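(* A predicate $p$ on $\mathbb N$ is recursively enumerable if and only if there is a closed well-formed RGA term $t$ such that for all $n\in\mathbb N$: $p(n)$ holds if and only if $\emptyset\vdash t\cdot\underline n$ is derivable in RGA.
   Context: **Terms.** Raw terms are: variables $v_i$ ($i\in\mathbb N$, de Bruijn indices), and operator nodes, each consisting of an operator code, a binder count $k\in\mathbb N$ and a finite list of raw terms as arguments, in each of which the $k$ lowest indices are bound. RGA has ten operators: constants $\bot$, $\mathbf 0$, $\mathcal R$ (recursor), $\mathcal A$ (universal quantifier combinator); unary $\mathbf S$, $\neg$; unary $\lambda$ (binder count 1, the only binder); binary $=$, $\lor$, and application $\cdot$ (left associative). A term $t$ is well-formed, $\mathrm{wf}(t)$, iff it is built from variables and these ten operators at these arities and binder counts. "Term" means raw term; formulas are just terms. Closed means having no free variables. $\underline n=\mathbf S^n\mathbf 0$ is the numeral of $n$. $[v_i\mapsto s]t$ (also $[i\mapsto s]t$): capture-avoiding replacement of the free variable $v_i$ by $s$, other free variables unchanged. $b[t]$: $\beta$-instance, replacing index $0$ in $b$ by $t$ and decrementing all other free indices. $\uparrow t$: all free indices increased by one; $\uparrow\Gamma$ elementwise. $\mathrm{fv}$: set of free variables. Abbreviations: $t\neq u:=\neg(t=u)$; $t\,\mathsf N:=(t=t)$; $t\,\mathsf B:=(t\lor\neg t)$; $t\land u:=\neg(\neg t\lor\neg u)$. **Head steps** $t\triangleright t'$ (syntactic relation): $(\lambda b)\cdot t\triangleright b[t]$ if $\mathrm{wf}(t)$; $\mathcal R\cdot g\cdot h\cdot\mathbf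 0\triangleright g$ if $\mathrm{wf}(h)$; $\mathcal R\cdot g\cdot h\cdot(\mathbf S\,\underline n)\triangleright h\cdot\underline n\cdot(\mathcal R\cdot g\cdot h\cdot\underline n)$ if $\mathrm{wf}(g)$; and $t\cdot u\triangleright t'\cdot u$ if $t\triangleright t'$. **Proofs.** A judgment $\Gamma\vdash c$ has a finite set $\Gamma$ of terms and a term $c$. A proof is a finite list of judgments each following from earlier entries by one rule below; a judgment is derivable if some proof contains it. Writing $\Gamma\vdash c$ as an assertion means derivability. Rules ($\Rightarrow$ from premises to conclusion, $\Leftrightarrow$ both directions): Structural: $\mathrm{wf}(c)\Rightarrow\Gamma,c\vdash c$; $\Gamma\vdash c\Rightarrow\Gamma,a\vdash c$; $\Gamma\vdash a$ and $\Gamma,a\vdash c\Rightarrow\Gamma\vdash c$; $\Gamma\vdash c$ with $\Gamma,c,s$ well-formed $\Rightarrow[v\mapsto s]\Gamma\vdash[v\mapsto s]c$. Truth values: $\Gamma\vdash a\Leftrightarrow\Gamma\vdash a=\underline 1$; $\Gamma\vdash\neg a\Leftrightarrow\Gamma\vdash a=\underline 0$. Negation: $\Gamma\vdash\neg a$, $\Gamma\vdash a$, $\mathrm{wf}(c)\Rightarrow\Gamma\vdash c$; $\Gamma\vdash a\Leftrightarrow\Gamma\vdash\neg\neg a$. Disjunction: $\Gamma\vdash a$, $\mathrm{wf}(b)\Rightarrow\Gamma\vdash a\lor b$; $\Gamma\vdash b$, $\mathrm{wf}(a)\Rightarrow\Gamma\vdash a\lor b$; $\Gamma\vdash\neg a$,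 $\Gamma\vdash\neg b\Rightarrow\Gamma\vdash\neg(a\lor b)$; $\Gamma\vdash a\lor b$, $\Gamma,a\vdash c$, $\Gamma,b\vdash c\Rightarrow\Gamma\vdash c$; $\Gamma\vdash\neg(a\lor b)\Rightarrow\Gamma\vdash\neg a$, and $\Rightarrow\Gamma\vdash\neg b$. Equality: $\Gamma\vdash a\,\mathsf N\Leftrightarrow\Gamma\vdash a=a$; $\Gamma\vdash a=b\Rightarrow\Gamma\vdash b=a$; $\Gamma\vdash a=b$, $\Gamma\vdash[v\mapsto a]p$, $\mathrm{wf}(p)\Rightarrow\Gamma\vdash[v\mapsto b]p$; $\Gamma\vdash a\ne b\Rightarrow\Gamma\vdash b\ne a$; $\Gamma\vdash a\,\mathsf N$, $\Gamma\vdash b\,\mathsf N\Rightarrow\Gamma\vdash(a=b)\,\mathsf B$; $\Gamma\vdash(a=b)\,\mathsf B\Rightarrow\Gamma\vdash(a\,\mathsf N)\land(b\,\mathsf N)$. Naturals: $\Gamma\vdash\mathbf 0\,\mathsf N$; $\Gamma\vdash a\,\mathsf N\Leftrightarrow\Gamma\vdash\mathbf S a\,\mathsf N$; $\Gamma\vdash a\,\mathsf N\Rightarrow\Gamma\vdash\mathbf S a\ne\mathbf 0$; $\Gamma\vdash a\ne b\Leftrightarrow\Gamma\vdash\mathbf S a\ne\mathbf S b$; $\Gamma\vdash\mathbf S a=\mathbf S b\Rightarrow\Gamma\vdash a=b$; $\Gamma\vdash\bot\,\mathsf N$, $\mathrm{wf}(p)\Rightarrow\Gamma\vdash p$. Induction: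 $\Gamma\vdash[i\mapsto\mathbf 0]c$; $v_i\,\mathsf N,c,\Gamma\vdash[i\mapsto\mathbf S v_i]c$; $\Gamma\vdash a\,\mathsf N$; $\mathrm{wf}(c)$; $i\notin\mathrm{fv}(\Gamma)$ $\Rightarrow\Gamma\vdash[i\mapsto a]c$. Conversion: if $c\triangleright c'$: $\Gamma\vdash c'\Leftrightarrow\Gamma\vdash c$; $\Gamma\vdash c'\,\mathsf N\Rightarrow\Gamma\vdash c=c'$. Recursor: $\Gamma\vdash m\,\mathsf N$, $\Gamma\vdash(h\cdot m\cdot(\mathcal R\cdot g\cdot h\cdot m))\,\mathsf N$, $\mathrm{wf}(g)\Rightarrow\Gamma\vdash\mathcal R\cdot g\cdot h\cdot(\mathbf S m)=h\cdot m\cdot(\mathcal R\cdot g\cdot h\cdot m)$. Quantifier: $v_0\,\mathsf N,\uparrow\Gamma\vdash\uparrow f\cdot v_0\Rightarrow\Gamma\vdash\mathcal A\cdot f$; $\Gamma\vdash\mathcal A\cdot f$, $\Gamma\vdash a\,\mathsf N\Rightarrow\Gamma\vdash f\cdot a$; $\Gamma\vdash\neg(f\cdot a)$, $\Gamma\vdash a\,\mathsf N\Rightarrow\Gamma\vdash\neg(\mathcal A\cdot f)$; $\Gamma\vdash\neg(\mathcal A\cdot f)$ and $v_0\,\mathsf N,\neg(\uparrow f\cdot v_0),\uparrow\Gamma\vdash\uparrow c\Rightarrow\Gamma\vdash c$. A predicate on $\mathbb N$ is recursively enumerable if it is the termination domain of a general-recursive computation. *)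

theory Defs
  imports Main "HOL-Library.FSet"
begin

section \<open>Raw terms\<close>

text \<open>\<open>Op c k ts\<close> is an operator node with code \<open>c\<close>; the \<open>k\<close> lowest de Bruijn indices are bound in
  every argument. Operator codes are arbitrary naturals, so raw terms also include nodes that
  are not built from the ten operators of RGA.\<close>

datatype rterm = Var nat | Op nat nat "rterm list"

abbreviation Bot :: rterm where "Bot \<equiv> Op 0 0 []"
abbreviation Zer :: rterm where "Zer \<equiv> Op 1 0 []"
abbreviation Rcs :: rterm where "Rcs \<equiv> Op 2 0 []"
abbreviation All :: rterm where "All \<equiv> Op 3 0 []"
abbreviation SS :: "rterm \<Rightarrow> rterm" where "SS t \<equiv> Op 4 0 [t]"
abbreviation Neg :: "rterm \<Rightarrow> rterm" where "Neg t \<equiv> Op 5 0 [t]"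
abbreviation Lam :: "rterm \<Rightarrow> rterm" where "Lam t \<equiv> Op 6 1 [t]"
abbreviation Eq :: "rterm \<Rightarrow> rterm \<Rightarrow> rterm" (infix "\<doteq>" 65) where "t \<doteq> u \<equiv> Op 7 0 [t, u]"
abbreviation Or :: "rterm \<Rightarrow> rterm \<Rightarrow> rterm" (infixr "\<^bold>\<or>" 60) where "t \<^bold>\<or> u \<equiv> Op 8 0 [t, u]"
abbreviation App :: "rterm \<Rightarrow> rterm \<Rightarrow> rterm" (infixl "\<cdot>" 90) where "t \<cdot> u \<equiv> Op 9 0 [t, u]"

abbreviation Neq :: "rterm \<Rightarrow> rterm \<Rightarrow> rterm" (infix "\<^bold>\<noteq>" 65) where "t \<^bold>\<noteq> u \<equiv> Neg (t \<doteq> u)"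
abbreviation And :: "rterm \<Rightarrow> rterm \<Rightarrow> rterm" (infixr "\<^bold>\<and>" 62)
  where "t \<^bold>\<and> u \<equiv> Neg (Neg t \<^bold>\<or> Neg u)"
abbreviation isN :: "rterm \<Rightarrow> rterm" where "isN t \<equiv> t \<doteq> t"
abbreviation isB :: "rterm \<Rightarrow> rterm" where "isB t \<equiv> t \<^bold>\<or> Neg t"

primrec num :: "nat \<Rightarrow> rterm" where
  "num 0 = Zer"
| "num (Suc n) = SS (num n)"

inductive wf_term :: "rterm \<Rightarrow> bool" where
  "wf_term (Var i)"
| "wf_term Bot"
| "wf_term Zer"
| "wf_term Rcs"
| "wf_term All"
| "wf_term t \<Longrightarrow> wf_term (SS t)"
| "wf_term t \<Longrightarrow> wf_term (Neg t)"
| "wf_term t \<Longrightarrow> wf_term (Lam t)"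
| "wf_term t \<Longrightarrow> wf_term u \<Longrightarrow> wf_term (t \<doteq> u)"
| "wf_term t \<Longrightarrow> wf_term u \<Longrightarrow> wf_term (t \<^bold>\<or> u)"
| "wf_term t \<Longrightarrow> wf_term u \<Longrightarrow> wf_term (t \<cdot> u)"

fun fv :: "rterm \<Rightarrow> nat set" where
  "fv (Var i) = {i}"
| "fv (Op c k ts) = {i. \<exists>t \<in> set ts. i + k \<in> fv t}"

definition closed_term :: "rterm \<Rightarrow> bool" where
  "closed_term t \<longleftrightarrow> fv t = {}"

text \<open>\<open>shift d c t\<close> increases by \<open>d\<close> all indices of \<open>t\<close> that are free and at least \<open>c\<close>.\<close>

fun shift :: "nat \<Rightarrow> nat \<Rightarrow> rterm \<Rightarrow> rterm" where
  "shift d c (Var i) = Var (if i < c then i else i + d)"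
| "shift d c (Op f k ts) = Op f k (map (shift d (c + k)) ts)"

abbreviation up :: "rterm \<Rightarrow> rterm" where "up \<equiv> shift 1 0"

text \<open>\<open>repl i s t\<close> is \<open>[v\<^sub>i \<mapsto> s]t\<close>: other free variables are not renumbered.\<close>

fun repl :: "nat \<Rightarrow> rterm \<Rightarrow> rterm \<Rightarrow> rterm" where
  "repl i s (Var j) = (if j = i then s else Var j)"
| "repl i s (Op c k ts) = Op c k (map (repl (i + k) (shift k 0 s)) ts)"

text \<open>\<open>inst i s t\<close> removes index \<open>i\<close> from \<open>t\<close>, replacing it by \<open>s\<close> and decrementing the larger free
  indices; the \<open>\<beta>\<close>-instance \<open>b[t]\<close> is \<open>inst 0 t b\<close>.\<close>

fun inst :: "nat \<Rightarrow> rterm \<Rightarrow> rterm \<Rightarrow> rterm" where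
  "inst i s (Var j) = (if j < i then Var j else if j = i then s else Var (j - 1))"
| "inst i s (Op c k ts) = Op c k (map (inst (i + k) (shift k 0 s)) ts)"

inductive head_step :: "rterm \<Rightarrow> rterm \<Rightarrow> bool" (infix "\<triangleright>" 50) where
  beta: "wf_term t \<Longrightarrow> Lam b \<cdot> t \<triangleright> inst 0 t b"
| rec_zero: "wf_term h \<Longrightarrow> Rcs \<cdot> g \<cdot> h \<cdot> Zer \<triangleright> g"
| rec_suc: "wf_term g \<Longrightarrow> Rcs \<cdot> g \<cdot> h \<cdot> SS (num n) \<triangleright> h \<cdot> num n \<cdot> (Rcs \<cdot> g \<cdot> h \<cdot> num n)"
| app: "t \<triangleright> t' \<Longrightarrow> t \<cdot> u \<triangleright> t' \<cdot> u"


section \<open>Proofs\<close>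

datatype sequent = Sequent "rterm fset" rterm (infix "\<turnstile>" 55)

text \<open>\<open>rule ps j\<close>: the sequent \<open>j\<close> is the conclusion of an instance of an inference rule with
  premises \<open>ps\<close>.\<close>

inductive rule :: "sequent list \<Rightarrow> sequent \<Rightarrow> bool" where
  hyp: "wf_term c \<Longrightarrow> rule [] (finsert c \<Gamma> \<turnstile> c)"
| weaken: "rule [\<Gamma> \<turnstile> c] (finsert a \<Gamma> \<turnstile> c)"
| cut: "rule [\<Gamma> \<turnstile> a, finsert a \<Gamma> \<turnstile> c] (\<Gamma> \<turnstile> c)"
| substitution: "(\<forall>a. a |\<in>| \<Gamma> \<longrightarrow> wf_term a) \<Longrightarrow> wf_term c \<Longrightarrow> wf_term s \<Longrightarrow>
    rule [\<Gamma> \<turnstile> c] (repl v s |`| \<Gamma> \<turnstile> repl v s c)"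

| true1: "rule [\<Gamma> \<turnstile> a] (\<Gamma> \<turnstile> a \<doteq> num 1)"
| true2: "rule [\<Gamma> \<turnstile> a \<doteq> num 1] (\<Gamma> \<turnstile> a)"
| false1: "rule [\<Gamma> \<turnstile> Neg a] (\<Gamma> \<turnstile> a \<doteq> num 0)"
| false2: "rule [\<Gamma> \<turnstile> a \<doteq> num 0] (\<Gamma> \<turnstile> Neg a)"

| neg_elim: "wf_term c \<Longrightarrow> rule [\<Gamma> \<turnstile> Neg a, \<Gamma> \<turnstile> a] (\<Gamma> \<turnstile> c)"
| neg_neg1: "rule [\<Gamma> \<turnstile> a] (\<Gamma> \<turnstile> Neg (Neg a))"
| neg_neg2: "rule [\<Gamma> \<turnstile> Neg (Neg a)] (\<Gamma> \<turnstile> a)"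

| or_intro1: "wf_term b \<Longrightarrow> rule [\<Gamma> \<turnstile> a] (\<Gamma> \<turnstile> a \<^bold>\<or> b)"
| or_intro2: "wf_term a \<Longrightarrow> rule [\<Gamma> \<turnstile> b] (\<Gamma> \<turnstile> a \<^bold>\<or> b)"
| nor_intro: "rule [\<Gamma> \<turnstile> Neg a, \<Gamma> \<turnstile> Neg b] (\<Gamma> \<turnstile> Neg (a \<^bold>\<or> b))"
| or_elim: "rule [\<Gamma> \<turnstile> a \<^bold>\<or> b, finsert a \<Gamma> \<turnstile> c, finsert b \<Gamma> \<turnstile> c] (\<Gamma> \<turnstile> c)"
| nor_elim1: "rule [\<Gamma> \<turnstile> Neg (a \<^bold>\<or> b)] (\<Gamma> \<turnstile> Neg a)"
| nor_elim2: "rule [\<Gamma> \<turnstile> Neg (a \<^bold>\<or> b)] (\<Gamma> \<turnstile> Neg b)"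

| nat_eq1: "rule [\<Gamma> \<turnstile> isN a] (\<Gamma> \<turnstile> a \<doteq> a)"
| nat_eq2: "rule [\<Gamma> \<turnstile> a \<doteq> a] (\<Gamma> \<turnstile> isN a)"
| eq_sym: "rule [\<Gamma> \<turnstile> a \<doteq> b] (\<Gamma> \<turnstile> b \<doteq> a)"
| eq_subst: "wf_term p \<Longrightarrow> rule [\<Gamma> \<turnstile> a \<doteq> b, \<Gamma> \<turnstile> repl v a p] (\<Gamma> \<turnstile> repl v b p)"
| neq_sym: "rule [\<Gamma> \<turnstile> a \<^bold>\<noteq> b] (\<Gamma> \<turnstile> b \<^bold>\<noteq> a)"
| eq_bool1: "rule [\<Gamma> \<turnstile> isN a, \<Gamma> \<turnstile> isN b] (\<Gamma> \<turnstile> isB (a \<doteq> b))"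
| eq_bool2: "rule [\<Gamma> \<turnstile> isB (a \<doteq> b)] (\<Gamma> \<turnstile> isN a \<^bold>\<and> isN b)"

| zero_nat: "rule [] (\<Gamma> \<turnstile> isN Zer)"
| suc_nat1: "rule [\<Gamma> \<turnstile> isN a] (\<Gamma> \<turnstile> isN (SS a))"
| suc_nat2: "rule [\<Gamma> \<turnstile> isN (SS a)] (\<Gamma> \<turnstile> isN a)"
| suc_neq_zero: "rule [\<Gamma> \<turnstile> isN a] (\<Gamma> \<turnstile> SS a \<^bold>\<noteq> Zer)"
| suc_neq1: "rule [\<Gamma> \<turnstile> a \<^bold>\<noteq> b] (\<Gamma> \<turnstile> SS a \<^bold>\<noteq> SS b)"
| suc_neq2: "rule [\<Gamma> \<turnstile> SS a \<^bold>\<noteq> SS b] (\<Gamma> \<turnstile> a \<^bold>\<noteq> b)"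
| suc_inj: "rule [\<Gamma> \<turnstile> SS a \<doteq> SS b] (\<Gamma> \<turnstile> a \<doteq> b)"
| bot_elim: "wf_term p \<Longrightarrow> rule [\<Gamma> \<turnstile> isN Bot] (\<Gamma> \<turnstile> p)"

| induction: "wf_term c \<Longrightarrow> (\<forall>b. b |\<in>| \<Gamma> \<longrightarrow> i \<notin> fv b) \<Longrightarrow>
    rule [\<Gamma> \<turnstile> repl i Zer c,
          finsert (isN (Var i)) (finsert c \<Gamma>) \<turnstile> repl i (SS (Var i)) c,
          \<Gamma> \<turnstile> isN a]
      (\<Gamma> \<turnstile> repl i a c)"

| conv1: "c \<triangleright> c' \<Longrightarrow> rule [\<Gamma> \<turnstile> c'] (\<Gamma> \<turnstile> c)"
| conv2: "c \<triangleright> c' \<Longrightarrow> rule [\<Gamma> \<turnstile> c] (\<Gamma> \<turnstile> c')"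
| conv_eq: "c \<triangleright> c' \<Longrightarrow> rule [\<Gamma> \<turnstile> isN c'] (\<Gamma> \<turnstile> c \<doteq> c')"

| recursor: "wf_term g \<Longrightarrow>
    rule [\<Gamma> \<turnstile> isN m, \<Gamma> \<turnstile> isN (h \<cdot> m \<cdot> (Rcs \<cdot> g \<cdot> h \<cdot> m))]
      (\<Gamma> \<turnstile> Rcs \<cdot> g \<cdot> h \<cdot> SS m \<doteq> h \<cdot> m \<cdot> (Rcs \<cdot> g \<cdot> h \<cdot> m))"

| all_intro: "rule [finsert (isN (Var 0)) (up |`| \<Gamma>) \<turnstile> up f \<cdot> Var 0] (\<Gamma> \<turnstile> All \<cdot> f)"
| all_elim: "rule [\<Gamma> \<turnstile> All \<cdot> f, \<Gamma> \<turnstile> isN a] (\<Gamma> \<turnstile> f \<cdot> a)"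
| not_all_intro: "rule [\<Gamma> \<turnstile> Neg (f \<cdot> a), \<Gamma> \<turnstile> isN a] (\<Gamma> \<turnstile> Neg (All \<cdot> f))"
| not_all_elim:
    "rule [\<Gamma> \<turnstile> Neg (All \<cdot> f),
           finsert (isN (Var 0)) (finsert (Neg (up f \<cdot> Var 0)) (up |`| \<Gamma>)) \<turnstile> up c]
      (\<Gamma> \<turnstile> c)"

definition is_proof :: "sequent list \<Rightarrow> bool" where
  "is_proof js \<longleftrightarrow> (\<forall>i < length js. \<exists>ps. set ps \<subseteq> set (take i js) \<and> rule ps (js ! i))"

definition derivable :: "sequent \<Rightarrow> bool" where
  "derivable j \<longleftrightarrow> (\<exists>js. is_proof js \<and> j \<in> set js)"


section \<open>Recursively enumerable predicates\<close>

text \<open>General-recursive computations are rendered as Kleene's partial recursive functions.\<close>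

datatype recf = RZero | RSucc | RProj nat | RComp recf "recf list" | RPrim recf recf | RMu recf

inductive has_arity :: "nat \<Rightarrow> recf \<Rightarrow> bool" where
  "has_arity k RZero"
| "has_arity 1 RSucc"
| "i < k \<Longrightarrow> has_arity k (RProj i)"
| "has_arity (length gs) f \<Longrightarrow> (\<forall>g \<in> set gs. has_arity k g) \<Longrightarrow> has_arity k (RComp f gs)"
| "has_arity k f \<Longrightarrow> has_arity (k + 2) g \<Longrightarrow> has_arity (k + 1) (RPrim f g)"
| "has_arity (k + 1) f \<Longrightarrow> has_arity k (RMu f)"

text \<open>\<open>computes f xs y\<close>: the computation of \<open>f\<close> on the arguments \<open>xs\<close> terminates with result \<open>y\<close>.
  Minimisation requires \<open>f\<close> to be defined at all arguments below the least zero.\<close>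

inductive computes :: "recf \<Rightarrow> nat list \<Rightarrow> nat \<Rightarrow> bool" where
  "computes RZero xs 0"
| "computes RSucc [x] (Suc x)"
| "i < length xs \<Longrightarrow> computes (RProj i) xs (xs ! i)"
| "list_all2 (\<lambda>g y. computes g xs y) gs ys \<Longrightarrow> computes f ys z \<Longrightarrow> computes (RComp f gs) xs z"
| "computes f xs y \<Longrightarrow> computes (RPrim f g) (0 # xs) y"
| "computes (RPrim f g) (n # xs) r \<Longrightarrow> computes g (n # r # xs) y \<Longrightarrow>
    computes (RPrim f g) (Suc n # xs) y"
| "computes f (n # xs) 0 \<Longrightarrow> (\<forall>m < n. \<exists>y. computes f (m # xs) (Suc y)) \<Longrightarrow>
    computes (RMu f) xs n"

definition rec_enum :: "(nat \<Rightarrow> bool) \<Rightarrow> bool" where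
  "rec_enum p \<longleftrightarrow> (\<exists>f. has_arity 1 f \<and> (\<forall>n. p n \<longleftrightarrow> (\<exists>y. computes f [n] y)))"

end

theory Submission
  imports Defs "HOL-Library.Nat_Bijection"
begin

text \<open>
  Representability. Closed terms are evaluated by an infinitary big-step semantics in which
  the quantifier combinator ranges over all numerals and the recursor forces its numeric argument. Values are
  unique, and replacing a closed subterm by another one with the same value does not change the
  value of a term: a term with a value is stuck when applied, so a replaced subterm never occurs
  in head position of an evaluating application. Hence all rules preserve truth under closed
  substitutions. For a recursive function \<open>f\<close> there is a \<open>\<Sigma>\<close>-formula for its graph that is
  derivable where \<open>f\<close> is defined with the given value, and true only there; by soundness,
  derivability, truth and computability coincide.

  Recursive enumerability. Derivability, together with all syntactic side conditions, is the least
  model of a finite set of Horn clauses over the natural numbers with pairing. The least model of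
  such a program is exhausted by finite stages that are computed by primitive recursion.
\<close>

text \<open>Terms are untyped, so there is no evident function space in which to interpret
  application. A partial evaluation relation takes its place; a term without a value is neither true
  nor false. Its quantifier clause has infinitely many premises, because introducing
  \<open>All\<close> is sound only if every numeral is covered. Truth in this sense goes beyond what
  can be enumerated, so the converse half does not pass through the semantics but enumerates
  derivations themselves. Writing derivability as Horn clauses means that only one recursive
  procedure is built, forward chaining for an arbitrary program, instead of one each for shifting,
  replacement, instantiation and proof search. The obstacle to soundness is equality: equal terms
  may be exchanged in arbitrary contexts, also below binders, while a true equation only says that
  both sides have the same number as value. In the representability half nothing is ever refuted:
  where \<open>p n\<close> fails, soundness alone excludes a derivation. Hence the asymmetric notion
  \<open>tv\<close>.\<close>

section \<open>Evaluation of terms\<close>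

text \<open>Operator codes and binder counts are written as literal numerals; unfolding
  \<open>1\<close> would hide them from the simplifier.\<close>
declare One_nat_def [simp del]

section \<open>Free variables, shifting and instantiation of raw terms\<close>

lemma closed_num [simp]: "fv (num n) = {}"
  by (induction n) auto

text \<open>Closedness is not inherited by the arguments of a binder, but this bound is: it grows by
  the binder count. Facts about closed terms are therefore proved with \<open>{..<n}\<close> in
  place of the empty set.\<close>

lemma fv_Op_le: "fv (Op c k ts) \<subseteq> {..<n} \<longleftrightarrow> (\<forall>t \<in> set ts. fv t \<subseteq> {..<n + k})"
proof (intro iffI ballI subsetI)
  fix t j assume "fv (Op c k ts) \<subseteq> {..<n}" "t \<in> set ts" "j \<in> fv t"
  then show "j \<in> {..<n + k}"
    by (cases "j < k") (auto simp: subset_iff dest!: spec[of _ "j - k"])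
next
  fix i assume a: "\<forall>t \<in> set ts. fv t \<subseteq> {..<n + k}" "i \<in> fv (Op c k ts)"
  then obtain t where "t \<in> set ts" "i + k \<in> fv t" by auto
  with a(1) have "i + k \<in> {..<n + k}" by blast
  then show "i \<in> {..<n}" by simp
qed

lemma shift_ident: "fv t \<subseteq> {..<c} \<Longrightarrow> shift d c t = t"
proof (induction d c t rule: shift.induct)
  case (2 d c f k ts)
  then show ?case unfolding fv_Op_le by (auto intro: map_idI)
qed auto

lemma shift_closed: "fv t = {} \<Longrightarrow> shift d c t = t"
  by (rule shift_ident) simp

lemma repl_ident: "i \<notin> fv t \<Longrightarrow> repl i s t = t"
  by (induction i s t rule: repl.induct) (auto intro!: map_idI)

lemma inst_ident: "fv t \<subseteq> {..<i} \<Longrightarrow> inst i s t = t"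
proof (induction i s t rule: inst.induct)
  case (2 i s c k ts)
  then show ?case unfolding fv_Op_le by (auto intro: map_idI)
qed auto

lemma inst_closed: "fv t = {} \<Longrightarrow> inst i s t = t"
  by (rule inst_ident) simp

lemma shift_zero [simp]: "shift 0 c t = t"
  by (induction "0::nat" c t rule: shift.induct) (auto intro: map_idI)

lemma shift_shift: "c \<le> c' \<Longrightarrow> c' \<le> c + e \<Longrightarrow> shift d c' (shift e c t) = shift (e + d) c t"
  by (induction e c t arbitrary: c' rule: shift.induct) auto

text \<open>Only closed terms are substituted, so no shifting is needed under binders.\<close>

fun sb :: "nat \<Rightarrow> (nat \<Rightarrow> rterm) \<Rightarrow> rterm \<Rightarrow> rterm" where
  "sb k \<sigma> (Var j) = (if j < k then Var j else \<sigma> (j - k))"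
| "sb k \<sigma> (Op c m ts) = Op c m (map (sb (k + m) \<sigma>) ts)"

definition closing :: "(nat \<Rightarrow> rterm) \<Rightarrow> bool" where
  "closing \<sigma> \<longleftrightarrow> (\<forall>i. fv (\<sigma> i) = {})"

lemma fv_sb: "closing \<sigma> \<Longrightarrow> fv (sb k \<sigma> t) \<subseteq> {..<k}"
proof (induction t arbitrary: k)
  case (Op c m ts)
  then show ?case unfolding sb.simps fv_Op_le by auto
qed (auto simp: closing_def)

lemma fv_sb0: "closing \<sigma> \<Longrightarrow> fv (sb 0 \<sigma> t) = {}"
  using fv_sb[of \<sigma> 0 t] by simp

lemma sb_shift: "closing \<sigma> \<Longrightarrow> sb (d + c) \<sigma> (shift d c t) = shift d c (sb c \<sigma> t)"
proof (induction d c t rule: shift.induct)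
  case (1 d c i)
  then show ?case by (auto simp: closing_def shift_closed)
next
  case (2 d c f k ts)
  then show ?case by (auto simp: add.assoc)
qed

lemma sb_shift0: "closing \<sigma> \<Longrightarrow> sb d \<sigma> (shift d 0 t) = sb 0 \<sigma> t"
  using sb_shift[of \<sigma> d 0 t] by (simp add: shift_closed fv_sb0)

text \<open>The substitution lemma behind the beta step. After k binders the inserted term has
  become \<open>shift k 0 s\<close>; its closed image \<open>sb 0 \<sigma> s\<close> is invariant
  under shifting, so no shift is left on the right.\<close>

lemma sb_inst: "closing \<sigma> \<Longrightarrow>
   sb k \<sigma> (inst k (shift k 0 s) t) = inst k (sb 0 \<sigma> s) (sb (Suc k) \<sigma> t)"
proof (induction t arbitrary: k)
  case (Var j)
  then show ?case
    by (auto simp: sb_shift0 closing_def inst_closed not_less_eq less_Suc_eq One_nat_def)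
next
  case (Op c m ts)
  then show ?case by (auto simp: shift_shift add.commute shift_closed fv_sb0)
qed

lemma sb_repl: "closing \<sigma> \<Longrightarrow>
   sb k \<sigma> (repl (i + k) (shift k 0 s) t) = sb k (\<sigma>(i := sb 0 \<sigma> s)) t"
proof (induction t arbitrary: k)
  case (Var j)
  then show ?case by (auto simp: sb_shift0)
next
  case (Op c m ts)
  have "sb (k + m) \<sigma> (repl (i + (k + m)) (shift (k + m) 0 s) t) = sb (k + m) (\<sigma>(i := sb 0 \<sigma> s)) t"
    if "t \<in> set ts" for t
    using Op that by blast
  then show ?case by (simp add: shift_shift add.assoc del: fun_upd_apply)
qed

text \<open>Any rule phrased with \<open>repl\<close> becomes a change of one entry of the
  environment, so that substitution, induction and equality are checked by comparing
  environments.\<close>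

lemma sb_repl0: "closing \<sigma> \<Longrightarrow> sb 0 \<sigma> (repl i s t) = sb 0 (\<sigma>(i := sb 0 \<sigma> s)) t"
  using sb_repl[of \<sigma> 0 i s t] by simp

lemma sb_up: "sb k \<sigma> (shift 1 k t) = sb k (\<lambda>i. \<sigma> (Suc i)) t"
  by (induction "1::nat" k t rule: shift.induct) (auto simp: Suc_diff_le One_nat_def)

lemma sb_cong: "(\<And>i. i + k \<in> fv t \<Longrightarrow> \<sigma> i = \<tau> i) \<Longrightarrow> sb k \<sigma> t = sb k \<tau> t"
proof (induction t arbitrary: k)
  case (Var j)
  then show ?case by (cases "j < k") auto
next
  case (Op c m ts)
  have "sb (k + m) \<sigma> t = sb (k + m) \<tau> t" if "t \<in> set ts" for t
    by (rule Op.IH[OF that], rule Op.prems) (use that in \<open>auto simp: add.assoc\<close>)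
  then show ?case by auto
qed

lemma sb_closed: "fv t = {} \<Longrightarrow> sb k \<sigma> t = t"
proof -
  have "fv t \<subseteq> {..<k} \<Longrightarrow> sb k \<sigma> t = t" for k
  proof (induction t arbitrary: k)
    case (Op c m ts)
    then show ?case unfolding fv_Op_le by (auto intro: map_idI)
  qed auto
  then show "fv t = {} \<Longrightarrow> sb k \<sigma> t = t" by simp
qed

lemma sb_num [simp]: "sb k \<sigma> (num n) = num n"
  by (simp add: sb_closed)

text \<open>The relations are mutually recursive because a recursor may step only once its numeric
  argument has a value; it then continues with the numeral, however the argument was written. A
  disjunction can be true while one disjunct has no value, since or-introduction accepts any
  well-formed formula. \<open>Bot\<close> gets no clause: \<open>isN Bot\<close> must never become
  true.\<close>

inductive ev :: "rterm \<Rightarrow> nat \<Rightarrow> bool" and st :: "rterm \<Rightarrow> rterm \<Rightarrow> bool" where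
  ev_zero: "ev Zer 0"
| ev_suc: "ev t n \<Longrightarrow> ev (SS t) (Suc n)"
| ev_neg0: "ev t (Suc 0) \<Longrightarrow> ev (Neg t) 0"
| ev_neg1: "ev t 0 \<Longrightarrow> ev (Neg t) (Suc 0)"
| ev_eq: "ev a n \<Longrightarrow> ev b m \<Longrightarrow> ev (a \<doteq> b) (if n = m then Suc 0 else 0)"
| ev_or1: "ev a (Suc 0) \<Longrightarrow> ev (a \<^bold>\<or> b) (Suc 0)"
| ev_or2: "ev b (Suc 0) \<Longrightarrow> ev (a \<^bold>\<or> b) (Suc 0)"
| ev_or0: "ev a 0 \<Longrightarrow> ev b 0 \<Longrightarrow> ev (a \<^bold>\<or> b) 0"
| ev_all1: "(\<And>n. ev (f \<cdot> num n) (Suc 0)) \<Longrightarrow> ev (All \<cdot> f) (Suc 0)"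
| ev_all0: "ev (f \<cdot> num n) 0 \<Longrightarrow> ev (All \<cdot> f) 0"
| ev_st: "st t t' \<Longrightarrow> ev t' n \<Longrightarrow> ev t n"
| st_beta: "st (Lam b \<cdot> t) (inst 0 t b)"
| st_rec0: "ev m 0 \<Longrightarrow> st (Rcs \<cdot> g \<cdot> h \<cdot> m) g"
| st_recS: "ev m (Suc k) \<Longrightarrow> st (Rcs \<cdot> g \<cdot> h \<cdot> m) (h \<cdot> num k \<cdot> (Rcs \<cdot> g \<cdot> h \<cdot> num k))"
| st_app: "st t t' \<Longrightarrow> st (t \<cdot> u) (t' \<cdot> u)"

lemmas ev_whnf = ev_zero ev_suc ev_neg0 ev_neg1 ev_eq ev_or1 ev_or2 ev_or0 ev_all1 ev_all0

section \<open>Inversion and uniqueness of values and steps\<close>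

inductive_cases stE: "st t t'"
inductive_cases evE: "ev t n"
inductive_cases st_AppE: "st (a \<cdot> b) t'"
inductive_cases ev_AppE: "ev (a \<cdot> b) n"

lemma st_is_App: "st t t' \<Longrightarrow> \<exists>a b. t = a \<cdot> b"
  by (auto elim: stE)

lemma no_st [simp]: "\<not> st Bot t" "\<not> st Zer t" "\<not> st Rcs t" "\<not> st All t" "\<not> st (SS x) t" "\<not> st (Neg x) t"
  "\<not> st (Lam x) t" "\<not> st (x \<doteq> y) t" "\<not> st (x \<^bold>\<or> y) t"
  by (auto dest: st_is_App)

lemma no_st_app [simp]: "\<not> st (All \<cdot> f) t" "\<not> st (Rcs \<cdot> g) t" "\<not> st (Rcs \<cdot> g \<cdot> h) t"
  by (auto elim!: st_AppE)

lemma ev_SS [simp]: "ev (SS t) n \<longleftrightarrow> (\<exists>m. n = Suc m \<and> ev t m)"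
  by (rule iffI, erule evE) (auto dest: st_is_App intro: ev_whnf)

lemma ev_Zer [simp]: "ev Zer n \<longleftrightarrow> n = 0"
  by (rule iffI, erule evE) (auto dest: st_is_App intro: ev_whnf)

lemma ev_Neg [simp]: "ev (Neg t) n \<longleftrightarrow> n = 0 \<and> ev t (Suc 0) \<or> n = Suc 0 \<and> ev t 0"
  by (rule iffI, erule evE) (auto dest: st_is_App intro: ev_whnf)

lemma ev_Eq: "ev (a \<doteq> b) n \<longleftrightarrow> (\<exists>x y. ev a x \<and> ev b y \<and> n = (if x = y then Suc 0 else 0))"
  by (rule iffI, erule evE) (auto dest: st_is_App intro: ev_eq)

lemma ev_Or: "ev (a \<^bold>\<or> b) n \<longleftrightarrow> n = Suc 0 \<and> (ev a (Suc 0) \<or> ev b (Suc 0)) \<or> n = 0 \<and> ev a 0 \<and> ev b 0"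
  by (rule iffI, erule evE) (auto dest: st_is_App intro: ev_whnf)

lemma ev_All: "ev (All \<cdot> f) n \<longleftrightarrow>
    n = Suc 0 \<and> (\<forall>k. ev (f \<cdot> num k) (Suc 0)) \<or> n = 0 \<and> (\<exists>k. ev (f \<cdot> num k) 0)"
  by (rule iffI, erule evE) (auto dest: st_is_App intro: ev_whnf)

lemma no_ev [simp]: "\<not> ev Bot n" "\<not> ev Rcs n" "\<not> ev All n" "\<not> ev (Lam b) n"
    "\<not> ev (Rcs \<cdot> g) n" "\<not> ev (Rcs \<cdot> g \<cdot> h) n"
  by (rule notI, erule evE, simp_all)+

lemma ev_num [simp]: "ev (num k) n \<longleftrightarrow> n = k"
  by (induction k arbitrary: n) auto

text \<open>Every other evaluation clause concerns a term that cannot step, so the value of a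
  stepping term must come from \<open>ev_st\<close>.\<close>

lemma ev_stD:
  assumes "st t t'" "ev t n"
  shows "\<exists>t'. st t t' \<and> ev t' n"
proof (rule evE[OF assms(2)])
  show "\<exists>t'. st t t' \<and> ev t' n" if "st t t'" "ev t' n" for t' using that by blast
qed (use assms(1) in simp_all)

lemma st_Lam: "st (Lam b \<cdot> t) u \<longleftrightarrow> u = inst 0 t b"
  by (rule iffI, erule st_AppE) (auto intro: st_beta)

lemma st_Rcs: "st (Rcs \<cdot> g \<cdot> h \<cdot> m) t \<longleftrightarrow>
    ev m 0 \<and> t = g \<or> (\<exists>k. ev m (Suc k) \<and> t = h \<cdot> num k \<cdot> (Rcs \<cdot> g \<cdot> h \<cdot> num k))"
  by (rule iffI, erule st_AppE) (auto intro: st_rec0 st_recS)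

lemma st_appD: "st (t \<cdot> u) x \<Longrightarrow> st t t' \<Longrightarrow> \<exists>t''. st t t'' \<and> x = t'' \<cdot> u"
  by (erule st_AppE) auto

text \<open>Both claims are needed at once: a recursor steps in only one way because its numeric
  argument has only one value, and the value of a stepping term is unique because the step is. A
  disjunction cannot be both 1 and 0, since 0 would make the true disjunct 0 as well.\<close>

lemma ev_st_det: "ev t n \<Longrightarrow> \<forall>m. ev t m \<longrightarrow> m = n"
  "st t t' \<Longrightarrow> \<forall>t''. st t t'' \<longrightarrow> t'' = t'"
proof (induction rule: ev_st.inducts)
  case (ev_st t t' n)
  show ?case
  proof (intro allI impI)
    fix m assume "ev t m"
    from ev_stD[OF ev_st(1) this] ev_st(3,4) show "m = n" by blast
  qed
next
  case (ev_eq a n b m)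
  then show ?case unfolding ev_Eq by metis
next
  case (st_app t t' u)
  then show ?case by (metis st_appD)
next
  case (st_beta b t)
  then show ?case by (simp add: st_Lam)
next
  case (st_rec0 m g h)
  then show ?case unfolding st_Rcs by blast
next
  case (st_recS m k g h)
  then show ?case unfolding st_Rcs by blast
next
  case (ev_suc t n)
  then show ?case by (metis ev_SS)
next
  case (ev_neg0 t)
  then show ?case by (metis ev_Neg nat.distinct(1))
next
  case (ev_neg1 t)
  then show ?case by (metis ev_Neg nat.distinct(1))
next
  case (ev_or1 a b)
  then show ?case by (metis ev_Or nat.distinct(1))
next
  case (ev_or2 b a)
  then show ?case by (metis ev_Or nat.distinct(1))
next
  case (ev_or0 a b)
  then show ?case by (metis ev_Or nat.distinct(1))
next
  case (ev_all1 f)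
  then show ?case by (metis ev_All nat.distinct(1))
next
  case (ev_all0 f n)
  then show ?case by (metis ev_All nat.distinct(1))
qed simp

lemma ev_det: "ev t n \<Longrightarrow> ev t m \<Longrightarrow> m = n"
  using ev_st_det(1) by blast

lemma st_det: "st t t' \<Longrightarrow> st t t'' \<Longrightarrow> t'' = t'"
  using ev_st_det(2) by blast

text \<open>Steps being unique, values pass along them in both directions; this is what makes both
  conversion rules sound.\<close>

lemma ev_st_iff: "st t t' \<Longrightarrow> ev t n \<longleftrightarrow> ev t' n"
  by (metis ev_stD st_det ev_st)

text \<open>A term that has a value cannot be applied: its head normal form is no \<open>\<lambda>\<close>-abstraction.\<close>

definition stuck :: "rterm \<Rightarrow> bool" where
  "stuck t \<longleftrightarrow> (\<forall>us n. \<not> ev (foldl App t us) n)"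

text \<open>A syntactic condition that implies \<open>stuck\<close>: at the head of the spine stands
  a node on which no step acts even when applied, or \<open>All\<close> that already has its
  argument. Values reached without a step take this shape as soon as they are applied.\<close>

inductive blocked :: "rterm \<Rightarrow> bool" where
  "\<not> (\<exists>b. w = Lam b) \<Longrightarrow> \<not> (\<exists>x y. w = x \<cdot> y) \<Longrightarrow> w \<noteq> All \<Longrightarrow> w \<noteq> Rcs \<Longrightarrow> blocked (w \<cdot> u)"
| "blocked (All \<cdot> f \<cdot> u)"
| "blocked t \<Longrightarrow> blocked (t \<cdot> u)"

lemma blocked_not_eq: "blocked t \<Longrightarrow> t \<noteq> Lam b \<and> t \<noteq> All \<cdot> f \<and> t \<noteq> All \<and> t \<noteq> Rcs \<cdot> g \<cdot> h \<and> t \<noteq> Rcs \<cdot> g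
    \<and> t \<noteq> Rcs"
proof (induction arbitrary: b f g h rule: blocked.induct)
  case (3 t u)
  show ?case using 3(2)[of _ _ g h] 3(2)[of _ _ h f] by auto
qed auto

lemma blocked_no_st: "blocked t \<Longrightarrow> st t t' \<Longrightarrow> False"
proof (induction arbitrary: t' rule: blocked.induct)
  case (1 w u)
  then show ?case by (auto elim!: st_AppE dest: st_is_App)
next
  case (3 t u)
  from 3(3) show ?case by (rule st_AppE) (use blocked_not_eq[OF 3(1)] 3(2) in blast)+
qed (auto elim!: st_AppE)

lemma blocked_no_ev: "blocked t \<Longrightarrow> \<not> ev t n"
proof
  assume b: "blocked t" and e: "ev t n"
  obtain x y where t: "t = x \<cdot> y" using b by cases auto
  from e[unfolded t] show False
    by (rule ev_AppE) (metis t blocked_not_eq[OF b] blocked_no_st[OF b])+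
qed

lemma blocked_stuck: "blocked t \<Longrightarrow> stuck t"
proof -
  have "blocked t \<Longrightarrow> blocked (foldl App t us)" for us
    by (induction us arbitrary: t) (simp_all add: blocked.intros(3))
  then show "blocked t \<Longrightarrow> stuck t" by (auto simp: stuck_def blocked_no_ev)
qed

lemma stuck_foldl: "stuck t \<Longrightarrow> \<not> ev (foldl App t us) n"
  by (simp add: stuck_def)

lemma stuck_app: "stuck t \<Longrightarrow> stuck (t \<cdot> u)"
  using stuck_foldl[of t "u # us" for us] by (simp add: stuck_def)

lemma stuck_no_ev: "stuck t \<Longrightarrow> \<not> ev t n"
  using stuck_foldl[of t "[]"] by simp

lemma st_foldl: "st t t' \<Longrightarrow> st (foldl App t us) (foldl App t' us)"
proof (induction us arbitrary: t t')
  case (Cons u us)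
  from Cons.IH[OF st_app[OF Cons.prems]] show ?case by simp
qed simp

lemma stuck_st:
  assumes "st t t'" "stuck t'"
  shows "stuck t"
  unfolding stuck_def ev_st_iff[OF st_foldl[OF assms(1)]]
  using assms(2) by (simp add: stuck_def)

text \<open>By \<open>stuck_st\<close>, stuckness passes from the result of a step back to its
  start, so only values found without a step remain to be considered, and these are
  \<open>blocked\<close> once an argument is supplied.\<close>

lemma ev_stuck: "ev a n \<Longrightarrow> stuck (a \<cdot> u)"
proof (induction arbitrary: u rule: ev_st.inducts(1)[where ?P2.0 = "\<lambda>_ _. True"])
  case (ev_st t t' n)
  from stuck_st[OF st_app[OF ev_st(1)] ev_st(4)] show ?case .
next
  case (ev_all1 f)
  then show ?case by (intro blocked_stuck blocked.intros(2))
next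
  case (ev_all0 f n)
  then show ?case by (intro blocked_stuck blocked.intros(2))
qed (simp_all add: blocked_stuck blocked.intros(1))

text \<open>Related terms differ by exchanging closed subterms of equal value, possibly below
  binders. Closedness of both sides in \<open>base\<close> makes the relation stable under shifting
  and instantiation, hence under beta steps.\<close>

inductive cong :: "rterm \<Rightarrow> rterm \<Rightarrow> bool" where
  base: "fv a = {} \<Longrightarrow> fv b = {} \<Longrightarrow> ev a n \<Longrightarrow> ev b n \<Longrightarrow> cong a b"
| var: "cong (Var i) (Var i)"
| op: "list_all2 cong ts us \<Longrightarrow> cong (Op c k ts) (Op c k us)"

lemma cong_refl: "cong t t"
  by (induction t) (auto intro!: cong.intros simp: list_all2_same)

lemma cong_shift: "cong t u \<Longrightarrow> cong (shift d c t) (shift d c u)"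
proof (induction arbitrary: c rule: cong.induct)
  case (base a b n)
  then show ?case by (auto simp: shift_closed intro: cong.base)
next
  case (op ts us f k)
  then show ?case by (auto intro!: cong.op simp: list_all2_conv_all_nth)
qed (auto intro: cong.intros)

lemma cong_inst: "cong t u \<Longrightarrow> cong s s' \<Longrightarrow> cong (inst i s t) (inst i s' u)"
proof (induction arbitrary: i s s' rule: cong.induct)
  case (base a b n)
  then show ?case by (auto simp: inst_closed intro: cong.base)
next
  case (op ts us f k)
  then show ?case by (auto intro!: cong.op simp: cong_shift list_all2_conv_all_nth)
qed (auto intro: cong.intros)

lemma cong_App: "cong a b \<Longrightarrow> cong c d \<Longrightarrow> cong (a \<cdot> c) (b \<cdot> d)"
  by (auto intro: cong.op)

inductive_cases cong_OpE: "cong (Op c k ts) u"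

lemma cong_OpD: "cong (Op c k ts) u \<Longrightarrow>
    (\<exists>n. ev (Op c k ts) n \<and> ev u n) \<or> (\<exists>us. u = Op c k us \<and> list_all2 cong ts us)"
  by (erule cong_OpE) auto

lemma cong_AppD: "cong (a \<cdot> b) u \<Longrightarrow>
    (\<exists>n. ev (a \<cdot> b) n \<and> ev u n) \<or> (\<exists>a' b'. u = a' \<cdot> b' \<and> cong a a' \<and> cong b b')"
  by (drule cong_OpD) (auto simp: list_all2_Cons1)

lemma cong_UnD: "cong (Op c k [a]) u \<Longrightarrow>
    (\<exists>n. ev (Op c k [a]) n \<and> ev u n) \<or> (\<exists>a'. u = Op c k [a'] \<and> cong a a')"
  by (drule cong_OpD) (auto simp: list_all2_Cons1)

lemma cong_BinD: "cong (Op c k [a, b]) u \<Longrightarrow>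
    (\<exists>n. ev (Op c k [a, b]) n \<and> ev u n) \<or> (\<exists>a' b'. u = Op c k [a', b'] \<and> cong a a' \<and> cong b b')"
  by (drule cong_OpD) (auto simp: list_all2_Cons1)

lemma cong_constD: "cong (Op c k []) u \<Longrightarrow> \<forall>n. \<not> ev (Op c k []) n \<Longrightarrow> u = Op c k []"
  by (drule cong_OpD) auto

lemma cong_LamD: "cong (Lam b) u \<Longrightarrow> \<exists>b'. u = Lam b' \<and> cong b b'"
  by (drule cong_OpD) (auto simp: list_all2_Cons1)

lemma cong_RcsD: "cong (Rcs \<cdot> g \<cdot> h) u \<Longrightarrow> \<exists>g' h'. u = Rcs \<cdot> g' \<cdot> h' \<and> cong g g' \<and> cong h h'"
  using cong_AppD[of "Rcs \<cdot> g" h] cong_AppD[of Rcs g] cong_constD[of 2 0] no_ev by metis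

lemma cong_All_appD: "cong (All \<cdot> f) u \<Longrightarrow>
    (\<exists>n. ev (All \<cdot> f) n \<and> ev u n) \<or> (\<exists>f'. u = All \<cdot> f' \<and> cong f f')"
  using cong_AppD[of All f] cong_constD[of 3 0] no_ev by metis

text \<open>A step need not be answered by a step. If the whole term was exchanged at
  \<open>base\<close>, both sides share a value already; if a subterm in head position was
  exchanged, the application is stuck. The second claim lists these three outcomes. Once the term is
  known to have a value the third is impossible, which is how the case \<open>ev_st\<close> uses
  it.\<close>

lemma cong_ev_aux: "ev t n \<Longrightarrow> \<forall>u. cong t u \<longrightarrow> ev u n"
  "st t t' \<Longrightarrow> \<forall>u. cong t u \<longrightarrow> (\<exists>u'. st u u' \<and> cong t' u') \<or> (\<exists>n. ev t n \<and> ev u n) \<or> stuck t"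
proof (induction rule: ev_st.inducts)
  case ev_zero
  then show ?case using cong_constD[of 1 0] by (metis ev_Zer cong_OpD list_all2_Nil)
next
  case (ev_suc t n)
  from ev_st.ev_suc[OF ev_suc(1)] have e: "ev (SS t) (Suc n)" .
  show ?case
  proof (intro allI impI)
    fix u assume "cong (SS t) u"
    from cong_UnD[OF this] e show "ev u (Suc n)"
      by (metis ev_suc.IH ev_det ev_st.ev_suc)
  qed
next
  case (ev_neg0 t)
  from ev_st.ev_neg0[OF ev_neg0(1)] have e: "ev (Neg t) 0" .
  show ?case
  proof (intro allI impI)
    fix u assume "cong (Neg t) u"
    from cong_UnD[OF this] e show "ev u 0"
      by (metis ev_neg0.IH ev_det ev_st.ev_neg0)
  qed
next
  case (ev_neg1 t)
  from ev_st.ev_neg1[OF ev_neg1(1)] have e: "ev (Neg t) (Suc 0)" .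
  show ?case
  proof (intro allI impI)
    fix u assume "cong (Neg t) u"
    from cong_UnD[OF this] e show "ev u (Suc 0)"
      by (metis ev_neg1.IH ev_det ev_st.ev_neg1)
  qed
next
  case (ev_eq a n b m)
  from ev_st.ev_eq[OF ev_eq(1,2)] have e: "ev (a \<doteq> b) (if n = m then Suc 0 else 0)" .
  show ?case
  proof (intro allI impI)
    fix u assume "cong (a \<doteq> b) u"
    from cong_BinD[OF this] e show "ev u (if n = m then Suc 0 else 0)"
      by (metis ev_eq.IH ev_det ev_st.ev_eq)
  qed
next
  case (ev_or1 a b)
  from ev_st.ev_or1[OF ev_or1(1)] have e: "ev (a \<^bold>\<or> b) (Suc 0)" .
  show ?case
  proof (intro allI impI)
    fix u assume "cong (a \<^bold>\<or> b) u"
    from cong_BinD[OF this] e show "ev u (Suc 0)"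
      by (metis ev_or1.IH ev_det ev_st.ev_or1)
  qed
next
  case (ev_or2 b a)
  from ev_st.ev_or2[OF ev_or2(1)] have e: "ev (a \<^bold>\<or> b) (Suc 0)" .
  show ?case
  proof (intro allI impI)
    fix u assume "cong (a \<^bold>\<or> b) u"
    from cong_BinD[OF this] e show "ev u (Suc 0)"
      by (metis ev_or2.IH ev_det ev_st.ev_or2)
  qed
next
  case (ev_or0 a b)
  from ev_st.ev_or0[OF ev_or0(1,2)] have e: "ev (a \<^bold>\<or> b) 0" .
  show ?case
  proof (intro allI impI)
    fix u assume "cong (a \<^bold>\<or> b) u"
    from cong_BinD[OF this] e show "ev u 0"
      by (metis ev_or0.IH ev_det ev_st.ev_or0)
  qed
next
  case (ev_all1 f)
  from ev_st.ev_all1[OF ev_all1(1)] have e: "ev (All \<cdot> f) (Suc 0)" .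
  show ?case
  proof (intro allI impI)
    fix u assume "cong (All \<cdot> f) u"
    then consider n where "ev (All \<cdot> f) n" "ev u n" | f' where "u = All \<cdot> f'" "cong f f'"
      using cong_All_appD by blast
    then show "ev u (Suc 0)"
    proof cases
      case 1 then show ?thesis using e ev_det by blast
    next
      case 2 then show ?thesis using ev_all1(2) cong_App cong_refl by (metis ev_st.ev_all1)
    qed
  qed
next
  case (ev_all0 f k)
  from ev_st.ev_all0[OF ev_all0(1)] have e: "ev (All \<cdot> f) 0" .
  show ?case
  proof (intro allI impI)
    fix u assume "cong (All \<cdot> f) u"
    then consider n where "ev (All \<cdot> f) n" "ev u n" | f' where "u = All \<cdot> f'" "cong f f'"
      using cong_All_appD by blast
    then show "ev u 0"
    proof cases
      case 1 then show ?thesis using e ev_det by blast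
    next
      case 2 then show ?thesis using ev_all0(2) cong_App cong_refl by (metis ev_st.ev_all0)
    qed
  qed
next
  case (ev_st t t' n)
  have e: "ev t n" unfolding ev_st_iff[OF ev_st.hyps(1)] by (rule ev_st.hyps(2))
  show ?case
  proof (intro allI impI)
    fix u assume "cong t u"
    with ev_st.IH(1) consider u' where "st u u'" "cong t' u'" | m where "ev t m" "ev u m" | "stuck t"
      by metis
    then show "ev u n"
    proof cases
      case 1
      show ?thesis unfolding ev_st_iff[OF 1(1)] using ev_st.IH(2) 1(2) by simp
    next
      case 2
      then show ?thesis using ev_det[OF e 2(1)] by simp
    next
      case 3
      then show ?thesis using e stuck_no_ev[OF 3] by simp
    qed
  qed
next
  case (st_beta b t)
  show ?case
  proof (intro allI impI)
    fix u assume "cong (Lam b \<cdot> t) u"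
    from cong_AppD[OF this] show "(\<exists>u'. st u u' \<and> cong (inst 0 t b) u') \<or>
        (\<exists>n. ev (Lam b \<cdot> t) n \<and> ev u n) \<or> stuck (Lam b \<cdot> t)"
      using cong_LamD cong_inst ev_st.st_beta by metis
  qed
next
  case (st_rec0 m g h)
  show ?case
  proof (intro allI impI)
    fix u assume "cong (Rcs \<cdot> g \<cdot> h \<cdot> m) u"
    from cong_AppD[OF this] show "(\<exists>u'. st u u' \<and> cong g u') \<or>
        (\<exists>n. ev (Rcs \<cdot> g \<cdot> h \<cdot> m) n \<and> ev u n) \<or> stuck (Rcs \<cdot> g \<cdot> h \<cdot> m)"
      using cong_RcsD st_rec0.IH ev_st.st_rec0 by metis
  qed
next
  case (st_recS m k g h)
  show ?case
  proof (intro allI impI)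
    fix u assume "cong (Rcs \<cdot> g \<cdot> h \<cdot> m) u"
    then consider n where "ev (Rcs \<cdot> g \<cdot> h \<cdot> m) n" "ev u n" |
      g' h' m' where "u = Rcs \<cdot> g' \<cdot> h' \<cdot> m'" "cong g g'" "cong h h'" "cong m m'"
      using cong_AppD cong_RcsD by metis
    then show "(\<exists>u'. st u u' \<and> cong (h \<cdot> num k \<cdot> (Rcs \<cdot> g \<cdot> h \<cdot> num k)) u') \<or>
        (\<exists>n. ev (Rcs \<cdot> g \<cdot> h \<cdot> m) n \<and> ev u n) \<or> stuck (Rcs \<cdot> g \<cdot> h \<cdot> m)"
    proof cases
      case 2
      have "cong (h \<cdot> num k \<cdot> (Rcs \<cdot> g \<cdot> h \<cdot> num k)) (h' \<cdot> num k \<cdot> (Rcs \<cdot> g' \<cdot> h' \<cdot> num k))"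
        using 2 by (intro cong_App cong_refl)
      \<comment> \<open>The related argument has the same value, so both recursors unfold with the
        same numeral \<open>num k\<close>.\<close>
      moreover have "st u (h' \<cdot> num k \<cdot> (Rcs \<cdot> g' \<cdot> h' \<cdot> num k))"
        unfolding 2(1) using 2(4) st_recS.IH by (intro ev_st.st_recS) blast
      ultimately show ?thesis by blast
    qed blast
  qed
next
  case (st_app t t' v)
  show ?case
  proof (intro allI impI)
    fix u assume "cong (t \<cdot> v) u"
    then consider n where "ev (t \<cdot> v) n" "ev u n" | x y where "u = x \<cdot> y" "cong t x" "cong v y"
      using cong_AppD by blast
    then show "(\<exists>u'. st u u' \<and> cong (t' \<cdot> v) u') \<or> (\<exists>n. ev (t \<cdot> v) n \<and> ev u n) \<or> stuck (t \<cdot> v)"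
    proof cases
      case 2
      from st_app(2) 2(2) consider x' where "st x x'" "cong t' x'" | n where "ev t n" | "stuck t"
        by blast
      then show ?thesis
      proof cases
        case 1
        then show ?thesis unfolding 2(1) using cong_App[OF 1(2) 2(3)] ev_st.st_app[OF 1(1)] by blast
      \<comment> \<open>In the remaining cases the head has a value or is itself stuck; applied to
        \<open>v\<close> it is stuck either way.\<close>
      qed (blast intro: ev_stuck stuck_app)+
    qed blast
  qed
qed

lemma cong_ev: "cong t u \<Longrightarrow> ev t n \<Longrightarrow> ev u n"
  using cong_ev_aux(1) by blast

lemma cong_sb:
  assumes "\<And>i. cong (\<sigma> i) (\<tau> i)"
  shows "cong (sb k \<sigma> t) (sb k \<tau> t)"
  using assms by (induction t arbitrary: k)
    (auto intro!: cong.intros simp: list_all2_conv_all_nth cong_refl)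

lemma ev_replace:
  assumes "closing \<sigma>" "fv a = {}" "fv b = {}" "ev a n" "ev b n" "ev (sb k (\<sigma>(i := a)) t) m"
  shows "ev (sb k (\<sigma>(i := b)) t) m"
  by (rule cong_ev[OF cong_sb assms(6)]) (use assms in \<open>auto simp: cong_refl intro: cong.base\<close>)


section \<open>Soundness\<close>

lemma is_proof_append: "is_proof js \<Longrightarrow> is_proof ks \<Longrightarrow> is_proof (js @ ks)"
  unfolding is_proof_def
proof (intro allI impI)
  fix i
  assume a: "\<forall>i<length js. \<exists>ps. set ps \<subseteq> set (take i js) \<and> rule ps (js ! i)"
    and b: "\<forall>i<length ks. \<exists>ps. set ps \<subseteq> set (take i ks) \<and> rule ps (ks ! i)"
    and i: "i < length (js @ ks)"
  show "\<exists>ps. set ps \<subseteq> set (take i (js @ ks)) \<and> rule ps ((js @ ks) ! i)"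
  proof (cases "i < length js")
    case True
    then show ?thesis using a by (auto simp: nth_append)
  next
    case False
    then have "i - length js < length ks" using i by auto
    with b obtain ps where "set ps \<subseteq> set (take (i - length js) ks)" "rule ps (ks ! (i - length js))"
      by blast
    then show ?thesis using False by (auto simp: nth_append intro!: exI[of _ ps])
  qed
qed

lemma derivable_rule:
  assumes "rule ps j" "\<And>p. p \<in> set ps \<Longrightarrow> derivable p"
  shows "derivable j"
proof -
  have "\<exists>js. is_proof js \<and> set ps \<subseteq> set js"
    using assms(2)
  proof (induction ps)
    case Nil
    show ?case by (rule exI[of _ "[]"]) (simp add: is_proof_def)
  next
    case (Cons p ps)
    then obtain js where "is_proof js" "set ps \<subseteq> set js" by auto
    moreover obtain ks where "is_proof ks" "p \<in> set ks"
      using Cons.prems by (auto simp: derivable_def)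
    ultimately show ?case by (intro exI[of _ "js @ ks"]) (auto intro: is_proof_append)
  qed
  then obtain js where js: "is_proof js" "set ps \<subseteq> set js" by blast
  then have "is_proof (js @ [j])"
    using assms(1) by (auto simp: is_proof_def nth_append less_Suc_eq)
  then show ?thesis by (auto simp: derivable_def)
qed

text \<open>Premises of an entry lie at smaller positions of the proof, so strong induction on
  positions applies. With \<open>derivable_rule\<close> this allows derivability to be treated as an
  inductive predicate.\<close>

lemma derivable_induct [consumes 1, case_names rule]:
  assumes "derivable j"
    and step: "\<And>ps j. rule ps j \<Longrightarrow> (\<And>p. p \<in> set ps \<Longrightarrow> derivable p) \<Longrightarrow>
      (\<And>p. p \<in> set ps \<Longrightarrow> P p) \<Longrightarrow> P j"
  shows "P j"
proof -
  obtain js where js: "is_proof js" "j \<in> set js" using assms(1) by (auto simp: derivable_def)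
  have "P (js ! i)" if "i < length js" for i
    using that
  proof (induction i rule: less_induct)
    case (less i)
    then obtain ps where ps: "set ps \<subseteq> set (take i js)" "rule ps (js ! i)"
      using js(1) by (auto simp: is_proof_def)
    from ps(2) show ?case
    proof (rule step)
      fix p assume "p \<in> set ps"
      then have "p \<in> set (take i js)" using ps(1) by blast
      then obtain k where "k < i" "k < length js" "p = js ! k"
        by (auto simp: in_set_conv_nth)
      then show "derivable p" "P p" using less js(1) by (auto simp: derivable_def)
    qed
  qed
  then show ?thesis using js(2) by (auto simp: in_set_conv_nth)
qed

text \<open>Environments range over all closed terms, including those without a value, because the
  substitution rule may insert any well-formed term. That a variable denotes a number is never built
  in; it has to be a hypothesis \<open>isN\<close>.\<close>

definition sat :: "(nat \<Rightarrow> rterm) \<Rightarrow> rterm fset \<Rightarrow> bool" where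
  "sat \<sigma> \<Gamma> \<longleftrightarrow> closing \<sigma> \<and> (\<forall>a. a |\<in>| \<Gamma> \<longrightarrow> ev (sb 0 \<sigma> a) (Suc 0))"

definition valid :: "sequent \<Rightarrow> bool" where
  "valid j \<longleftrightarrow> (case j of \<Gamma> \<turnstile> c \<Rightarrow> \<forall>\<sigma>. sat \<sigma> \<Gamma> \<longrightarrow> ev (sb 0 \<sigma> c) (Suc 0))"

lemma validI: "(\<And>\<sigma>. sat \<sigma> \<Gamma> \<Longrightarrow> ev (sb 0 \<sigma> c) (Suc 0)) \<Longrightarrow> valid (\<Gamma> \<turnstile> c)"
  by (simp add: valid_def)

lemma validD: "valid (\<Gamma> \<turnstile> c) \<Longrightarrow> sat \<sigma> \<Gamma> \<Longrightarrow> ev (sb 0 \<sigma> c) (Suc 0)"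
  by (simp add: valid_def)

lemma sat_finsert [simp]: "sat \<sigma> (finsert a \<Gamma>) \<longleftrightarrow> ev (sb 0 \<sigma> a) (Suc 0) \<and> sat \<sigma> \<Gamma>"
  by (auto simp: sat_def)

lemma sat_closing: "sat \<sigma> \<Gamma> \<Longrightarrow> closing \<sigma>"
  by (simp add: sat_def)

lemma closing_upd: "closing \<sigma> \<Longrightarrow> fv a = {} \<Longrightarrow> closing (\<sigma>(i := a))"
  by (simp add: closing_def)

definition cons_env :: "rterm \<Rightarrow> (nat \<Rightarrow> rterm) \<Rightarrow> nat \<Rightarrow> rterm" where
  "cons_env a \<sigma> i = (case i of 0 \<Rightarrow> a | Suc j \<Rightarrow> \<sigma> j)"

lemma cons_env_simps [simp]: "cons_env a \<sigma> 0 = a" "cons_env a \<sigma> (Suc i) = \<sigma> i"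
  by (simp_all add: cons_env_def)

lemma closing_cons_env: "closing \<sigma> \<Longrightarrow> fv a = {} \<Longrightarrow> closing (cons_env a \<sigma>)"
  by (simp add: closing_def cons_env_def split: nat.split)

lemma sb_up_cons_env [simp]: "sb 0 (cons_env a \<sigma>) (up t) = sb 0 \<sigma> t"
  by (simp add: sb_up)

lemma sat_up: "sat \<sigma> \<Gamma> \<Longrightarrow> fv a = {} \<Longrightarrow> sat (cons_env a \<sigma>) (up |`| \<Gamma>)"
  by (auto simp: sat_def closing_cons_env)

lemma st_head_step: "c \<triangleright> c' \<Longrightarrow> closing \<sigma> \<Longrightarrow> st (sb 0 \<sigma> c) (sb 0 \<sigma> c')"
proof (induction rule: head_step.induct)
  case (beta t b)
  have "st (Lam (sb 1 \<sigma> b) \<cdot> sb 0 \<sigma> t) (inst 0 (sb 0 \<sigma> t) (sb 1 \<sigma> b))"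
    by (rule st_beta)
  then show ?case using sb_inst[OF beta(2), of 0 t b] by (simp add: One_nat_def)
next
  case (rec_zero h g)
  then show ?case by (simp add: st_rec0)
next
  case (rec_suc g h n)
  have "ev (SS (num n)) (Suc n)" by simp
  from st_recS[OF this] show ?case by simp
next
  case (app t t' u)
  then show ?case by (simp add: st_app)
qed

lemma ev_isN: "ev (a \<doteq> a) (Suc 0) \<longleftrightarrow> (\<exists>n. ev a n)"
  unfolding ev_Eq by (metis n_not_Suc_n)

lemma ex_ev_num: "Ex (ev (num n))"
  by (rule exI[of _ n]) simp

lemma ev_Eq1: "ev (a \<doteq> b) (Suc 0) \<longleftrightarrow> (\<exists>n. ev a n \<and> ev b n)"
  unfolding ev_Eq by (metis n_not_Suc_n)

lemma ev_Eq0: "ev (a \<doteq> b) 0 \<longleftrightarrow> (\<exists>n m. ev a n \<and> ev b m \<and> n \<noteq> m)"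
  unfolding ev_Eq by (metis n_not_Suc_n)

lemma ev_Or1: "ev (a \<^bold>\<or> b) (Suc 0) \<longleftrightarrow> ev a (Suc 0) \<or> ev b (Suc 0)"
  unfolding ev_Or by simp

lemma ev_Or0: "ev (a \<^bold>\<or> b) 0 \<longleftrightarrow> ev a 0 \<and> ev b 0"
  unfolding ev_Or by simp

lemma ev_Neg1: "ev (Neg a) (Suc 0) \<longleftrightarrow> ev a 0"
  by simp

lemma ev_All1: "ev (All \<cdot> f) (Suc 0) \<longleftrightarrow> (\<forall>k. ev (f \<cdot> num k) (Suc 0))"
  unfolding ev_All by simp

lemma ev_All0: "ev (All \<cdot> f) 0 \<longleftrightarrow> (\<exists>k. ev (f \<cdot> num k) 0)"
  unfolding ev_All by simp

lemma ev_replace_repl: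
  assumes "closing \<sigma>" "ev (sb 0 \<sigma> a) n" "ev (sb 0 \<sigma> b) n" "ev (sb 0 \<sigma> (repl v a t)) m"
  shows "ev (sb 0 \<sigma> (repl v b t)) m"
  using ev_replace[OF assms(1) fv_sb0[OF assms(1)] fv_sb0[OF assms(1)] assms(2,3)] assms(4)
  by (simp add: sb_repl0[OF assms(1)] del: fun_upd_apply)

lemma ev_replace_arg:
  assumes "fv a = {}" "ev a k" "ev (f \<cdot> num k) m"
  shows "ev (f \<cdot> a) m"
  by (rule cong_ev[OF cong_App[OF cong_refl] assms(3)]) (rule base, use assms in auto)

lemma ev_replace_arg':
  assumes "fv a = {}" "ev a k" "ev (f \<cdot> a) m"
  shows "ev (f \<cdot> num k) m"
  by (rule cong_ev[OF cong_App[OF cong_refl] assms(3)]) (rule base, use assms in auto)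

lemmas sb_Op = sb.simps(2) list.map(1) list.map(2) add_0_right

text \<open>Most rules are read off the evaluation clauses. Uniqueness of values is needed for
  \<open>neg_elim\<close>, invariance under steps for the conversions, and exchange of closed terms
  of equal value for \<open>eq_subst\<close>, \<open>induction\<close>, \<open>recursor\<close>,
  \<open>all_elim\<close> and \<open>not_all_intro\<close>.\<close>

lemma sound_rule:
  assumes "rule ps j" "\<And>p. p \<in> set ps \<Longrightarrow> valid p"
  shows "valid j"
  using assms
proof (induction rule: rule.induct)
  case (hyp c \<Gamma>)
  then show ?case by (simp add: valid_def)
next
  case (weaken \<Gamma> c a)
  then show ?case by (simp add: valid_def)
next
  case (cut \<Gamma> a c)
  then have "valid (\<Gamma> \<turnstile> a)" "valid (finsert a \<Gamma> \<turnstile> c)" by simp_all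
  then show ?case by (simp add: valid_def)
next
  case (substitution \<Gamma> c s v)
  then have v: "valid (\<Gamma> \<turnstile> c)" by simp
  show ?case
  proof (rule validI)
    fix \<sigma> assume s: "sat \<sigma> (repl v s |`| \<Gamma>)"
    note c = sat_closing[OF s]
    have "sat (\<sigma>(v := sb 0 \<sigma> s)) \<Gamma>"
      using s by (auto simp: sat_def sb_repl0[OF c] closing_upd fv_sb0 simp del: fun_upd_apply)
    from validD[OF v this] show "ev (sb 0 \<sigma> (repl v s c)) (Suc 0)"
      by (simp only: sb_repl0[OF c])
  qed
next
  case (true1 \<Gamma> a)
  then show ?case by (simp add: valid_def ev_Eq1 One_nat_def del: num.simps)
next
  case (true2 \<Gamma> a)
  then show ?case by (simp add: valid_def ev_Eq1 One_nat_def del: num.simps)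
next
  case (false1 \<Gamma> a)
  then show ?case by (simp add: valid_def ev_Eq1 del: num.simps)
next
  case (false2 \<Gamma> a)
  then show ?case by (simp add: valid_def ev_Eq1 del: num.simps)
next
  case (neg_elim c \<Gamma> a)
  then have "valid (\<Gamma> \<turnstile> Neg a)" "valid (\<Gamma> \<turnstile> a)" by simp_all
  then have "\<not> sat \<sigma> \<Gamma>" for \<sigma>
    using ev_det[of "sb 0 \<sigma> a" 0 "Suc 0"] validD[of \<Gamma> "Neg a" \<sigma>] validD[of \<Gamma> a \<sigma>] by auto
  then show ?case by (simp add: valid_def)
next
  case (neg_neg1 \<Gamma> a)
  then show ?case by (simp add: valid_def)
next
  case (neg_neg2 \<Gamma> a)
  then show ?case by (simp add: valid_def)
next
  case (or_intro1 b \<Gamma> a)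
  then show ?case by (simp add: valid_def ev_Or1)
next
  case (or_intro2 a \<Gamma> b)
  then show ?case by (simp add: valid_def ev_Or1)
next
  case (nor_intro \<Gamma> a b)
  then have "valid (\<Gamma> \<turnstile> Neg a)" "valid (\<Gamma> \<turnstile> Neg b)" by simp_all
  then show ?case by (simp add: valid_def ev_Or0)
next
  case (or_elim \<Gamma> a b c)
  then have v: "valid (\<Gamma> \<turnstile> a \<^bold>\<or> b)" "valid (finsert a \<Gamma> \<turnstile> c)" "valid (finsert b \<Gamma> \<turnstile> c)"
    by simp_all
  show ?case
  proof (rule validI)
    fix \<sigma> assume s: "sat \<sigma> \<Gamma>"
    have "ev (sb 0 \<sigma> a) (Suc 0) \<or> ev (sb 0 \<sigma> b) (Suc 0)"
      using validD[OF v(1) s] by (simp add: ev_Or1)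
    then show "ev (sb 0 \<sigma> c) (Suc 0)"
      using s validD[OF v(2), of \<sigma>] validD[OF v(3), of \<sigma>] by auto
  qed
next
  case (nor_elim1 \<Gamma> a b)
  then show ?case by (simp add: valid_def ev_Or0)
next
  case (nor_elim2 \<Gamma> a b)
  then show ?case by (simp add: valid_def ev_Or0)
next
  case (nat_eq1 \<Gamma> a)
  then show ?case by (simp add: valid_def)
next
  case (nat_eq2 \<Gamma> a)
  then show ?case by (simp add: valid_def)
next
  case (eq_sym \<Gamma> a b)
  then have v: "valid (\<Gamma> \<turnstile> a \<doteq> b)" by simp
  show ?case
    using validD[OF v] by (intro validI) (simp add: ev_Eq1 conj_commute)
next
  case (eq_subst p \<Gamma> a b v)
  then have v: "valid (\<Gamma> \<turnstile> a \<doteq> b)" "valid (\<Gamma> \<turnstile> repl v a p)" by simp_all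
  show ?case
  proof (rule validI)
    fix \<sigma> assume s: "sat \<sigma> \<Gamma>"
    obtain n where "ev (sb 0 \<sigma> a) n" "ev (sb 0 \<sigma> b) n"
      using validD[OF v(1) s] by (auto simp: ev_Eq1)
    from ev_replace_repl[OF sat_closing[OF s] this validD[OF v(2) s]]
    show "ev (sb 0 \<sigma> (repl v b p)) (Suc 0)" .
  qed
next
  case (neq_sym \<Gamma> a b)
  then have v: "valid (\<Gamma> \<turnstile> a \<^bold>\<noteq> b)" by simp
  show ?case
  proof (rule validI)
    fix \<sigma> assume s: "sat \<sigma> \<Gamma>"
    from validD[OF v s] show "ev (sb 0 \<sigma> (b \<^bold>\<noteq> a)) (Suc 0)"
      unfolding sb_Op ev_Neg1 ev_Eq0 by metis
  qed
next
  case (eq_bool1 \<Gamma> a b)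
  then have v: "valid (\<Gamma> \<turnstile> isN a)" "valid (\<Gamma> \<turnstile> isN b)" by simp_all
  show ?case
  proof (rule validI)
    fix \<sigma> assume s: "sat \<sigma> \<Gamma>"
    from validD[OF v(1) s] validD[OF v(2) s] show "ev (sb 0 \<sigma> (isB (a \<doteq> b))) (Suc 0)"
      unfolding sb_Op ev_Or1 ev_Neg1 ev_isN ev_Eq0 ev_Eq1 by metis
  qed
next
  case (eq_bool2 \<Gamma> a b)
  then have v: "valid (\<Gamma> \<turnstile> isB (a \<doteq> b))" by simp
  show ?case
  proof (rule validI)
    fix \<sigma> assume s: "sat \<sigma> \<Gamma>"
    from validD[OF v s] show "ev (sb 0 \<sigma> (isN a \<^bold>\<and> isN b)) (Suc 0)"
      unfolding sb_Op ev_Or1 ev_Neg1 ev_Or0 ev_Neg ev_isN ev_Eq0 ev_Eq1 by metis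
  qed
next
  case (zero_nat \<Gamma>)
  then show ?case by (simp add: valid_def ev_isN)
next
  case (suc_nat1 \<Gamma> a)
  then show ?case by (simp add: valid_def ev_isN)
next
  case (suc_nat2 \<Gamma> a)
  then show ?case by (simp add: valid_def ev_isN)
next
  case (suc_neq_zero \<Gamma> a)
  then show ?case by (simp add: valid_def ev_isN ev_Eq0) blast
next
  case (suc_neq1 \<Gamma> a b)
  then have v: "valid (\<Gamma> \<turnstile> a \<^bold>\<noteq> b)" by simp
  show ?case
  proof (rule validI)
    fix \<sigma> assume s: "sat \<sigma> \<Gamma>"
    from validD[OF v s] show "ev (sb 0 \<sigma> (SS a \<^bold>\<noteq> SS b)) (Suc 0)"
      unfolding sb_Op ev_Neg1 ev_Eq0 ev_SS by blast
  qed
next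
  case (suc_neq2 \<Gamma> a b)
  then have v: "valid (\<Gamma> \<turnstile> SS a \<^bold>\<noteq> SS b)" by simp
  show ?case
  proof (rule validI)
    fix \<sigma> assume s: "sat \<sigma> \<Gamma>"
    from validD[OF v s] show "ev (sb 0 \<sigma> (a \<^bold>\<noteq> b)) (Suc 0)"
      unfolding sb_Op ev_Neg1 ev_Eq0 ev_SS by blast
  qed
next
  case (suc_inj \<Gamma> a b)
  then have v: "valid (\<Gamma> \<turnstile> SS a \<doteq> SS b)" by simp
  show ?case
  proof (rule validI)
    fix \<sigma> assume s: "sat \<sigma> \<Gamma>"
    from validD[OF v s] show "ev (sb 0 \<sigma> (a \<doteq> b)) (Suc 0)"
      unfolding sb_Op ev_Eq1 ev_SS by blast
  qed
next
  case (bot_elim p \<Gamma>)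
  then show ?case by (simp add: valid_def ev_isN)
next
  case (induction c \<Gamma> i a)
  then have v: "valid (\<Gamma> \<turnstile> repl i Zer c)" "valid (\<Gamma> \<turnstile> isN a)"
    "valid (finsert (isN (Var i)) (finsert c \<Gamma>) \<turnstile> repl i (SS (Var i)) c)"
    by simp_all
  show ?case
  proof (rule validI)
    fix \<sigma> assume s: "sat \<sigma> \<Gamma>"
    note cl = sat_closing[OF s]
    \<comment> \<open>Induction on the metalevel over numerals; afterwards the numeral is exchanged
      for \<open>a\<close>, which has the same value.\<close>
    have num: "ev (sb 0 (\<sigma>(i := num n)) c) (Suc 0)" for n
    proof (induction n)
      case 0
      then show ?case using validD[OF v(1) s] sb_repl0[OF cl, of i Zer c] by (simp del: fun_upd_apply)
    next
      case (Suc n)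
      let ?\<tau> = "\<sigma>(i := num n)"
      have cl': "closing ?\<tau>" using cl by (simp add: closing_upd)
      have "sb 0 ?\<tau> b = sb 0 \<sigma> b" if "b |\<in>| \<Gamma>" for b
        by (rule sb_cong) (use induction(2) that in auto)
      then have "sat ?\<tau> \<Gamma>" using s cl' by (simp add: sat_def)
      then have "sat ?\<tau> (finsert (isN (Var i)) (finsert c \<Gamma>))"
        using Suc by (simp add: ev_isN ex_ev_num fun_upd_same del: fun_upd_apply)
      from validD[OF v(3) this] sb_repl0[OF cl', of i "SS (Var i)" c] show ?case
        by (simp add: fun_upd_upd fun_upd_same del: fun_upd_apply)
    qed
    obtain n where n: "ev (sb 0 \<sigma> a) n"
      using validD[OF v(2) s] by (auto simp: ev_isN)
    have "ev (num n) n" by simp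
    from ev_replace[OF cl closed_num fv_sb0[OF cl] this n num]
    show "ev (sb 0 \<sigma> (repl i a c)) (Suc 0)" by (simp only: sb_repl0[OF cl])
  qed
next
  case (conv1 c c' \<Gamma>)
  then have v: "valid (\<Gamma> \<turnstile> c')" by simp
  show ?case
  proof (rule validI)
    fix \<sigma> assume s: "sat \<sigma> \<Gamma>"
    show "ev (sb 0 \<sigma> c) (Suc 0)"
      unfolding ev_st_iff[OF st_head_step[OF conv1(1) sat_closing[OF s]]] by (rule validD[OF v s])
  qed
next
  case (conv2 c c' \<Gamma>)
  then have v: "valid (\<Gamma> \<turnstile> c)" by simp
  show ?case
  proof (rule validI)
    fix \<sigma> assume s: "sat \<sigma> \<Gamma>"
    show "ev (sb 0 \<sigma> c') (Suc 0)"
      using validD[OF v s]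
      unfolding ev_st_iff[OF st_head_step[OF conv2(1) sat_closing[OF s]]] .
  qed
next
  case (conv_eq c c' \<Gamma>)
  then have v: "valid (\<Gamma> \<turnstile> isN c')" by simp
  show ?case
  proof (rule validI)
    fix \<sigma> assume s: "sat \<sigma> \<Gamma>"
    show "ev (sb 0 \<sigma> (c \<doteq> c')) (Suc 0)"
      using validD[OF v s]
      unfolding sb_Op ev_isN ev_Eq1
      unfolding ev_st_iff[OF st_head_step[OF conv_eq(1) sat_closing[OF s]]] by blast
  qed
next
  case (recursor g \<Gamma> m h)
  then have v: "valid (\<Gamma> \<turnstile> isN m)" "valid (\<Gamma> \<turnstile> isN (h \<cdot> m \<cdot> (Rcs \<cdot> g \<cdot> h \<cdot> m)))" by simp_all
  show ?case
  proof (rule validI)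
    fix \<sigma> assume s: "sat \<sigma> \<Gamma>"
    note cl = sat_closing[OF s]
    let ?g = "sb 0 \<sigma> g" and ?h = "sb 0 \<sigma> h" and ?m = "sb 0 \<sigma> m"
    obtain k where k: "ev ?m k" using validD[OF v(1) s] by (auto simp: ev_isN)
    obtain n where n: "ev (?h \<cdot> ?m \<cdot> (Rcs \<cdot> ?g \<cdot> ?h \<cdot> ?m)) n"
      using validD[OF v(2) s] by (auto simp: ev_isN)
    \<comment> \<open>The recursor unfolds with the numeral of the value of \<open>m\<close>,
      whereas the rule speaks of \<open>m\<close> itself; this congruence bridges the two.\<close>
    have c: "cong ?m (num k)" by (rule base[OF fv_sb0[OF cl] closed_num k]) simp
    have "ev (?h \<cdot> num k \<cdot> (Rcs \<cdot> ?g \<cdot> ?h \<cdot> num k)) n"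
      by (rule cong_ev[OF _ n]) (intro cong_App cong_refl c)
    moreover have "ev (SS ?m) (Suc k)" using k by simp
    ultimately have "ev (Rcs \<cdot> ?g \<cdot> ?h \<cdot> SS ?m) n" using ev_st_iff[OF st_recS] by simp
    then show "ev (sb 0 \<sigma> (Rcs \<cdot> g \<cdot> h \<cdot> SS m \<doteq> h \<cdot> m \<cdot> (Rcs \<cdot> g \<cdot> h \<cdot> m))) (Suc 0)"
      using n unfolding sb_Op ev_Eq1 by blast
  qed
next
  case (all_intro \<Gamma> f)
  then have v: "valid (finsert (isN (Var 0)) (up |`| \<Gamma>) \<turnstile> up f \<cdot> Var 0)" by simp
  show ?case
  proof (rule validI)
    fix \<sigma> assume s: "sat \<sigma> \<Gamma>"
    have "ev (sb 0 \<sigma> f \<cdot> num k) (Suc 0)" for k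
    proof -
      have "sat (cons_env (num k) \<sigma>) (finsert (isN (Var 0)) (up |`| \<Gamma>))"
        using sat_up[OF s closed_num] by (simp add: ev_isN ex_ev_num)
      from validD[OF v this] show ?thesis by simp
    qed
    then show "ev (sb 0 \<sigma> (All \<cdot> f)) (Suc 0)" by (simp add: ev_All1)
  qed
next
  case (all_elim \<Gamma> f a)
  then have v: "valid (\<Gamma> \<turnstile> All \<cdot> f)" "valid (\<Gamma> \<turnstile> isN a)" by simp_all
  show ?case
  proof (rule validI)
    fix \<sigma> assume s: "sat \<sigma> \<Gamma>"
    obtain k where k: "ev (sb 0 \<sigma> a) k" using validD[OF v(2) s] by (auto simp: ev_isN)
    have "ev (sb 0 \<sigma> f \<cdot> num k) (Suc 0)" using validD[OF v(1) s] by (simp add: ev_All1)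
    from ev_replace_arg[OF fv_sb0[OF sat_closing[OF s]] k this]
    show "ev (sb 0 \<sigma> (f \<cdot> a)) (Suc 0)" by simp
  qed
next
  case (not_all_intro \<Gamma> f a)
  then have v: "valid (\<Gamma> \<turnstile> Neg (f \<cdot> a))" "valid (\<Gamma> \<turnstile> isN a)" by simp_all
  show ?case
  proof (rule validI)
    fix \<sigma> assume s: "sat \<sigma> \<Gamma>"
    obtain k where k: "ev (sb 0 \<sigma> a) k" using validD[OF v(2) s] by (auto simp: ev_isN)
    have "ev (sb 0 \<sigma> f \<cdot> sb 0 \<sigma> a) 0" using validD[OF v(1) s] by simp
    from ev_replace_arg'[OF fv_sb0[OF sat_closing[OF s]] k this]
    show "ev (sb 0 \<sigma> (Neg (All \<cdot> f))) (Suc 0)" by (auto simp: ev_All0)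
  qed
next
  case (not_all_elim \<Gamma> f c)
  then have v: "valid (\<Gamma> \<turnstile> Neg (All \<cdot> f))"
    "valid (finsert (isN (Var 0)) (finsert (Neg (up f \<cdot> Var 0)) (up |`| \<Gamma>)) \<turnstile> up c)" by simp_all
  show ?case
  proof (rule validI)
    fix \<sigma> assume s: "sat \<sigma> \<Gamma>"
    obtain k where k: "ev (sb 0 \<sigma> f \<cdot> num k) 0"
      using validD[OF v(1) s] by (auto simp: ev_All0)
    have "sat (cons_env (num k) \<sigma>) (finsert (isN (Var 0)) (finsert (Neg (up f \<cdot> Var 0)) (up |`| \<Gamma>)))"
      using sat_up[OF s closed_num] k by (simp add: ev_isN ex_ev_num)
    from validD[OF v(2) this] show "ev (sb 0 \<sigma> c) (Suc 0)" by simp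
  qed
qed

theorem soundness: "derivable j \<Longrightarrow> valid j"
  by (induction rule: derivable_induct) (rule sound_rule)

lemma derivable_closed_ev:
  assumes "derivable ({||} \<turnstile> c)" "fv c = {}"
  shows "ev c (Suc 0)"
proof -
  have "sat (\<lambda>_. Zer) {||}" by (simp add: sat_def closing_def)
  from validD[OF soundness[OF assms(1)] this] show ?thesis by (simp add: sb_closed assms(2))
qed


section \<open>Total recursive functions\<close>

inductive_cases computes_ZeroE: "computes RZero xs y"
  and computes_SuccE: "computes RSucc xs y"
  and computes_ProjE: "computes (RProj i) xs y"
  and computes_CompE: "computes (RComp f gs) xs y"
  and computes_PrimE: "computes (RPrim f g) xs y"
  and computes_MuE: "computes (RMu f) xs y"

lemma computes_Zero [simp]: "computes RZero xs y \<longleftrightarrow> y = 0"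
  by (auto elim: computes_ZeroE intro: computes.intros)

lemma computes_Succ: "computes RSucc xs y \<longleftrightarrow> (\<exists>x. xs = [x] \<and> y = Suc x)"
  by (auto elim: computes_SuccE intro: computes.intros)

lemma computes_Proj: "computes (RProj i) xs y \<longleftrightarrow> i < length xs \<and> y = xs ! i"
  by (auto elim: computes_ProjE intro: computes.intros)

lemma computes_Comp: "computes (RComp f gs) xs y \<longleftrightarrow>
    (\<exists>ys. list_all2 (\<lambda>g y. computes g xs y) gs ys \<and> computes f ys y)"
  by (auto elim!: computes_CompE intro: computes.intros)

lemma computes_Prim:
  "\<not> computes (RPrim f g) [] y"
  "computes (RPrim f g) (0 # xs) y \<longleftrightarrow> computes f xs y"
  "computes (RPrim f g) (Suc n # xs) y \<longleftrightarrow>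
    (\<exists>r. computes (RPrim f g) (n # xs) r \<and> computes g (n # r # xs) y)"
  by (auto elim: computes_PrimE intro: computes.intros)

lemma computes_Mu: "computes (RMu f) xs n \<longleftrightarrow>
    computes f (n # xs) 0 \<and> (\<forall>m < n. \<exists>y. computes f (m # xs) (Suc y))"
  by (auto elim: computes_MuE intro: computes.intros)

lemma computes_det: "computes f xs y \<Longrightarrow> computes f xs z \<Longrightarrow> z = y"
proof (induction f arbitrary: xs y z)
  case (RComp f gs)
  have "ys = zs" if "list_all2 (\<lambda>g y. computes g xs y) gs ys" "list_all2 (\<lambda>g y. computes g xs y) gs zs" for ys zs
    using that RComp.IH(2)
  proof (induction gs arbitrary: ys zs)
    case (Cons g gs)
    then show ?case by (auto simp: list_all2_Cons1) blast+
  qed auto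
  with RComp show ?case unfolding computes_Comp by metis
next
  case (RPrim f g)
  show ?case
  proof (cases xs)
    case Nil
    then show ?thesis using RPrim.prems by (simp add: computes_Prim)
  next
    case (Cons n ns)
    have "computes (RPrim f g) (n # ns) y \<Longrightarrow> computes (RPrim f g) (n # ns) z \<Longrightarrow> z = y" for y z
    proof (induction n arbitrary: y z)
      case 0
      then show ?case using RPrim.IH(1) by (simp add: computes_Prim)
    next
      case (Suc n)
      then show ?case using RPrim.IH(2) unfolding computes_Prim by metis
    qed
    then show ?thesis using RPrim.prems Cons by blast
  qed
next
  case (RMu f)
  \<comment> \<open>At the smaller of two distinct results, \<open>f\<close> would have both the
    value zero and a successor as value.\<close>
  then have "\<not> y < z" "\<not> z < y" unfolding computes_Mu by (metis nat.distinct(1))+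
  then show ?case by simp
qed (auto simp: computes_Succ computes_Proj)

text \<open>Total recursiveness is a property of a HOL function rather than of a code, so that it
  can be established by introduction rules that follow the shape of an expression.\<close>

definition trec :: "nat \<Rightarrow> (nat list \<Rightarrow> nat) \<Rightarrow> bool" where
  "trec k f \<longleftrightarrow> (\<exists>F. has_arity k F \<and> (\<forall>xs. length xs = k \<longrightarrow> computes F xs (f xs)))"

lemma trecI: "has_arity k F \<Longrightarrow> (\<And>xs. length xs = k \<Longrightarrow> computes F xs (f xs)) \<Longrightarrow> trec k f"
  by (auto simp: trec_def)

lemma trec_cong: "trec k f \<Longrightarrow> (\<And>xs. length xs = k \<Longrightarrow> g xs = f xs) \<Longrightarrow> trec k g"
  by (auto simp: trec_def)

lemma trec_proj: "i < k \<Longrightarrow> trec k (\<lambda>xs. xs ! i)"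
  by (rule trecI[of _ "RProj i"]) (auto intro: has_arity.intros computes.intros)

lemma trec_comp:
  assumes "trec (length gs) f" "\<And>g. g \<in> set gs \<Longrightarrow> trec k g"
  shows "trec k (\<lambda>xs. f (map (\<lambda>g. g xs) gs))"
proof -
  obtain F where F: "has_arity (length gs) F" "\<And>xs. length xs = length gs \<Longrightarrow> computes F xs (f xs)"
    using assms(1) by (auto simp: trec_def)
  have "\<forall>g \<in> set gs. \<exists>G. has_arity k G \<and> (\<forall>xs. length xs = k \<longrightarrow> computes G xs (g xs))"
    using assms(2) by (auto simp: trec_def)
  then obtain G where G: "\<And>g. g \<in> set gs \<Longrightarrow> has_arity k (G g)"
    "\<And>g xs. g \<in> set gs \<Longrightarrow> length xs = k \<Longrightarrow> computes (G g) xs (g xs)"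
    by metis
  show ?thesis
  proof (rule trecI[of _ "RComp F (map G gs)"])
    show "has_arity k (RComp F (map G gs))"
      using F(1) G(1) by (auto intro!: has_arity.intros)
    show "computes (RComp F (map G gs)) xs (f (map (\<lambda>g. g xs) gs))" if "length xs = k" for xs
      unfolding computes_Comp
      by (rule exI[of _ "map (\<lambda>g. g xs) gs"])
        (auto simp: list_all2_map1 list_all2_map2 list_all2_same F(2) G(2) that)
  qed
qed

lemma trec_comp1: "trec 1 (\<lambda>xs. f (xs ! 0)) \<Longrightarrow> trec k g \<Longrightarrow> trec k (\<lambda>xs. f (g xs))"
  using trec_comp[of "[g]" "\<lambda>xs. f (xs ! 0)" k] by (simp add: One_nat_def)

lemma trec_comp2:
  assumes "trec 2 (\<lambda>xs. f (xs ! 0) (xs ! 1))" "trec k g" "trec k h"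
  shows "trec k (\<lambda>xs. f (g xs) (h xs))"
proof -
  have "l \<in> set [g, h] \<Longrightarrow> trec k l" for l using assms by auto
  from trec_comp[where f = "\<lambda>xs. f (xs ! 0) (xs ! 1)" and gs = "[g, h]", OF _ this] assms(1) show ?thesis
    by (simp add: One_nat_def numeral_eq_Suc)
qed

lemma trec_comp3:
  assumes "trec 3 (\<lambda>xs. f (xs ! 0) (xs ! 1) (xs ! 2))" "trec k g" "trec k h" "trec k i"
  shows "trec k (\<lambda>xs. f (g xs) (h xs) (i xs))"
proof -
  have "l \<in> set [g, h, i] \<Longrightarrow> trec k l" for l using assms by auto
  from trec_comp[where f = "\<lambda>xs. f (xs ! 0) (xs ! 1) (xs ! 2)" and gs = "[g, h, i]", OF _ this] assms(1) show ?thesis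
    by (simp add: One_nat_def numeral_eq_Suc)
qed

lemma trec_Suc: "trec k g \<Longrightarrow> trec k (\<lambda>xs. Suc (g xs))"
proof (rule trec_comp1[of Suc])
  show "trec 1 (\<lambda>xs. Suc (xs ! 0))"
    by (rule trecI[of _ RSucc]) (auto simp: One_nat_def length_Suc_conv computes_Succ
      intro: has_arity.intros(2)[unfolded One_nat_def])
qed

lemma trec_const: "trec k (\<lambda>xs. c)"
proof (induction c)
  case 0
  show ?case by (rule trecI[of _ RZero]) (auto intro: has_arity.intros)
qed (rule trec_Suc)

text \<open>\<open>f\<close> need only satisfy the recursion equations; existing functions such as
  \<open>triangle\<close> therefore qualify without being redefined.\<close>

lemma trec_prim:
  assumes "trec k g" "trec (k + 2) h"
    and "\<And>xs. length xs = k \<Longrightarrow> f (0 # xs) = g xs"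
    and "\<And>n xs. length xs = k \<Longrightarrow> f (Suc n # xs) = h (n # f (n # xs) # xs)"
  shows "trec (k + 1) f"
proof -
  obtain G where G: "has_arity k G" "\<And>xs. length xs = k \<Longrightarrow> computes G xs (g xs)"
    using assms(1) by (auto simp: trec_def)
  obtain H where H: "has_arity (k + 2) H" "\<And>xs. length xs = k + 2 \<Longrightarrow> computes H xs (h xs)"
    using assms(2) by (auto simp: trec_def)
  show ?thesis
  proof (rule trecI[of _ "RPrim G H"])
    show "has_arity (k + 1) (RPrim G H)" using G(1) H(1) by (rule has_arity.intros)
    fix xs :: "nat list" assume "length xs = k + 1"
    then obtain n ys where xs: "xs = n # ys" "length ys = k" by (auto simp: length_Suc_conv One_nat_def)
    have "computes (RPrim G H) (n # ys) (f (n # ys))"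
    proof (induction n)
      case 0
      then show ?case by (simp add: computes_Prim assms(3) G(2) xs(2))
    next
      case (Suc n)
      then show ?case
        unfolding computes_Prim using H(2)[of "n # f (n # ys) # ys"] xs(2) by (auto simp: assms(4))
    qed
    then show "computes (RPrim G H) xs (f xs)" by (simp add: xs(1))
  qed
qed

lemma trec_mu:
  assumes "trec (k + 1) f" "\<And>xs. length xs = k \<Longrightarrow> \<exists>n. f (n # xs) = 0"
  shows "trec k (\<lambda>xs. LEAST n. f (n # xs) = 0)"
proof -
  obtain F where F: "has_arity (k + 1) F" "\<And>xs. length xs = k + 1 \<Longrightarrow> computes F xs (f xs)"
    using assms(1) by (auto simp: trec_def)
  show ?thesis
  proof (rule trecI[of _ "RMu F"])
    show "has_arity k (RMu F)" using F(1) by (rule has_arity.intros)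
    fix xs :: "nat list" assume k: "length xs = k"
    let ?n = "LEAST n. f (n # xs) = 0"
    have "f (?n # xs) = 0" using assms(2)[OF k] by (rule LeastI_ex)
    moreover have "\<exists>y. computes F (m # xs) (Suc y)" if "m < ?n" for m
    proof -
      have "f (m # xs) \<noteq> 0" using not_less_Least[OF that] .
      then show ?thesis using F(2)[of "m # xs"] k by (cases "f (m # xs)") auto
    qed
    ultimately show "computes (RMu F) xs ?n"
      unfolding computes_Mu using F(2)[of "?n # xs"] k by auto
  qed
qed

lemma trec_prim1:
  assumes "trec 2 (\<lambda>xs. h (xs ! 0) (xs ! 1))" "\<And>n. f (Suc n) = h n (f n)"
  shows "trec 1 (\<lambda>xs. f (xs ! 0))"
  using trec_prim[of 0 "\<lambda>_. f 0" "\<lambda>xs. h (xs ! 0) (xs ! 1)" "\<lambda>xs. f (xs ! 0)"] assms trec_const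
  by (simp add: One_nat_def numeral_eq_Suc)

lemma trec_prim2:
  assumes "trec 1 (\<lambda>xs. g (xs ! 0))" "trec 3 (\<lambda>xs. h (xs ! 0) (xs ! 1) (xs ! 2))"
    "\<And>x. f 0 x = g x" "\<And>n x. f (Suc n) x = h n (f n x) x"
  shows "trec 2 (\<lambda>xs. f (xs ! 0) (xs ! 1))"
  using trec_prim[of 1 "\<lambda>xs. g (xs ! 0)" "\<lambda>xs. h (xs ! 0) (xs ! 1) (xs ! 2)" "\<lambda>xs. f (xs ! 0) (xs ! 1)"]
    assms by (simp add: One_nat_def numeral_eq_Suc)

lemma trec_prim3:
  assumes "trec 2 (\<lambda>xs. g (xs ! 0) (xs ! 1))" "trec 4 (\<lambda>xs. h (xs ! 0) (xs ! 1) (xs ! 2) (xs ! 3))"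
    "\<And>x y. f 0 x y = g x y" "\<And>n x y. f (Suc n) x y = h n (f n x y) x y"
  shows "trec 3 (\<lambda>xs. f (xs ! 0) (xs ! 1) (xs ! 2))"
  using trec_prim[of 2 "\<lambda>xs. g (xs ! 0) (xs ! 1)" "\<lambda>xs. h (xs ! 0) (xs ! 1) (xs ! 2) (xs ! 3)"
      "\<lambda>xs. f (xs ! 0) (xs ! 1) (xs ! 2)"]
    assms by (simp add: One_nat_def numeral_eq_Suc)

section \<open>Arithmetic, pairing and list membership as total recursive functions\<close>

named_theorems trec_intros
lemmas [trec_intros] = trec_const trec_Suc trec_proj

lemma trec_pred [trec_intros]: "trec k f \<Longrightarrow> trec k (\<lambda>xs. f xs - 1)"
  by (rule trec_comp1[of "\<lambda>x. x - 1"], rule trec_prim1[of "\<lambda>n r. n"])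
    (simp_all add: One_nat_def trec_proj)

lemma trec_add [trec_intros]: "trec k f \<Longrightarrow> trec k g \<Longrightarrow> trec k (\<lambda>xs. f xs + g xs)"
  by (rule trec_comp2[of "\<lambda>x y. x + y"], rule trec_prim2[of "\<lambda>x. x" "\<lambda>n r x. Suc r"])
    (simp_all add: trec_intros)

text \<open>Primitive recursion runs on the first argument, hence the swapped difference
  \<open>y - x\<close>, which iterates the predecessor.\<close>

lemma trec_diff [trec_intros]: "trec k f \<Longrightarrow> trec k g \<Longrightarrow> trec k (\<lambda>xs. f xs - g xs)"
  by (rule trec_comp2[of "\<lambda>x y. y - x"], rule trec_prim2[of "\<lambda>x. x" "\<lambda>n r x. r - 1"])
    (auto intro!: trec_intros)

lemma trec_if [trec_intros]:
  assumes "trec k c" "trec k f" "trec k g"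
  shows "trec k (\<lambda>xs. if c xs = 0 then f xs else g xs)"
  by (rule trec_comp3[of "\<lambda>c x y. if c = 0 then x else y", OF _ assms],
      rule trec_prim3[of "\<lambda>x y. x" "\<lambda>n r x y. y"]) (simp_all add: trec_intros)

lemma trec_if_eq [trec_intros]:
  assumes "trec k a" "trec k b" "trec k f" "trec k g"
  shows "trec k (\<lambda>xs. if a xs = b xs then f xs else g xs)"
proof -
  \<comment> \<open>The truncated differences in both directions vanish together exactly when the
    numbers agree.\<close>
  have "trec k (\<lambda>xs. if (a xs - b xs) + (b xs - a xs) = 0 then f xs else g xs)"
    by (intro trec_intros assms)
  then show ?thesis by (rule trec_cong) auto
qed

lemma trec_triangle [trec_intros]: "trec k f \<Longrightarrow> trec k (\<lambda>xs. triangle (f xs))"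
  by (rule trec_comp1[of triangle], rule trec_prim1[of "\<lambda>n r. r + Suc n"]) (auto intro!: trec_intros)

lemma trec_pair [trec_intros]: "trec k f \<Longrightarrow> trec k g \<Longrightarrow> trec k (\<lambda>xs. prod_encode (f xs, g xs))"
  by (simp add: prod_encode_def trec_intros)

definition pfst where "pfst z = fst (prod_decode z)"
definition psnd where "psnd z = snd (prod_decode z)"

lemma pfst_pair [simp]: "pfst (prod_encode (a, b)) = a"
  and psnd_pair [simp]: "psnd (prod_encode (a, b)) = b"
  by (simp_all add: pfst_def psnd_def)

lemma triangle_mono: "m \<le> n \<Longrightarrow> triangle m \<le> triangle n"
  by (induction rule: dec_induct) auto

text \<open>The antidiagonal on which a pair code lies: \<open>prod_encode (a, b)\<close> is
  \<open>triangle (a + b) + a\<close>, so the index is the least n with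
  \<open>z < triangle (Suc n)\<close>. This is written as a vanishing difference because
  minimisation searches for zeros.\<close>

definition diag :: "nat \<Rightarrow> nat" where "diag z = (LEAST n. Suc z - triangle (Suc n) = 0)"

lemma diag_pair: "diag (prod_encode (a, b)) = a + b"
  unfolding diag_def
proof (rule Least_equality)
  show "Suc (prod_encode (a, b)) - triangle (Suc (a + b)) = 0" by (simp add: prod_encode_def)
  fix n assume *: "Suc (prod_encode (a, b)) - triangle (Suc n) = 0"
  show "a + b \<le> n"
  proof (rule ccontr)
    assume "\<not> a + b \<le> n"
    then have "triangle (Suc n) \<le> triangle (a + b)" by (intro triangle_mono) simp
    then show False using * by (simp add: prod_encode_def)
  qed
qed

lemma pfst_eq: "pfst z = z - triangle (diag z)" and psnd_eq: "psnd z = diag z - pfst z"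
proof -
  obtain a b where "z = prod_encode (a, b)" by (metis prod_decode_inverse surj_pair)
  then show "pfst z = z - triangle (diag z)" "psnd z = diag z - pfst z"
    by (simp_all add: diag_pair) (simp add: prod_encode_def)
qed

lemma trec_diag: "trec k f \<Longrightarrow> trec k (\<lambda>xs. diag (f xs))"
proof (rule trec_comp1[of diag])
  have "trec 1 (\<lambda>xs. LEAST n. Suc ((n # xs) ! 1) - triangle (Suc ((n # xs) ! 0)) = 0)"
  proof (rule trec_mu)
    show "trec (1 + 1) (\<lambda>xs. Suc (xs ! 1) - triangle (Suc (xs ! 0)))"
      by (auto intro!: trec_intros)
    show "\<exists>n. Suc ((n # xs) ! 1) - triangle (Suc ((n # xs) ! 0)) = 0" for xs
      \<comment> \<open>The code itself bounds the search, since \<open>Suc z\<close> is at most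
        \<open>triangle (Suc z)\<close>.\<close>
      by (rule exI[of _ "xs ! 0"]) (simp add: One_nat_def)
  qed
  then show "trec 1 (\<lambda>xs. diag (xs ! 0))" by (simp add: diag_def One_nat_def)
qed

lemma trec_pfst [trec_intros]: "trec k f \<Longrightarrow> trec k (\<lambda>xs. pfst (f xs))"
  unfolding pfst_eq by (intro trec_intros trec_diag)

lemma trec_psnd [trec_intros]: "trec k f \<Longrightarrow> trec k (\<lambda>xs. psnd (f xs))"
  unfolding psnd_eq by (intro trec_intros trec_diag)

text \<open>Membership in a coded list by bounded iteration: after \<open>l\<close> steps the code \<open>l\<close> is exhausted
  unless \<open>x\<close> has come to the head.\<close>

primrec list_skip :: "nat \<Rightarrow> nat \<Rightarrow> nat \<Rightarrow> nat" where
  "list_skip x 0 l = l"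
| "list_skip x (Suc n) l =
    (let r = list_skip x n l in
     if r = 0 then 0 else if pfst (r - 1) = x then r else psnd (r - 1))"

lemma list_decode_0: "l = 0 \<longleftrightarrow> list_decode l = []"
  by (metis list_decode.simps(1) list_encode.simps(1) list_decode_inverse)

lemma list_decode_pos: "0 < l \<Longrightarrow> list_decode l = pfst (l - 1) # list_decode (psnd (l - 1))"
  by (cases l) (auto simp: pfst_def psnd_def One_nat_def split: prod.split)

lemma list_skip_drop: "\<exists>k. list_decode (list_skip x n l) = drop k (list_decode l)"
proof (induction n)
  case 0
  show ?case by (rule exI[of _ 0]) simp
next
  case (Suc n)
  then obtain k where k: "list_decode (list_skip x n l) = drop k (list_decode l)" ..
  let ?r = "list_skip x n l"
  show ?case
  proof (cases "?r = 0 \<or> pfst (?r - 1) = x")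
    case True
    then show ?thesis using k by (intro exI[of _ k]) (auto simp: Let_def)
  next
    case False
    then have "list_decode (psnd (?r - 1)) = tl (list_decode ?r)"
      using list_decode_pos[of ?r] by simp
    also have "\<dots> = drop (Suc k) (list_decode l)" by (simp add: k drop_Suc tl_drop)
    finally show ?thesis using False by (intro exI[of _ "Suc k"]) (simp add: Let_def)
  qed
qed

lemma list_skip_invariant:
  "x \<in> set (list_decode l) \<Longrightarrow> x \<in> set (list_decode (list_skip x n l))"
proof (induction n)
  case (Suc n)
  let ?r = "list_skip x n l"
  have "?r \<noteq> 0" using Suc by (auto simp: list_decode_0)
  then show ?case using Suc list_decode_pos[of ?r] by (auto simp: Let_def)
qed simp

text \<open>Until \<open>x\<close> is at the head, each step drops one element of a nonempty rest,
  so the remaining length falls with the number of steps.\<close>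

lemma list_skip_stop:
  "(list_skip x n l \<noteq> 0 \<and> pfst (list_skip x n l - 1) = x) \<or>
    length (list_decode (list_skip x n l)) \<le> length (list_decode l) - n"
proof (induction n)
  case (Suc n)
  let ?r = "list_skip x n l"
  show ?case
  proof (cases "?r \<noteq> 0 \<and> pfst (?r - 1) \<noteq> x")
    case True
    then show ?thesis using Suc list_decode_pos[of ?r] by (auto simp: Let_def)
  next
    case False
    then show ?thesis by (auto simp: Let_def)
  qed
qed simp

text \<open>The reason why a list code can serve as the number of iterations when its own list is
  scanned.\<close>

lemma length_le_list_encode: "length xs \<le> list_encode xs"
proof (induction xs)
  case (Cons x xs)
  then show ?case using le_prod_encode_2[of "list_encode xs" x] by simp
qed simp

lemma list_skip_mem: "list_skip x l l \<noteq> 0 \<longleftrightarrow> x \<in> set (list_decode l)"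
proof
  assume *: "list_skip x l l \<noteq> 0"
  let ?r = "list_skip x l l"
  have "length (list_decode l) \<le> l" using length_le_list_encode[of "list_decode l"] by simp
  then have "pfst (?r - 1) = x" using list_skip_stop[of x l l] * by (auto simp: list_decode_0[of "list_skip x l l"])
  then have "x \<in> set (list_decode ?r)" using list_decode_pos[of ?r] * by simp
  then show "x \<in> set (list_decode l)"
    using list_skip_drop[of x l l] by (metis in_set_dropD)
next
  assume "x \<in> set (list_decode l)"
  from list_skip_invariant[OF this, of l] show "list_skip x l l \<noteq> 0" by (auto simp: list_decode_0)
qed

lemma trec_mem [trec_intros]:
  assumes "trec k a" "trec k l" "trec k f" "trec k g"
  shows "trec k (\<lambda>xs. if a xs \<in> set (list_decode (l xs)) then f xs else g xs)"
proof -
  have "trec 3 (\<lambda>xs. (\<lambda>n x l. list_skip x n l) (xs ! 0) (xs ! 1) (xs ! 2))"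
    by (rule trec_prim3[of "\<lambda>x l. l" "\<lambda>n r x l. if r = 0 then 0 else if pfst (r - 1) = x then r else psnd (r - 1)"])
      (auto intro!: trec_intros simp: Let_def)
  from trec_comp3[OF this assms(2,1,2)]
  have "trec k (\<lambda>xs. list_skip (a xs) (l xs) (l xs))" .
  from trec_if[OF this assms(4,3)] show ?thesis
    by (rule trec_cong) (simp add: list_skip_mem[symmetric])
qed


section \<open>Horn programs\<close>

text \<open>The successor pattern does double duty: for arithmetic, and for lists, because the code
  of a nonempty list is the successor of a pair.\<close>

datatype pat = PV nat | PC nat | PS pat | PP pat pat

primrec pev :: "(nat \<Rightarrow> nat) \<Rightarrow> pat \<Rightarrow> nat" where
  "pev \<sigma> (PV i) = \<sigma> i"
| "pev \<sigma> (PC n) = n"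
| "pev \<sigma> (PS p) = Suc (pev \<sigma> p)"
| "pev \<sigma> (PP p q) = prod_encode (pev \<sigma> p, pev \<sigma> q)"

inductive horn :: "(pat list \<times> pat) list \<Rightarrow> nat \<Rightarrow> bool" for P where
  clause: "(ps, q) \<in> set P \<Longrightarrow> (\<And>p. p \<in> set ps \<Longrightarrow> horn P (pev \<sigma> p)) \<Longrightarrow> horn P (pev \<sigma> q)"

text \<open>Iterated pairing lets one number assign values to all variables. Not every assignment is
  coded, but every finite part of one is (\<open>ex_env\<close>), and a clause mentions finitely
  many variables.\<close>

fun env_of :: "nat \<Rightarrow> nat \<Rightarrow> nat" where
  "env_of e 0 = pfst e"
| "env_of e (Suc i) = env_of (psnd e) i"

lemma ex_env: "\<exists>e. \<forall>i < N. env_of e i = \<sigma> i"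
proof (induction N arbitrary: \<sigma>)
  case (Suc N)
  obtain e where "\<forall>i < N. env_of e i = \<sigma> (Suc i)" using Suc[of "\<lambda>i. \<sigma> (Suc i)"] by blast
  then show ?case
    by (intro exI[of _ "prod_encode (\<sigma> 0, e)"]) (simp add: All_less_Suc2)
qed simp

primrec pat_bound :: "pat \<Rightarrow> nat" where
  "pat_bound (PV i) = Suc i"
| "pat_bound (PC n) = 0"
| "pat_bound (PS p) = pat_bound p"
| "pat_bound (PP p q) = max (pat_bound p) (pat_bound q)"

lemma pev_cong: "(\<And>i. i < pat_bound p \<Longrightarrow> \<sigma> i = \<tau> i) \<Longrightarrow> pev \<sigma> p = pev \<tau> p"
  by (induction p) auto

lemma ex_env_clause: "\<exists>e. \<forall>p \<in> set ps. pev (env_of e) p = pev \<sigma> p"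
proof -
  obtain e where e: "\<forall>i < Max (insert 0 (pat_bound ` set ps)). env_of e i = \<sigma> i"
    using ex_env[of _ \<sigma>] by blast
  have "pev (env_of e) p = pev \<sigma> p" if "p \<in> set ps" for p
  proof (rule pev_cong)
    fix i assume "i < pat_bound p"
    also have "pat_bound p \<le> Max (insert 0 (pat_bound ` set ps))" using that by (intro Max_ge) auto
    finally show "env_of e i = \<sigma> i" using e by blast
  qed
  then show ?thesis by blast
qed

abbreviation codes :: "nat \<Rightarrow> nat set" where "codes l \<equiv> set (list_decode l)"

fun add_clauses :: "nat \<Rightarrow> (pat list \<times> pat) list \<Rightarrow> nat \<Rightarrow> nat" where
  "add_clauses e [] l = l"
| "add_clauses e ((ps, q) # P) l = add_clauses e P
    (if \<forall>p \<in> set ps. pev (env_of e) p \<in> codes l then Suc (prod_encode (pev (env_of e) q, l)) else l)"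

text \<open>Every environment occurs as \<open>pfst n\<close> for arbitrarily large \<open>n\<close>, so the stages exhaust the
  least model.\<close>

primrec stage :: "(pat list \<times> pat) list \<Rightarrow> nat \<Rightarrow> nat" where
  "stage P 0 = 0"
| "stage P (Suc n) = add_clauses (pfst n) P (stage P n)"

section \<open>The stages exhaust the least model\<close>

lemma add_clauses_sound:
  "set P \<subseteq> set Q \<Longrightarrow> codes l \<subseteq> Collect (horn Q) \<Longrightarrow> codes (add_clauses e P l) \<subseteq> Collect (horn Q)"
proof (induction e P l rule: add_clauses.induct)
  case (2 e ps q P l)
  show ?case unfolding add_clauses.simps
  proof (rule 2(1))
    show "set P \<subseteq> set Q" using 2(2) by simp
    have "horn Q (pev (env_of e) q)" if "\<forall>p \<in> set ps. pev (env_of e) p \<in> codes l"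
      by (rule horn.clause[of ps q]) (use 2 that in auto)
    then show "codes (if \<forall>p \<in> set ps. pev (env_of e) p \<in> codes l
        then Suc (prod_encode (pev (env_of e) q, l)) else l) \<subseteq> Collect (horn Q)"
      using 2(3) by auto
  qed
qed simp

lemma add_clauses_mono: "codes l \<subseteq> codes (add_clauses e P l)"
proof (induction e P l rule: add_clauses.induct)
  case (2 e ps q P l)
  let ?l = "if \<forall>p \<in> set ps. pev (env_of e) p \<in> codes l then Suc (prod_encode (pev (env_of e) q, l)) else l"
  have "codes l \<subseteq> codes ?l" by auto
  with 2 show ?case by simp
qed simp

lemma add_clauses_complete:
  "(ps, q) \<in> set P \<Longrightarrow> \<forall>p \<in> set ps. pev (env_of e) p \<in> codes l \<Longrightarrow>
    pev (env_of e) q \<in> codes (add_clauses e P l)"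
proof (induction e P l rule: add_clauses.induct)
  case (2 e ps' q' P l)
  let ?l = "if \<forall>p \<in> set ps'. pev (env_of e) p \<in> codes l then Suc (prod_encode (pev (env_of e) q', l)) else l"
  have l: "codes l \<subseteq> codes ?l" by auto
  show ?case
  proof (cases "(ps, q) = (ps', q')")
    case True
    then have "pev (env_of e) q \<in> codes ?l" using 2(3) by auto
    then show ?thesis unfolding add_clauses.simps using add_clauses_mono by blast
  next
    case False
    then show ?thesis unfolding add_clauses.simps using 2(2,3) l by (intro 2(1)) auto
  qed
qed simp

lemma stage_mono: "m \<le> n \<Longrightarrow> codes (stage P m) \<subseteq> codes (stage P n)"
  by (rule lift_Suc_mono_le[of "\<lambda>n. codes (stage P n)"]) (simp_all add: add_clauses_mono)

lemma horn_iff_stage: "horn P x \<longleftrightarrow> (\<exists>n. x \<in> codes (stage P n))"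
proof
  assume "horn P x"
  then show "\<exists>n. x \<in> codes (stage P n)"
  proof induction
    case (clause ps q \<sigma>)
    have "\<exists>n. \<forall>p \<in> set ps. pev \<sigma> p \<in> codes (stage P n)"
      using clause(3)
    proof (induction ps)
      case (Cons p ps)
      then obtain n m where "\<forall>p \<in> set ps. pev \<sigma> p \<in> codes (stage P n)" "pev \<sigma> p \<in> codes (stage P m)"
        by force
      then show ?case using stage_mono[of n "max n m" P] stage_mono[of m "max n m" P]
        by (intro exI[of _ "max n m"]) auto
    qed simp
    then obtain n where n: "\<forall>p \<in> set ps. pev \<sigma> p \<in> codes (stage P n)" ..
    obtain e where e: "\<forall>p \<in> set (q # ps). pev (env_of e) p = pev \<sigma> p" using ex_env_clause[of "q # ps" \<sigma>] by blast
    \<comment> \<open>The pass from stage \<open>?m\<close> to its successor uses the environment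
      \<open>e\<close>, and \<open>?m\<close> is at least \<open>n\<close>, so all premises have
      been collected by then.\<close>
    let ?m = "prod_encode (e, n)"
    have "n \<le> ?m" by (rule le_prod_encode_2)
    then have "\<forall>p \<in> set ps. pev (env_of e) p \<in> codes (stage P ?m)"
      using n e stage_mono[of n ?m P] by auto
    from add_clauses_complete[OF clause(1) this] e
    show ?case by (intro exI[of _ "Suc ?m"]) simp
  qed
next
  have "codes (stage P n) \<subseteq> Collect (horn P)" for n
    by (induction n) (simp_all add: add_clauses_sound)
  then show "horn P x" if "\<exists>n. x \<in> codes (stage P n)" using that by auto
qed

lemma trec_env: "trec k f \<Longrightarrow> trec k (\<lambda>xs. env_of (f xs) i)"
  by (induction i arbitrary: f) (simp_all add: trec_pfst trec_psnd)

lemma trec_pev [trec_intros]: "trec k f \<Longrightarrow> trec k (\<lambda>xs. pev (env_of (f xs)) p)"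
  by (induction p) (auto intro: trec_intros trec_env)

text \<open>The premises form a fixed finite list, so the bounded quantifier unfolds into nested
  conditionals with one membership test each.\<close>

lemma trec_premises [trec_intros]:
  assumes "trec k f" "trec k l" "trec k a" "trec k b"
  shows "trec k (\<lambda>xs. if \<forall>p \<in> set ps. pev (env_of (f xs)) p \<in> codes (l xs) then a xs else b xs)"
proof (induction ps)
  case (Cons p ps)
  have "trec k (\<lambda>xs. if pev (env_of (f xs)) p \<in> codes (l xs) then
      (if \<forall>p \<in> set ps. pev (env_of (f xs)) p \<in> codes (l xs) then a xs else b xs) else b xs)"
    by (intro trec_intros assms Cons)
  then show ?case by (rule trec_cong) simp
qed (simp add: assms)

lemma trec_add_clauses: "trec k f \<Longrightarrow> trec k l \<Longrightarrow> trec k (\<lambda>xs. add_clauses (f xs) P (l xs))"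
proof (induction P arbitrary: l)
  case (Cons c P)
  obtain ps q where c: "c = (ps, q)" by force
  show ?case unfolding c add_clauses.simps
    by (rule Cons.IH) (intro trec_intros Cons.prems)+
qed simp

lemma trec_stage [trec_intros]: "trec k f \<Longrightarrow> trec k (\<lambda>xs. stage P (f xs))"
  by (rule trec_comp1[of "stage P"], rule trec_prim1[of "\<lambda>n r. add_clauses (pfst n) P r"])
    (auto intro!: trec_intros trec_add_clauses)

text \<open>Minimisation over stages: the test returns 0 when the fact is present and 1 otherwise.
  It is total, so the search stops exactly when some stage contains the fact.\<close>

theorem rec_enum_horn:
  assumes "trec 1 (\<lambda>xs. f (xs ! 0))"
  shows "rec_enum (\<lambda>n. horn P (f n))"
proof -
  have "trec 2 (\<lambda>xs. f (xs ! 1))"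
    by (rule trec_comp1[of f, OF assms]) (simp add: trec_proj)
  then have "trec 2 (\<lambda>xs. if f (xs ! 1) \<in> codes (stage P (xs ! 0)) then 0 else 1)"
    by (intro trec_intros) auto
  then obtain F where F2: "has_arity 2 F" "\<And>xs. length xs = 2 \<Longrightarrow>
      computes F xs (if f (xs ! 1) \<in> codes (stage P (xs ! 0)) then 0 else 1)"
    unfolding trec_def by blast
  have F: "computes F [m, n] (if f n \<in> codes (stage P m) then 0 else 1)" for m n
    using F2(2)[of "[m, n]"] by (simp add: One_nat_def)
  have "(\<exists>y. computes (RMu F) [n] y) \<longleftrightarrow> horn P (f n)" for n
  proof
    assume "\<exists>y. computes (RMu F) [n] y"
    then obtain y where "computes F [y, n] 0" by (auto simp: computes_Mu)
    from computes_det[OF F this] have "f n \<in> codes (stage P y)"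
      by (simp split: if_splits)
    then show "horn P (f n)" by (auto simp: horn_iff_stage)
  next
    let ?Q = "\<lambda>m. f n \<in> codes (stage P m)"
    assume "horn P (f n)"
    then have ex: "\<exists>m. ?Q m" by (simp add: horn_iff_stage)
    have "computes F [LEAST m. ?Q m, n] 0"
      using F[of "LEAST m. ?Q m" n] LeastI_ex[OF ex] by simp
    moreover have "computes F [m, n] (Suc 0)" if "m < (LEAST m. ?Q m)" for m
      using F[of m n] not_less_Least[OF that] by (simp add: One_nat_def)
    ultimately show "\<exists>y. computes (RMu F) [n] y"
      unfolding computes_Mu by blast
  qed
  moreover have "has_arity 1 (RMu F)"
    using F2(1) has_arity.intros(6)[of 1 F] by (simp add: One_nat_def numeral_eq_Suc)
  ultimately show ?thesis unfolding rec_enum_def by blast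
qed


section \<open>Derivability as a Horn program\<close>

fun enc :: "rterm \<Rightarrow> nat" where
  "enc (Var i) = prod_encode (0, i)"
| "enc (Op c k ts) = prod_encode (Suc c, prod_encode (k, list_encode (map enc ts)))"

lemma list_encode_ge: "x \<in> set xs \<Longrightarrow> x \<le> list_encode xs"
proof (induction xs)
  case (Cons y ys)
  then show ?case
    using le_prod_encode_1[of y "list_encode ys"] le_prod_encode_2[of "list_encode ys" y] by auto
qed simp

text \<open>Since every number codes a raw term, \<open>dec\<close> is a true inverse. Clauses then
  range over all numbers without any premise saying that a variable holds a term code.\<close>

lemma enc_surj: "\<exists>t. enc t = n"
proof (induction n rule: less_induct)
  case (less n)
  obtain a b where n: "n = prod_encode (a, b)" by (metis prod_decode_inverse surj_pair)
  show ?case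
  proof (cases a)
    case 0
    then show ?thesis using n by (intro exI[of _ "Var b"]) simp
  next
    case (Suc c)
    obtain k l where b: "b = prod_encode (k, l)" by (metis prod_decode_inverse surj_pair)
    have "l \<le> b" unfolding b by (rule le_prod_encode_2)
    \<comment> \<open>An operator tag is a successor, and pairing with a positive first component is
      strictly increasing.\<close>
    moreover have "b < n" unfolding n Suc by (simp add: prod_encode_def)
    ultimately have "\<exists>t. enc t = x" if "x \<in> codes l" for x
      using list_encode_ge[OF that] less by simp
    then obtain g where "\<And>x. x \<in> codes l \<Longrightarrow> enc (g x) = x" by metis
    then have "map enc (map g (list_decode l)) = list_decode l" by (simp add: map_idI)
    then have "enc (Op c k (map g (list_decode l))) = n"
      unfolding enc.simps by (simp only: n Suc b list_decode_inverse)
    then show ?thesis ..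
  qed
qed

lemma enc_inj: "enc t = enc u \<longleftrightarrow> t = u"
proof
  show "enc t = enc u \<Longrightarrow> t = u"
  proof (induction t arbitrary: u)
    case (Var i)
    then show ?case by (cases u) (auto simp: prod_encode_eq)
  next
    case (Op c k ts)
    then obtain us where u: "u = Op c k us" "map enc ts = map enc us"
      by (cases u) (auto simp: prod_encode_eq list_encode_eq)
    have "ts = us" using u(2) Op.IH
      by (simp add: list_eq_iff_nth_eq)
    then show ?case using u by simp
  qed
qed simp

definition dec :: "nat \<Rightarrow> rterm" where "dec = inv enc"

lemma dec_enc [simp]: "dec (enc t) = t"
  unfolding dec_def by (rule inv_f_f) (simp add: inj_def enc_inj)

lemma enc_dec [simp]: "enc (dec n) = n"
  unfolding dec_def by (rule f_inv_into_f) (metis enc_surj rangeI)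

definition decs :: "nat \<Rightarrow> rterm list" where "decs l = map dec (list_decode l)"

lemma decs_simps [simp]: "decs 0 = []" "decs (Suc (prod_encode (a, l))) = dec a # decs l"
  by (simp_all add: decs_def)

lemma dec_Var [simp]: "dec (prod_encode (0, i)) = Var i"
  using dec_enc[of "Var i"] by simp

lemma dec_Op [simp]: "dec (prod_encode (Suc c, prod_encode (k, l))) = Op c k (decs l)"
proof -
  have "map enc (decs l) = list_decode l" by (simp add: decs_def map_idI)
  then have "enc (Op c k (decs l)) = prod_encode (Suc c, prod_encode (k, l))" by simp
  then show ?thesis by (metis dec_enc)
qed

lemma dec_Op' [simp]:
  "dec (prod_encode (Suc 0, prod_encode (k, l))) = Op 0 k (decs l)"
  "dec (prod_encode (numeral n, prod_encode (k, l))) = Op (pred_numeral n) k (decs l)"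
  using dec_Op by (simp_all add: numeral_eq_Suc)

text \<open>A fact is coded as a pair of a relation number and the tuple of arguments.\<close>

abbreviation "x0 \<equiv> PV 0" abbreviation "x1 \<equiv> PV 1" abbreviation "x2 \<equiv> PV 2" abbreviation "x3 \<equiv> PV 3"
abbreviation "x4 \<equiv> PV 4" abbreviation "x5 \<equiv> PV 5" abbreviation "x6 \<equiv> PV 6" abbreviation "x7 \<equiv> PV 7"

abbreviation "pL i j \<equiv> PP (PC 0) (PP i j)"
abbreviation "pN i j \<equiv> PP (PC 1) (PP i j)"
abbreviation "pA i j k \<equiv> PP (PC 2) (PP i (PP j k))"
abbreviation "pW t \<equiv> PP (PC 3) t"
abbreviation "pSh d c t t' \<equiv> PP (PC 4) (PP d (PP c (PP t t')))"
abbreviation "pShs d c t t' \<equiv> PP (PC 5) (PP d (PP c (PP t t')))"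
abbreviation "pR i s t t' \<equiv> PP (PC 6) (PP i (PP s (PP t t')))"
abbreviation "pRs i s t t' \<equiv> PP (PC 7) (PP i (PP s (PP t t')))"
abbreviation "pI i s t t' \<equiv> PP (PC 8) (PP i (PP s (PP t t')))"
abbreviation "pIs i s t t' \<equiv> PP (PC 9) (PP i (PP s (PP t t')))"
abbreviation "pF i t \<equiv> PP (PC 10) (PP i t)"
abbreviation "pFs i t \<equiv> PP (PC 11) (PP i t)"
abbreviation "pNum n t \<equiv> PP (PC 12) (PP n t)"
abbreviation "pSt t t' \<equiv> PP (PC 13) (PP t t')"
abbreviation "pM a l \<equiv> PP (PC 14) (PP a l)"
abbreviation "pSub l l' \<equiv> PP (PC 15) (PP l l')"
abbreviation "pWs l \<equiv> PP (PC 16) l"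
abbreviation "pD g c \<equiv> PP (PC 17) (PP g c)"

text \<open>The intended reading of the relation numbers, against which the clauses are checked. The
  last branch covers all numbers from 17 on; the program itself uses only 17 among them.\<close>

definition holds :: "nat \<Rightarrow> bool" where
  "holds x \<longleftrightarrow> (let r = pfst x; a = psnd x; a1 = pfst a; b = psnd a; a2 = pfst b; c = psnd b;
      a3 = pfst c; a4 = psnd c in
    if r = 0 then a1 < b
    else if r = 1 then a1 \<noteq> b
    else if r = 2 then c = a1 + a2
    else if r = 3 then wf_term (dec a)
    else if r = 4 then dec a4 = shift a1 a2 (dec a3)
    else if r = 5 then decs a4 = map (shift a1 a2) (decs a3)
    else if r = 6 then dec a4 = repl a1 (dec a2) (dec a3)
    else if r = 7 then decs a4 = map (repl a1 (dec a2)) (decs a3)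
    else if r = 8 then dec a4 = inst a1 (dec a2) (dec a3)
    else if r = 9 then decs a4 = map (inst a1 (dec a2)) (decs a3)
    else if r = 10 then a1 \<notin> fv (dec b)
    else if r = 11 then (\<forall>t \<in> set (decs b). a1 \<notin> fv t)
    else if r = 12 then dec b = num a1
    else if r = 13 then dec a1 \<triangleright> dec b
    else if r = 14 then a1 \<in> codes b
    else if r = 15 then codes a1 \<subseteq> codes b
    else if r = 16 then (\<forall>t \<in> set (decs a). wf_term t)
    else derivable (fset_of_list (decs a1) \<turnstile> dec b))"

lemma holds_simps [simp]:
  "holds (prod_encode (0, prod_encode (i, j))) \<longleftrightarrow> i < j"
  "holds (prod_encode (1, prod_encode (i, j))) \<longleftrightarrow> i \<noteq> j"
  "holds (prod_encode (2, prod_encode (i, prod_encode (j, k)))) \<longleftrightarrow> k = i + j"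
  "holds (prod_encode (3, a)) \<longleftrightarrow> wf_term (dec a)"
  "holds (prod_encode (4, prod_encode (d, prod_encode (c, prod_encode (a, b))))) \<longleftrightarrow>
    dec b = shift d c (dec a)"
  "holds (prod_encode (5, prod_encode (d, prod_encode (c, prod_encode (a, b))))) \<longleftrightarrow>
    decs b = map (shift d c) (decs a)"
  "holds (prod_encode (6, prod_encode (i, prod_encode (s, prod_encode (a, b))))) \<longleftrightarrow>
    dec b = repl i (dec s) (dec a)"
  "holds (prod_encode (7, prod_encode (i, prod_encode (s, prod_encode (a, b))))) \<longleftrightarrow>
    decs b = map (repl i (dec s)) (decs a)"
  "holds (prod_encode (8, prod_encode (i, prod_encode (s, prod_encode (a, b))))) \<longleftrightarrow>
    dec b = inst i (dec s) (dec a)"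
  "holds (prod_encode (9, prod_encode (i, prod_encode (s, prod_encode (a, b))))) \<longleftrightarrow>
    decs b = map (inst i (dec s)) (decs a)"
  "holds (prod_encode (10, prod_encode (i, a))) \<longleftrightarrow> i \<notin> fv (dec a)"
  "holds (prod_encode (11, prod_encode (i, a))) \<longleftrightarrow> (\<forall>t \<in> set (decs a). i \<notin> fv t)"
  "holds (prod_encode (12, prod_encode (n, a))) \<longleftrightarrow> dec a = num n"
  "holds (prod_encode (13, prod_encode (a, b))) \<longleftrightarrow> dec a \<triangleright> dec b"
  "holds (prod_encode (14, prod_encode (a, b))) \<longleftrightarrow> a \<in> codes b"
  "holds (prod_encode (15, prod_encode (a, b))) \<longleftrightarrow> codes a \<subseteq> codes b"
  "holds (prod_encode (16, a)) \<longleftrightarrow> (\<forall>t \<in> set (decs a). wf_term t)"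
  "holds (prod_encode (17, prod_encode (a, b))) \<longleftrightarrow> derivable (fset_of_list (decs a) \<turnstile> dec b)"
  by (simp_all add: holds_def)

abbreviation "pVar i \<equiv> PP (PC 0) i"
abbreviation "pOp c k l \<equiv> PP (PS c) (PP k l)"
abbreviation "pNil \<equiv> PC 0"
abbreviation pCons (infixr "##" 55) where "x ## l \<equiv> PS (PP x l)"
abbreviation "pConst c \<equiv> PP (PC c) (PP (PC 0) pNil)"
abbreviation "pUn c t \<equiv> PP (PC c) (PP (PC 0) (t ## pNil))"
abbreviation "pBin c t u \<equiv> PP (PC c) (PP (PC 0) (t ## u ## pNil))"
text \<open>The tags are operator codes plus one, as tag 0 marks variables.\<close>

abbreviation "pBot \<equiv> pConst (Suc 0)"
abbreviation "pZer \<equiv> pConst 2"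
abbreviation "pRcs \<equiv> pConst 3"
abbreviation "pAll \<equiv> pConst 4"
abbreviation "pSS \<equiv> pUn 5"
abbreviation "pNeg \<equiv> pUn 6"
abbreviation "pLam t \<equiv> PP (PC 7) (PP (PC 1) (t ## pNil))"
abbreviation "pEq \<equiv> pBin 8"
abbreviation "pOr \<equiv> pBin 9"
abbreviation pApp (infixl "\<cdot>\<^sub>p" 90) where "t \<cdot>\<^sub>p u \<equiv> pBin 10 t u"
abbreviation "pIsN t \<equiv> pEq t t"

text \<open>Horn clauses have no negation, so disequality here, and not occurring free in
  \<open>subst_prog\<close>, are relations with positive clauses of their own.\<close>

definition arith_prog :: "(pat list \<times> pat) list" where
  "arith_prog =
   [([], pL (PC 0) (PS x0)),
    ([pL x0 x1], pL (PS x0) (PS x1)),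
    ([pL x0 x1], pN x0 x1),
    ([pL x0 x1], pN x1 x0),
    ([], pA x0 (PC 0) x0),
    ([pA x0 x1 x2], pA x0 (PS x1) (PS x2))]"

definition wf_prog :: "(pat list \<times> pat) list" where
  "wf_prog =
   [([], pW (pVar x0)), ([], pW pBot), ([], pW pZer), ([], pW pRcs), ([], pW pAll),
    ([pW x0], pW (pSS x0)),
    ([pW x0], pW (pNeg x0)),
    ([pW x0], pW (pLam x0)),
    ([pW x0, pW x1], pW (pEq x0 x1)),
    ([pW x0, pW x1], pW (pOr x0 x1)),
    ([pW x0, pW x1], pW (x0 \<cdot>\<^sub>p x1)),
    ([], pWs pNil),
    ([pW x0, pWs x1], pWs (x0 ## x1))]"

text \<open>Each syntactic operation is given by its graph, with a companion relation for argument
  lists. In the second clause for variables, \<open>pA x1 x3 x0\<close> expresses that the index is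
  at least the cutoff. In the clauses for \<open>pI\<close>, writing a larger index as
  \<open>PS x2\<close> performs the decrement.\<close>

definition subst_prog :: "(pat list \<times> pat) list" where
  "subst_prog =
   [([pL x0 x1], pSh x2 x1 (pVar x0) (pVar x0)),
    ([pA x1 x3 x0, pA x0 x2 x4], pSh x2 x1 (pVar x0) (pVar x4)),
    ([pA x1 x2 x3, pShs x0 x3 x4 x5], pSh x0 x1 (pOp x6 x2 x4) (pOp x6 x2 x5)),
    ([], pShs x0 x1 pNil pNil),
    ([pSh x0 x1 x2 x3, pShs x0 x1 x4 x5], pShs x0 x1 (x2 ## x4) (x3 ## x5)),
    ([], pR x0 x1 (pVar x0) x1),
    ([pN x0 x2], pR x0 x1 (pVar x2) (pVar x2)),
    ([pA x0 x2 x3, pSh x2 (PC 0) x1 x4, pRs x3 x4 x5 x6], pR x0 x1 (pOp x7 x2 x5) (pOp x7 x2 x6)),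
    ([], pRs x0 x1 pNil pNil),
    ([pR x0 x1 x2 x3, pRs x0 x1 x4 x5], pRs x0 x1 (x2 ## x4) (x3 ## x5)),
    ([], pI x0 x1 (pVar x0) x1),
    ([pL x2 x0], pI x0 x1 (pVar x2) (pVar x2)),
    ([pL x0 (PS x2)], pI x0 x1 (pVar (PS x2)) (pVar x2)),
    ([pA x0 x2 x3, pSh x2 (PC 0) x1 x4, pIs x3 x4 x5 x6], pI x0 x1 (pOp x7 x2 x5) (pOp x7 x2 x6)),
    ([], pIs x0 x1 pNil pNil),
    ([pI x0 x1 x2 x3, pIs x0 x1 x4 x5], pIs x0 x1 (x2 ## x4) (x3 ## x5)),
    ([pN x0 x1], pF x0 (pVar x1)),
    ([pA x0 x1 x2, pFs x2 x3], pF x0 (pOp x4 x1 x3)),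
    ([], pFs x0 pNil),
    ([pF x0 x1, pFs x0 x2], pFs x0 (x1 ## x2))]"

definition step_prog :: "(pat list \<times> pat) list" where
  "step_prog =
   [([], pNum (PC 0) pZer),
    ([pNum x0 x1], pNum (PS x0) (pSS x1)),
    ([pW x0, pI (PC 0) x0 x1 x2], pSt (pLam x1 \<cdot>\<^sub>p x0) x2),
    ([pW x1], pSt (pRcs \<cdot>\<^sub>p x0 \<cdot>\<^sub>p x1 \<cdot>\<^sub>p pZer) x0),
    ([pW x0, pNum x2 x3],
      pSt (pRcs \<cdot>\<^sub>p x0 \<cdot>\<^sub>p x1 \<cdot>\<^sub>p pSS x3) (x1 \<cdot>\<^sub>p x3 \<cdot>\<^sub>p (pRcs \<cdot>\<^sub>p x0 \<cdot>\<^sub>p x1 \<cdot>\<^sub>p x3))),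
    ([pSt x0 x1], pSt (x0 \<cdot>\<^sub>p x2) (x1 \<cdot>\<^sub>p x2)),
    ([], pM x0 (x0 ## x1)),
    ([pM x0 x1], pM x0 (x2 ## x1)),
    ([], pSub pNil x0),
    ([pM x0 x2, pSub x1 x2], pSub (x0 ## x1) x2)]"

text \<open>Contexts are coded as lists; clause \<open>0\<close> makes derivability depend only on their elements.
  The rules whose conclusion coincides with their premise have no clause.\<close>

definition rule_prog :: "(pat list \<times> pat) list" where
  "rule_prog =
   [([pD x0 x1, pSub x0 x2], pD x2 x1),
    ([pW x1], pD (x1 ## x0) x1),
    ([pD x0 x1, pD (x1 ## x0) x2], pD x0 x2),
    ([pWs x0, pW x1, pW x2, pRs x3 x2 x0 x4, pR x3 x2 x1 x5, pD x0 x1], pD x4 x5),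
    ([pD x0 x1], pD x0 (pEq x1 (pSS pZer))),
    ([pD x0 (pEq x1 (pSS pZer))], pD x0 x1),
    ([pD x0 (pNeg x1)], pD x0 (pEq x1 pZer)),
    ([pD x0 (pEq x1 pZer)], pD x0 (pNeg x1)),
    ([pW x2, pD x0 (pNeg x1), pD x0 x1], pD x0 x2),
    ([pD x0 x1], pD x0 (pNeg (pNeg x1))),
    ([pD x0 (pNeg (pNeg x1))], pD x0 x1),
    ([pW x2, pD x0 x1], pD x0 (pOr x1 x2)),
    ([pW x1, pD x0 x2], pD x0 (pOr x1 x2)),
    ([pD x0 (pNeg x1), pD x0 (pNeg x2)], pD x0 (pNeg (pOr x1 x2))),
    ([pD x0 (pOr x1 x2), pD (x1 ## x0) x3, pD (x2 ## x0) x3], pD x0 x3),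
    ([pD x0 (pNeg (pOr x1 x2))], pD x0 (pNeg x1)),
    ([pD x0 (pNeg (pOr x1 x2))], pD x0 (pNeg x2)),
    ([pD x0 (pEq x1 x2)], pD x0 (pEq x2 x1)),
    ([pW x3, pD x0 (pEq x1 x2), pR x4 x1 x3 x5, pR x4 x2 x3 x6, pD x0 x5], pD x0 x6),
    ([pD x0 (pNeg (pEq x1 x2))], pD x0 (pNeg (pEq x2 x1))),
    ([pD x0 (pIsN x1), pD x0 (pIsN x2)], pD x0 (pOr (pEq x1 x2) (pNeg (pEq x1 x2)))),
    ([pD x0 (pOr (pEq x1 x2) (pNeg (pEq x1 x2)))],
      pD x0 (pNeg (pOr (pNeg (pIsN x1)) (pNeg (pIsN x2))))),
    ([], pD x0 (pIsN pZer)),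
    ([pD x0 (pIsN x1)], pD x0 (pIsN (pSS x1))),
    ([pD x0 (pIsN (pSS x1))], pD x0 (pIsN x1)),
    ([pD x0 (pIsN x1)], pD x0 (pNeg (pEq (pSS x1) pZer))),
    ([pD x0 (pNeg (pEq x1 x2))], pD x0 (pNeg (pEq (pSS x1) (pSS x2)))),
    ([pD x0 (pNeg (pEq (pSS x1) (pSS x2)))], pD x0 (pNeg (pEq x1 x2))),
    ([pD x0 (pEq (pSS x1) (pSS x2))], pD x0 (pEq x1 x2)),
    ([pW x1, pD x0 (pIsN pBot)], pD x0 x1),
    ([pW x1, pFs x2 x0, pR x2 pZer x1 x3, pD x0 x3, pR x2 (pSS (pVar x2)) x1 x4,
      pD (pIsN (pVar x2) ## x1 ## x0) x4, pD x0 (pIsN x5), pR x2 x5 x1 x6], pD x0 x6),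
    ([pSt x1 x2, pD x0 x2], pD x0 x1),
    ([pSt x1 x2, pD x0 x1], pD x0 x2),
    ([pSt x1 x2, pD x0 (pIsN x2)], pD x0 (pEq x1 x2)),
    ([pW x1, pD x0 (pIsN x2), pD x0 (pIsN (x3 \<cdot>\<^sub>p x2 \<cdot>\<^sub>p (pRcs \<cdot>\<^sub>p x1 \<cdot>\<^sub>p x3 \<cdot>\<^sub>p x2)))],
      pD x0 (pEq (pRcs \<cdot>\<^sub>p x1 \<cdot>\<^sub>p x3 \<cdot>\<^sub>p pSS x2) (x3 \<cdot>\<^sub>p x2 \<cdot>\<^sub>p (pRcs \<cdot>\<^sub>p x1 \<cdot>\<^sub>p x3 \<cdot>\<^sub>p x2)))),
    ([pShs (PC 1) (PC 0) x0 x2, pSh (PC 1) (PC 0) x1 x3,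
      pD (pIsN (pVar (PC 0)) ## x2) (x3 \<cdot>\<^sub>p pVar (PC 0))], pD x0 (pAll \<cdot>\<^sub>p x1)),
    ([pD x0 (pAll \<cdot>\<^sub>p x1), pD x0 (pIsN x2)], pD x0 (x1 \<cdot>\<^sub>p x2)),
    ([pD x0 (pNeg (x1 \<cdot>\<^sub>p x2)), pD x0 (pIsN x2)], pD x0 (pNeg (pAll \<cdot>\<^sub>p x1))),
    ([pD x0 (pNeg (pAll \<cdot>\<^sub>p x1)), pShs (PC 1) (PC 0) x0 x3, pSh (PC 1) (PC 0) x1 x4,
      pSh (PC 1) (PC 0) x2 x5,
      pD (pIsN (pVar (PC 0)) ## pNeg (x4 \<cdot>\<^sub>p pVar (PC 0)) ## x3) x5], pD x0 x2)]"

definition rga_prog :: "(pat list \<times> pat) list" where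
  "rga_prog = arith_prog @ wf_prog @ subst_prog @ step_prog @ rule_prog"

definition sound :: "(pat list \<times> pat) \<Rightarrow> bool" where
  "sound cl \<longleftrightarrow> (\<forall>\<sigma>. (\<forall>p \<in> set (fst cl). holds (pev \<sigma> p)) \<longrightarrow> holds (pev \<sigma> (snd cl)))"

section \<open>Soundness of the clauses\<close>

lemma sound_arith: "list_all sound arith_prog"
  by (auto simp: arith_prog_def sound_def)

lemma sound_wf: "list_all sound wf_prog"
  by (auto simp: wf_prog_def sound_def intro: wf_term.intros)

lemma sound_subst: "list_all sound subst_prog"
  by (simp add: subst_prog_def sound_def) (auto simp: One_nat_def)

lemma sound_step: "list_all sound step_prog"
  by (simp add: step_prog_def sound_def) (metis head_step.intros)


lemma derivable_rule0: "rule [] j \<Longrightarrow> derivable j"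
  by (erule derivable_rule) simp

lemma derivable_rule1: "rule [p] j \<Longrightarrow> derivable p \<Longrightarrow> derivable j"
  by (erule derivable_rule) simp

lemma derivable_rule2: "rule [p, q] j \<Longrightarrow> derivable p \<Longrightarrow> derivable q \<Longrightarrow> derivable j"
  by (erule derivable_rule) auto

lemma derivable_rule3: "rule [p, q, r] j \<Longrightarrow> derivable p \<Longrightarrow> derivable q \<Longrightarrow> derivable r \<Longrightarrow> derivable j"
  by (erule derivable_rule) auto

lemma derivable_mono: "derivable (\<Gamma> \<turnstile> c) \<Longrightarrow> derivable (fset_of_list as |\<union>| \<Gamma> \<turnstile> c)"
  by (induction as) (auto intro: derivable_rule1[OF weaken])

lemma derivable_codes_mono:
  assumes "derivable (fset_of_list (decs g) \<turnstile> c)" "codes g \<subseteq> codes g'"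
  shows "derivable (fset_of_list (decs g') \<turnstile> c)"
proof -
  have "fset_of_list (decs g') |\<union>| fset_of_list (decs g) = fset_of_list (decs g')"
    using assms(2) by (auto simp: decs_def fset_of_list_elem)
  with derivable_mono[OF assms(1), of "decs g'"] show ?thesis by simp
qed

lemma derivable_subst:
  "\<forall>a \<in> set as. wf_term a \<Longrightarrow> wf_term c \<Longrightarrow> wf_term s \<Longrightarrow> derivable (fset_of_list as \<turnstile> c) \<Longrightarrow>
    derivable (repl v s |`| fset_of_list as \<turnstile> repl v s c)"
  by (rule derivable_rule1[OF substitution]) (simp_all add: fset_of_list_elem)

lemma derivable_induction:
  "wf_term c \<Longrightarrow> \<forall>b \<in> set bs. i \<notin> fv b \<Longrightarrow> derivable (fset_of_list bs \<turnstile> repl i Zer c) \<Longrightarrow>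
    derivable (finsert (isN (Var i)) (finsert c (fset_of_list bs)) \<turnstile> repl i (SS (Var i)) c) \<Longrightarrow>
    derivable (fset_of_list bs \<turnstile> isN a) \<Longrightarrow> derivable (fset_of_list bs \<turnstile> repl i a c)"
  by (rule derivable_rule3[OF induction]) (simp_all add: fset_of_list_elem)

text \<open>The program spells out \<open>num 1\<close>; the truth rules are folded into that form
  so that they match the clauses.\<close>

lemma SS_Zer: "SS Zer = num 1"
  by (simp add: One_nat_def)

lemmas derivable_intros =
  derivable_rule0[OF hyp] derivable_rule2[OF cut] derivable_subst
  derivable_rule1[OF true1, folded SS_Zer] derivable_rule1[OF true2, folded SS_Zer]
  derivable_rule1[OF false1, unfolded num.simps] derivable_rule1[OF false2, unfolded num.simps]
  derivable_rule2[OF neg_elim] derivable_rule1[OF neg_neg1] derivable_rule1[OF neg_neg2]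
  derivable_rule1[OF or_intro1] derivable_rule1[OF or_intro2] derivable_rule2[OF nor_intro]
  derivable_rule3[OF or_elim] derivable_rule1[OF nor_elim1] derivable_rule1[OF nor_elim2]
  derivable_rule1[OF eq_sym] derivable_rule2[OF eq_subst] derivable_rule1[OF neq_sym]
  derivable_rule2[OF eq_bool1] derivable_rule1[OF eq_bool2]
  derivable_rule0[OF zero_nat] derivable_rule1[OF suc_nat1] derivable_rule1[OF suc_nat2]
  derivable_rule1[OF suc_neq_zero] derivable_rule1[OF suc_neq1] derivable_rule1[OF suc_neq2]
  derivable_rule1[OF suc_inj] derivable_rule1[OF bot_elim] derivable_induction
  derivable_rule1[OF conv1] derivable_rule1[OF conv2] derivable_rule1[OF conv_eq]
  derivable_rule2[OF recursor] derivable_rule1[OF all_intro] derivable_rule2[OF all_elim]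
  derivable_rule2[OF not_all_intro] derivable_rule2[OF not_all_elim]

lemma sound_rule_prog: "list_all sound rule_prog"
  unfolding rule_prog_def list.pred_inject
  apply (intro conjI)
  apply (simp_all add: sound_def)
  \<comment> \<open>Clause 0 is not a rule of the calculus; it combines weakening with a change of
    the list that codes the context.\<close>
  apply (blast intro: derivable_codes_mono)
  apply ((intro allI impI, (elim conjE)?,
      ((rule derivable_intros; assumption) | (simp, (rule derivable_intros; assumption))))+)
  done

section \<open>Completeness of the clauses\<close>

abbreviation "rga_fact \<equiv> horn rga_prog"

text \<open>A clause is addressed by its position and its variables by a list of values, so that a
  use of a clause becomes a concrete instance which simplification can evaluate.\<close>

lemma horn_nth:
  assumes "set G \<subseteq> set P" "k < length G" "\<forall>p \<in> set (fst (G ! k)). horn P (pev ((!) xs) p)"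
  shows "horn P (pev ((!) xs) (snd (G ! k)))"
proof (rule horn.clause)
  show "(fst (G ! k), snd (G ! k)) \<in> set P" using assms(1,2) by auto
qed (use assms(3) in blast)

lemma sub_progs: "set arith_prog \<subseteq> set rga_prog" "set wf_prog \<subseteq> set rga_prog"
  "set subst_prog \<subseteq> set rga_prog" "set step_prog \<subseteq> set rga_prog" "set rule_prog \<subseteq> set rga_prog"
  by (auto simp: rga_prog_def)

lemmas horn_arith = sub_progs(1)[THEN horn_nth]
lemmas horn_wf = sub_progs(2)[THEN horn_nth]
lemmas horn_subst = sub_progs(3)[THEN horn_nth]
lemmas horn_step = sub_progs(4)[THEN horn_nth]
lemmas horn_rule = sub_progs(5)[THEN horn_nth]

lemma horn_less [simp]: "i < j \<Longrightarrow> rga_fact (prod_encode (0, prod_encode (i, j)))"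
proof (induction i arbitrary: j)
  case 0
  then obtain k where "j = Suc k" by (cases j) auto
  then show ?case using horn_arith[of 0 "[k]"] by (simp add: arith_prog_def)
next
  case (Suc i)
  then obtain k where "j = Suc k" "i < k" by (cases j) auto
  then show ?case using horn_arith[of 1 "[i, k]"] Suc.IH[of k] by (simp add: arith_prog_def One_nat_def)
qed

lemma horn_holds: "rga_fact x \<Longrightarrow> holds x"
proof (induction rule: horn.induct)
  case (clause ps q \<sigma>)
  have "list_all sound rga_prog"
    by (simp add: rga_prog_def sound_arith sound_wf sound_subst sound_step sound_rule_prog)
  then have "sound (ps, q)" using clause(1) by (auto simp: list_all_iff)
  then show ?case using clause(3) by (simp add: sound_def)
qed

lemma horn_neq: "i \<noteq> j \<Longrightarrow> rga_fact (prod_encode (1, prod_encode (i, j)))"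
  using horn_arith[of 2 "[i, j]"] horn_arith[of 3 "[j, i]"] horn_less[of i j] horn_less[of j i]
  by (cases i j rule: linorder_cases) (auto simp: arith_prog_def One_nat_def)

lemma horn_add: "rga_fact (prod_encode (2, prod_encode (i, prod_encode (j, i + j))))"
proof (induction j)
  case 0
  then show ?case using horn_arith[of 4 "[i]"] by (simp add: arith_prog_def)
next
  case (Suc j)
  then show ?case using horn_arith[of 5 "[i, j, i + j]"] by (simp add: arith_prog_def One_nat_def)
qed

lemma horn_wf_term: "wf_term t \<Longrightarrow> rga_fact (prod_encode (3, enc t))"
proof (induction rule: wf_term.induct)
  case (1 i)
  show ?case using horn_wf[of 0 "[i]"] by (simp add: wf_prog_def)
next
  case 2
  show ?case using horn_wf[of 1 "[]"] by (simp add: wf_prog_def)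
next
  case 3
  show ?case using horn_wf[of 2 "[]"] by (simp add: wf_prog_def)
next
  case 4
  show ?case using horn_wf[of 3 "[]"] by (simp add: wf_prog_def)
next
  case 5
  show ?case using horn_wf[of 4 "[]"] by (simp add: wf_prog_def)
next
  case (6 t)
  then show ?case using horn_wf[of 5 "[enc t]"] by (simp add: wf_prog_def)
next
  case (7 t)
  then show ?case using horn_wf[of 6 "[enc t]"] by (simp add: wf_prog_def)
next
  case (8 t)
  then show ?case using horn_wf[of 7 "[enc t]"] by (simp add: wf_prog_def)
next
  case (9 t u)
  then show ?case using horn_wf[of 8 "[enc t, enc u]"] by (simp add: wf_prog_def One_nat_def)
next
  case (10 t u)
  then show ?case using horn_wf[of 9 "[enc t, enc u]"] by (simp add: wf_prog_def One_nat_def)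
next
  case (11 t u)
  then show ?case using horn_wf[of 10 "[enc t, enc u]"] by (simp add: wf_prog_def One_nat_def)
qed

lemma horn_wf_list: "\<forall>t \<in> set ts. wf_term t \<Longrightarrow> rga_fact (prod_encode (16, list_encode (map enc ts)))"
proof (induction ts)
  case Nil
  show ?case using horn_wf[of 11 "[]"] by (simp add: wf_prog_def)
next
  case (Cons t ts)
  then show ?case using horn_wf[of 12 "[enc t, list_encode (map enc ts)]"] horn_wf_term[of t]
    by (simp add: wf_prog_def One_nat_def)
qed

text \<open>The relations on argument lists follow elementwise; they are proved inside the structural
  induction on terms.\<close>

lemma horn_map:
  assumes "rga_fact (r 0 0)"
    and "\<And>x y l m. rga_fact (s x y) \<Longrightarrow> rga_fact (r l m) \<Longrightarrow> rga_fact (r (Suc (prod_encode (x, l))) (Suc (prod_encode (y, m))))"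
    and "\<And>t. t \<in> set ts \<Longrightarrow> rga_fact (s (enc t) (enc (f t)))"
  shows "rga_fact (r (list_encode (map enc ts)) (list_encode (map enc (map f ts))))"
  using assms(3) by (induction ts) (simp_all add: assms(1,2))

abbreviation "rel4 n a b c d \<equiv> rga_fact (prod_encode (n, prod_encode (a, prod_encode (b, prod_encode (c, d)))))"

lemma horn_shift_list:
  assumes "\<And>t. t \<in> set ts \<Longrightarrow> rel4 4 d c (enc t) (enc (shift d c t))"
  shows "rel4 5 d c (list_encode (map enc ts)) (list_encode (map enc (map (shift d c) ts)))"
proof (rule horn_map[of "\<lambda>l m. prod_encode (5, prod_encode (d, prod_encode (c, prod_encode (l, m))))"
      "\<lambda>x y. prod_encode (4, prod_encode (d, prod_encode (c, prod_encode (x, y))))"])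
  show "rel4 5 d c 0 0" using horn_subst[of 3 "[d, c]"] by (simp add: subst_prog_def One_nat_def)
  show "rel4 5 d c (Suc (prod_encode (x, l))) (Suc (prod_encode (y, m)))"
    if "rel4 4 d c x y" "rel4 5 d c l m" for x y l m
    using horn_subst[of 4 "[d, c, x, y, l, m]"] that
    by (simp add: subst_prog_def One_nat_def numeral_nat)
qed (use assms in blast)

lemma horn_shift: "rel4 4 d c (enc t) (enc (shift d c t))"
proof (induction t arbitrary: c)
  case (Var i)
  show ?case
  proof (cases "i < c")
    case True
    then show ?thesis using horn_subst[of 0 "[i, c, d]"] by (simp add: subst_prog_def One_nat_def)
  next
    case False
    then obtain k where "i = c + k" by (metis le_Suc_ex not_less)
    then show ?thesis using horn_subst[of 1 "[i, c, d, k, i + d]"] horn_add[of c k] horn_add[of i d]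
      by (simp add: subst_prog_def One_nat_def numeral_nat)
  qed
next
  case (Op f k ts)
  from horn_shift_list[of ts d "c + k", OF Op] show ?case
    using horn_subst[of 2 "[d, c, k, c + k, list_encode (map enc ts),
        list_encode (map enc (map (shift d (c + k)) ts)), f]"] horn_add[of c k]
    by (simp add: subst_prog_def One_nat_def numeral_nat)
qed

lemma horn_shift_terms:
  "rel4 5 d c (list_encode (map enc ts)) (list_encode (map enc (map (shift d c) ts)))"
  by (rule horn_shift_list) (rule horn_shift)

lemma horn_repl_list:
  assumes "\<And>t. t \<in> set ts \<Longrightarrow> rel4 6 i (enc s) (enc t) (enc (repl i s t))"
  shows "rel4 7 i (enc s) (list_encode (map enc ts)) (list_encode (map enc (map (repl i s) ts)))"
proof (rule horn_map[of "\<lambda>l m. prod_encode (7, prod_encode (i, prod_encode (enc s, prod_encode (l, m))))"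
      "\<lambda>x y. prod_encode (6, prod_encode (i, prod_encode (enc s, prod_encode (x, y))))"])
  show "rel4 7 i (enc s) 0 0" using horn_subst[of 8 "[i, enc s]"] by (simp add: subst_prog_def One_nat_def)
  show "rel4 7 i (enc s) (Suc (prod_encode (x, l))) (Suc (prod_encode (y, m)))"
    if "rel4 6 i (enc s) x y" "rel4 7 i (enc s) l m" for x y l m
    using horn_subst[of 9 "[i, enc s, x, y, l, m]"] that
    by (simp add: subst_prog_def One_nat_def numeral_nat)
qed (use assms in blast)

lemma horn_repl: "rel4 6 i (enc s) (enc t) (enc (repl i s t))"
proof (induction t arbitrary: i s)
  case (Var j)
  show ?case
    using horn_subst[of 5 "[j, enc s]"] horn_subst[of 6 "[i, enc s, j]"] horn_neq[of i j]
    by (cases "j = i") (simp_all add: subst_prog_def One_nat_def numeral_nat)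
next
  case (Op f k ts)
  from horn_repl_list[of ts "i + k" "shift k 0 s", OF Op] show ?case
    using horn_subst[of 7 "[i, enc s, k, i + k, enc (shift k 0 s), list_encode (map enc ts),
        list_encode (map enc (map (repl (i + k) (shift k 0 s)) ts)), f]"] horn_add[of i k] horn_shift[of k 0 s]
    by (simp add: subst_prog_def One_nat_def numeral_nat)
qed

lemma horn_repl_terms:
  "rel4 7 i (enc s) (list_encode (map enc ts)) (list_encode (map enc (map (repl i s) ts)))"
  by (rule horn_repl_list) (rule horn_repl)

lemma horn_inst_list:
  assumes "\<And>t. t \<in> set ts \<Longrightarrow> rel4 8 i (enc s) (enc t) (enc (inst i s t))"
  shows "rel4 9 i (enc s) (list_encode (map enc ts)) (list_encode (map enc (map (inst i s) ts)))"
proof (rule horn_map[of "\<lambda>l m. prod_encode (9, prod_encode (i, prod_encode (enc s, prod_encode (l, m))))"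
      "\<lambda>x y. prod_encode (8, prod_encode (i, prod_encode (enc s, prod_encode (x, y))))"])
  show "rel4 9 i (enc s) 0 0" using horn_subst[of 14 "[i, enc s]"] by (simp add: subst_prog_def One_nat_def)
  show "rel4 9 i (enc s) (Suc (prod_encode (x, l))) (Suc (prod_encode (y, m)))"
    if "rel4 8 i (enc s) x y" "rel4 9 i (enc s) l m" for x y l m
    using horn_subst[of 15 "[i, enc s, x, y, l, m]"] that
    by (simp add: subst_prog_def One_nat_def numeral_nat)
qed (use assms in blast)

lemma horn_inst: "rel4 8 i (enc s) (enc t) (enc (inst i s t))"
proof (induction t arbitrary: i s)
  case (Var j)
  show ?case
  proof (cases i j rule: linorder_cases)
    case less
    then obtain k where "j = Suc k" by (cases j) auto
    then show ?thesis using less horn_subst[of 12 "[i, enc s, k]"] horn_less[of i j]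
      by (simp add: subst_prog_def One_nat_def numeral_nat)
  next
    case equal
    then show ?thesis using horn_subst[of 10 "[i, enc s]"]
      by (simp add: subst_prog_def One_nat_def)
  next
    case greater
    then show ?thesis using horn_subst[of 11 "[i, enc s, j]"] horn_less[of j i]
      by (simp add: subst_prog_def One_nat_def numeral_nat)
  qed
next
  case (Op f k ts)
  from horn_inst_list[of ts "i + k" "shift k 0 s", OF Op] show ?case
    using horn_subst[of 13 "[i, enc s, k, i + k, enc (shift k 0 s), list_encode (map enc ts),
        list_encode (map enc (map (inst (i + k) (shift k 0 s)) ts)), f]"] horn_add[of i k] horn_shift[of k 0 s]
    by (simp add: subst_prog_def One_nat_def numeral_nat)
qed

lemma horn_not_fv_list:
  "(\<And>t. t \<in> set ts \<Longrightarrow> rga_fact (prod_encode (10, prod_encode (i, enc t)))) \<Longrightarrow>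
    rga_fact (prod_encode (11, prod_encode (i, list_encode (map enc ts))))"
proof (induction ts)
  case Nil
  show ?case using horn_subst[of 18 "[i]"] by (simp add: subst_prog_def)
next
  case (Cons t ts)
  then show ?case using horn_subst[of 19 "[i, enc t, list_encode (map enc ts)]"]
    by (simp add: subst_prog_def One_nat_def numeral_nat)
qed

lemma horn_not_fv: "i \<notin> fv t \<Longrightarrow> rga_fact (prod_encode (10, prod_encode (i, enc t)))"
proof (induction t arbitrary: i)
  case (Var j)
  then show ?case using horn_subst[of 16 "[i, j]"] horn_neq[of i j]
    by (simp add: subst_prog_def One_nat_def numeral_nat)
next
  case (Op f k ts)
  have "rga_fact (prod_encode (11, prod_encode (i + k, list_encode (map enc ts))))"
    by (rule horn_not_fv_list, rule Op.IH) (use Op.prems in auto)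
  then show ?case using horn_subst[of 17 "[i, k, i + k, list_encode (map enc ts), f]"] horn_add[of i k]
    by (simp add: subst_prog_def One_nat_def numeral_nat)
qed

lemma horn_not_fv_terms:
  "\<forall>t \<in> set ts. i \<notin> fv t \<Longrightarrow> rga_fact (prod_encode (11, prod_encode (i, list_encode (map enc ts))))"
  by (rule horn_not_fv_list) (simp add: horn_not_fv)

lemma horn_num: "rga_fact (prod_encode (12, prod_encode (n, enc (num n))))"
proof (induction n)
  case 0
  show ?case using horn_step[of 0 "[]"] by (simp add: step_prog_def)
next
  case (Suc n)
  then show ?case using horn_step[of 1 "[n, enc (num n)]"] by (simp add: step_prog_def One_nat_def)
qed

lemma horn_head_step: "t \<triangleright> t' \<Longrightarrow> rga_fact (prod_encode (13, prod_encode (enc t, enc t')))"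
proof (induction rule: head_step.induct)
  case (beta t b)
  then show ?case using horn_step[of 2 "[enc t, enc b, enc (inst 0 t b)]"] horn_inst[of 0 t b] horn_wf_term[of t]
    by (simp add: step_prog_def One_nat_def numeral_nat)
next
  case (rec_zero h g)
  then show ?case using horn_step[of 3 "[enc g, enc h]"] horn_wf_term[of h]
    by (simp add: step_prog_def One_nat_def numeral_nat)
next
  case (rec_suc g h n)
  then show ?case using horn_step[of 4 "[enc g, enc h, n, enc (num n)]"] horn_wf_term[of g] horn_num[of n]
    by (simp add: step_prog_def One_nat_def numeral_nat)
next
  case (app t t' u)
  then show ?case using horn_step[of 5 "[enc t, enc t', enc u]"]
    by (simp add: step_prog_def One_nat_def numeral_nat)
qed

lemma horn_mem: "a \<in> set as \<Longrightarrow> rga_fact (prod_encode (14, prod_encode (a, list_encode as)))"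
proof (induction as)
  case (Cons b as)
  then show ?case using horn_step[of 6 "[a, list_encode as]"] horn_step[of 7 "[a, list_encode as, b]"]
    by (auto simp: step_prog_def One_nat_def numeral_nat)
qed simp

lemma horn_subset: "set as \<subseteq> codes l \<Longrightarrow> rga_fact (prod_encode (15, prod_encode (list_encode as, l)))"
proof (induction as)
  case Nil
  show ?case using horn_step[of 8 "[l]"] by (simp add: step_prog_def)
next
  case (Cons a as)
  then show ?case using horn_step[of 9 "[a, list_encode as, l]"] horn_mem[of a "list_decode l"]
    by (simp add: step_prog_def One_nat_def numeral_nat)
qed

lemma horn_derivable_mono:
  assumes "rga_fact (prod_encode (17, prod_encode (g, c)))" "codes g \<subseteq> codes g'"
  shows "rga_fact (prod_encode (17, prod_encode (g', c)))"
  using horn_rule[of 0 "[g, c, g']"] assms horn_subset[of "list_decode g" g']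
  by (simp add: rule_prog_def One_nat_def numeral_nat)

text \<open>Sequents have sets as contexts, the program has list codes. Clause 0 makes the choice of
  the code immaterial, which \<open>horn_derives\<close> records.\<close>

definition derives :: "nat set \<Rightarrow> nat \<Rightarrow> bool" where
  "derives A c \<longleftrightarrow> (\<exists>g. codes g = A \<and> rga_fact (prod_encode (17, prod_encode (g, c))))"

lemma horn_derives: "rga_fact (prod_encode (17, prod_encode (g, c))) \<longleftrightarrow> derives (codes g) c"
  unfolding derives_def using horn_derivable_mono by blast

lemma derives_mono: "derives A c \<Longrightarrow> derives (insert a A) c"
proof -
  assume "derives A c"
  then obtain g where g: "codes g = A" "rga_fact (prod_encode (17, prod_encode (g, c)))"
    unfolding derives_def by blast
  have "rga_fact (prod_encode (17, prod_encode (Suc (prod_encode (a, g)), c)))"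
    by (rule horn_derivable_mono[OF g(2)]) auto
  then show ?thesis using g(1) by (simp add: horn_derives)
qed

definition list_of_fset :: "rterm fset \<Rightarrow> rterm list" where
  "list_of_fset \<Gamma> = (SOME xs. fset_of_list xs = \<Gamma>)"

lemma set_list_of_fset [simp]: "set (list_of_fset \<Gamma>) = fset \<Gamma>"
proof -
  have "fset_of_list (list_of_fset \<Gamma>) = \<Gamma>"
    unfolding list_of_fset_def by (rule someI_ex) (rule exists_fset_of_list)
  then show ?thesis by (metis fset_of_list.rep_eq)
qed

abbreviation "codel \<Gamma> \<equiv> list_encode (map enc (list_of_fset \<Gamma>))"

definition derives_seq :: "sequent \<Rightarrow> bool" where
  "derives_seq j \<longleftrightarrow> (case j of \<Gamma> \<turnstile> c \<Rightarrow> derives (enc ` fset \<Gamma>) (enc c))"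

lemma nth_Cons_1 [simp]: "(x # xs) ! 1 = xs ! 0"
  by (simp add: One_nat_def)

text \<open>Each rule is simulated by the clause at the given position; the list supplies values for
  \<open>x0\<close>, \<open>x1\<close> and so on. Weakening goes through clause 0, and the two rules
  between \<open>isN a\<close> and \<open>a \<doteq> a\<close> are identities.\<close>

lemma derives_seq_rule:
  assumes "rule ps j" "\<And>p. p \<in> set ps \<Longrightarrow> derives_seq p"
  shows "derives_seq j"
proof -
  note [simp] = derives_seq_def horn_derives rule_prog_def SS_Zer[symmetric] image_image
  have "\<forall>p \<in> set ps. derives_seq p" using assms(2) by blast
  with assms(1) show ?thesis
  proof (induction rule: rule.induct)
    case (hyp c \<Gamma>)
    then show ?case using horn_rule[of 1 "[codel \<Gamma>, enc c]"] horn_wf_term[of c] by simp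
  next
    case (weaken \<Gamma> c a)
    then show ?case by (simp add: derives_mono)
  next
    case (cut \<Gamma> a c)
    then show ?case using horn_rule[of 2 "[codel \<Gamma>, enc a, enc c]"] by simp
  next
    case (substitution \<Gamma> c s v)
    then show ?case using horn_rule[of 3 "[codel \<Gamma>, enc c, enc s, v, list_encode (map enc (map (repl v s) (list_of_fset \<Gamma>))), enc (repl v s c)]"]
      horn_wf_list[of "list_of_fset \<Gamma>"] horn_wf_term[of c] horn_wf_term[of s] horn_repl_terms[of v s "list_of_fset \<Gamma>"] horn_repl[of v s c]
      by simp
  next
    case (true1 \<Gamma> a)
    then show ?case using horn_rule[of 4 "[codel \<Gamma>, enc a]"] by simp
  next
    case (true2 \<Gamma> a)
    then show ?case using horn_rule[of 5 "[codel \<Gamma>, enc a]"] by simp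
  next
    case (false1 \<Gamma> a)
    then show ?case using horn_rule[of 6 "[codel \<Gamma>, enc a]"] by simp
  next
    case (false2 \<Gamma> a)
    then show ?case using horn_rule[of 7 "[codel \<Gamma>, enc a]"] by simp
  next
    case (neg_elim c \<Gamma> a)
    then show ?case using horn_rule[of 8 "[codel \<Gamma>, enc a, enc c]"] horn_wf_term[of c] by simp
  next
    case (neg_neg1 \<Gamma> a)
    then show ?case using horn_rule[of 9 "[codel \<Gamma>, enc a]"] by simp
  next
    case (neg_neg2 \<Gamma> a)
    then show ?case using horn_rule[of 10 "[codel \<Gamma>, enc a]"] by simp
  next
    case (or_intro1 b \<Gamma> a)
    then show ?case using horn_rule[of 11 "[codel \<Gamma>, enc a, enc b]"] horn_wf_term[of b] by simp
  next
    case (or_intro2 a \<Gamma> b)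
    then show ?case using horn_rule[of 12 "[codel \<Gamma>, enc a, enc b]"] horn_wf_term[of a] by simp
  next
    case (nor_intro \<Gamma> a b)
    then show ?case using horn_rule[of 13 "[codel \<Gamma>, enc a, enc b]"] by simp
  next
    case (or_elim \<Gamma> a b c)
    then show ?case using horn_rule[of 14 "[codel \<Gamma>, enc a, enc b, enc c]"] by simp
  next
    case (nor_elim1 \<Gamma> a b)
    then show ?case using horn_rule[of 15 "[codel \<Gamma>, enc a, enc b]"] by simp
  next
    case (nor_elim2 \<Gamma> a b)
    then show ?case using horn_rule[of 16 "[codel \<Gamma>, enc a, enc b]"] by simp
  next
    case (nat_eq1 \<Gamma> a)
    then show ?case by simp
  next
    case (nat_eq2 \<Gamma> a)
    then show ?case by simp
  next
    case (eq_sym \<Gamma> a b)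
    then show ?case using horn_rule[of 17 "[codel \<Gamma>, enc a, enc b]"] by simp
  next
    case (eq_subst p \<Gamma> a b v)
    then show ?case using horn_rule[of 18 "[codel \<Gamma>, enc a, enc b, enc p, v, enc (repl v a p), enc (repl v b p)]"] horn_wf_term[of p]
      horn_repl[of v a p] horn_repl[of v b p] by simp
  next
    case (neq_sym \<Gamma> a b)
    then show ?case using horn_rule[of 19 "[codel \<Gamma>, enc a, enc b]"] by simp
  next
    case (eq_bool1 \<Gamma> a b)
    then show ?case using horn_rule[of 20 "[codel \<Gamma>, enc a, enc b]"] by simp
  next
    case (eq_bool2 \<Gamma> a b)
    then show ?case using horn_rule[of 21 "[codel \<Gamma>, enc a, enc b]"] by simp
  next
    case (zero_nat \<Gamma>)
    then show ?case using horn_rule[of 22 "[codel \<Gamma>]"] by simp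
  next
    case (suc_nat1 \<Gamma> a)
    then show ?case using horn_rule[of 23 "[codel \<Gamma>, enc a]"] by simp
  next
    case (suc_nat2 \<Gamma> a)
    then show ?case using horn_rule[of 24 "[codel \<Gamma>, enc a]"] by simp
  next
    case (suc_neq_zero \<Gamma> a)
    then show ?case using horn_rule[of 25 "[codel \<Gamma>, enc a]"] by simp
  next
    case (suc_neq1 \<Gamma> a b)
    then show ?case using horn_rule[of 26 "[codel \<Gamma>, enc a, enc b]"] by simp
  next
    case (suc_neq2 \<Gamma> a b)
    then show ?case using horn_rule[of 27 "[codel \<Gamma>, enc a, enc b]"] by simp
  next
    case (suc_inj \<Gamma> a b)
    then show ?case using horn_rule[of 28 "[codel \<Gamma>, enc a, enc b]"] by simp
  next
    case (bot_elim p \<Gamma>)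
    then show ?case using horn_rule[of 29 "[codel \<Gamma>, enc p]"] horn_wf_term[of p] by simp
  next
    case (induction c \<Gamma> i a)
    then show ?case using horn_rule[of 30 "[codel \<Gamma>, enc c, i, enc (repl i Zer c), enc (repl i (SS (Var i)) c), enc a, enc (repl i a c)]"]
      horn_wf_term[of c] horn_not_fv_terms[of "list_of_fset \<Gamma>" i] horn_repl[of i Zer c] horn_repl[of i "SS (Var i)" c]
      horn_repl[of i a c] by simp
  next
    case (conv1 c c' \<Gamma>)
    then show ?case using horn_rule[of 31 "[codel \<Gamma>, enc c, enc c']"] horn_head_step[of c c'] by simp
  next
    case (conv2 c c' \<Gamma>)
    then show ?case using horn_rule[of 32 "[codel \<Gamma>, enc c, enc c']"] horn_head_step[of c c'] by simp
  next
    case (conv_eq c c' \<Gamma>)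
    then show ?case using horn_rule[of 33 "[codel \<Gamma>, enc c, enc c']"] horn_head_step[of c c'] by simp
  next
    case (recursor g \<Gamma> m h)
    then show ?case using horn_rule[of 34 "[codel \<Gamma>, enc g, enc m, enc h]"] horn_wf_term[of g] by simp
  next
    case (all_intro \<Gamma> f)
    then show ?case using horn_rule[of 35 "[codel \<Gamma>, enc f, list_encode (map enc (map up (list_of_fset \<Gamma>))), enc (up f)]"]
      horn_shift_terms[of 1 0 "list_of_fset \<Gamma>"] horn_shift[of 1 0 f] by simp
  next
    case (all_elim \<Gamma> f a)
    then show ?case using horn_rule[of 36 "[codel \<Gamma>, enc f, enc a]"] by simp
  next
    case (not_all_intro \<Gamma> f a)
    then show ?case using horn_rule[of 37 "[codel \<Gamma>, enc f, enc a]"] by simp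
  next
    case (not_all_elim \<Gamma> f c)
    then show ?case using horn_rule[of 38 "[codel \<Gamma>, enc f, enc c, list_encode (map enc (map up (list_of_fset \<Gamma>))), enc (up f), enc (up c)]"]
      horn_shift_terms[of 1 0 "list_of_fset \<Gamma>"] horn_shift[of 1 0 f] horn_shift[of 1 0 c] by simp
  qed
qed

lemma derivable_iff_T:
  "derivable ({||} \<turnstile> c) \<longleftrightarrow> rga_fact (prod_encode (17, prod_encode (0, enc c)))"
proof
  have "derives_seq j" if "derivable j" for j
    using that by (induction rule: derivable_induct) (rule derives_seq_rule)
  then show "derivable ({||} \<turnstile> c) \<Longrightarrow> rga_fact (prod_encode (17, prod_encode (0, enc c)))"
    by (fastforce simp: derives_seq_def horn_derives)
  show "rga_fact (prod_encode (17, prod_encode (0, enc c))) \<Longrightarrow> derivable ({||} \<turnstile> c)"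
    using horn_holds by fastforce
qed

lemma derivable_rec_enum: "rec_enum (\<lambda>n. derivable ({||} \<turnstile> t \<cdot> num n))"
proof -
  have "trec 1 (\<lambda>xs. enc (num (xs ! 0)))"
    \<comment> \<open>Passing from the code of t to that of \<open>SS t\<close>: tag 5, no binder, a
      list with one element.\<close>
    by (rule trec_prim1[of "\<lambda>n r. prod_encode (5, prod_encode (0, Suc (prod_encode (r, 0))))"])
      (auto intro!: trec_intros)
  then have "trec 1 (\<lambda>xs. prod_encode (17, prod_encode (0, enc (t \<cdot> num (xs ! 0)))))"
    by (simp, intro trec_intros)
  from rec_enum_horn[OF this, of rga_prog] show ?thesis by (simp add: derivable_iff_T)
qed


section \<open>Formulas for graphs of recursive functions\<close>

lemma fv_Var_le: "fv (Var i) \<subseteq> {..<n} \<longleftrightarrow> i < n"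
  by simp

lemma wf_simps [simp]:
  "wf_term (SS t) \<longleftrightarrow> wf_term t" "wf_term (Neg t) \<longleftrightarrow> wf_term t" "wf_term (Lam t) \<longleftrightarrow> wf_term t"
  "wf_term (t \<doteq> u) \<longleftrightarrow> wf_term t \<and> wf_term u" "wf_term (t \<^bold>\<or> u) \<longleftrightarrow> wf_term t \<and> wf_term u"
  "wf_term (t \<cdot> u) \<longleftrightarrow> wf_term t \<and> wf_term u"
  "wf_term (Var i)" "wf_term Bot" "wf_term Zer" "wf_term Rcs" "wf_term All"
  by (auto intro: wf_term.intros elim: wf_term.cases)

lemma wf_num [simp]: "wf_term (num n)"
  by (induction n) auto

lemma wf_shift [simp]: "wf_term t \<Longrightarrow> wf_term (shift d c t)"
  by (induction arbitrary: c rule: wf_term.induct) auto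

lemma wf_inst: "wf_term t \<Longrightarrow> wf_term s \<Longrightarrow> wf_term (inst i s t)"
  by (induction arbitrary: i s rule: wf_term.induct) auto

lemma shift_num [simp]: "shift d c (num n) = num n"
  by (simp add: shift_closed)

lemma inst_num [simp]: "inst i s (num n) = num n"
  by (simp add: inst_closed)

lemma fv_shift_le: "fv t \<subseteq> {..<n} \<Longrightarrow> fv (shift d c t) \<subseteq> {..<n + d}"
proof (induction t arbitrary: n c)
  case (Op f k ts)
  have "fv (shift d (c + k) t) \<subseteq> {..<n + d + k}" if "t \<in> set ts" for t
    using Op.IH[OF that, of "n + k" "c + k"] Op.prems that unfolding fv_Op_le
    by (simp add: add.assoc add.commute add.left_commute)
  then show ?case by (simp only: shift.simps fv_Op_le) auto
qed auto

lemma inst_shift_high: "fv s = {} \<Longrightarrow>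
    inst (i + (k + c)) s (shift k c t) = shift k c (inst (i + c) s t)"
  by (induction t arbitrary: c) (auto simp: shift_closed add.assoc)

lemma inst_shift_high0: "fv s = {} \<Longrightarrow> inst (i + k) s (shift k 0 t) = shift k 0 (inst i s t)"
  using inst_shift_high[of s i k 0 t] by simp

definition ex_fm :: "rterm \<Rightarrow> rterm" where "ex_fm b = Neg (All \<cdot> Lam (Neg b))"

text \<open>One half speaks of derivations, the other of values. A derivation of an existential
  formula does not hand over a derivable instance, but its value does hand over a true one, so in
  this form the notion passes through conjunction, \<open>ex_fm\<close> and head expansion.
  Soundness joins the two halves only at the very end.\<close>

definition tv :: "rterm \<Rightarrow> bool \<Rightarrow> bool" where
  "tv c P \<longleftrightarrow> (P \<longrightarrow> derivable ({||} \<turnstile> c)) \<and> (ev c (Suc 0) \<longrightarrow> P)"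

lemma derivable_num: "derivable (\<Gamma> \<turnstile> isN (num n))"
  by (induction n) (auto intro: derivable_rule0[OF zero_nat] derivable_rule1[OF suc_nat1])

lemma tv_eq: "tv (num a \<doteq> num b) (a = b)"
  using derivable_num by (auto simp: tv_def ev_Eq1)

lemma tv_Bot: "tv Bot False"
  by (simp add: tv_def)

lemma tv_and: "tv a P \<Longrightarrow> tv b Q \<Longrightarrow> tv (a \<^bold>\<and> b) (P \<and> Q)"
  unfolding tv_def ev_Neg1 ev_Or0 ev_Neg
  by (auto intro!: derivable_rule2[OF nor_intro] derivable_rule1[OF neg_neg1])

lemma head_step_st: "c \<triangleright> c' \<Longrightarrow> st c c'"
proof (induction rule: head_step.induct)
  case (rec_suc g h n)
  have "ev (SS (num n)) (Suc n)" by simp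
  from st_recS[OF this] show ?case .
qed (simp_all add: st_beta st_rec0 st_app)

lemma tv_step:
  assumes "c \<triangleright> c'" "tv c' P"
  shows "tv c P"
  using assms(2) derivable_rule1[OF conv1[OF assms(1)]]
  unfolding tv_def ev_st_iff[OF head_step_st[OF assms(1)]] by simp

text \<open>\<open>not_all_intro\<close> asks for the negation of the redex
  \<open>Lam (Neg b) \<cdot> num n\<close>. Conversion acts only on a whole formula, not below
  \<open>Neg\<close>, so the derivation detours through equations: the redex equals its contractum,
  which equals 0.\<close>

lemma tv_ex:
  assumes tv: "\<And>n. tv (inst 0 (num n) b) (P n)" and wf: "wf_term b" and fv: "fv b \<subseteq> {..<1}"
  shows "tv (ex_fm b) (\<exists>n. P n)"
  unfolding tv_def
proof (intro conjI impI)
  assume "\<exists>n. P n"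
  then obtain n where "P n" ..
  let ?b = "inst 0 (num n) b" and ?c = "Lam (Neg b) \<cdot> num n"
  from tv[of n] \<open>P n\<close> have "derivable ({||} \<turnstile> ?b)" by (simp add: tv_def)
  have step: "?c \<triangleright> Neg ?b" using beta[OF wf_num, of "Neg b" n] by simp
  have closed_b: "fv ?b = {}"
  proof -
    have "fv (inst i (num n) t) \<subseteq> {..<i}" if "fv t \<subseteq> {..<Suc i}" for i t
      using that
    proof (induction t arbitrary: i)
      case (Op f k ts)
      have "fv (inst (i + k) (num n) t) \<subseteq> {..<i + k}" if "t \<in> set ts" for t
        using Op.IH[OF that, of "i + k"] Op.prems that unfolding fv_Op_le by simp
      then show ?case by (simp only: inst.simps fv_Op_le) auto
    qed auto
    from this[of b 0] fv show ?thesis by (simp add: One_nat_def)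
  qed
  \<comment> \<open>Replacing variable 0 in the redex acts on index 1 below its \<open>Lam\<close>,
    and \<open>b\<close> has no such index.\<close>
  have "1 \<notin> fv b" using fv by auto
  then have rb: "repl 1 s b = b" for s by (rule repl_ident)
  have wf_b: "wf_term ?b" using wf by (simp add: wf_inst)
  have "derivable ({||} \<turnstile> Neg (Neg ?b))"
    by (rule derivable_rule1[OF neg_neg1]) fact
  then have b0: "derivable ({||} \<turnstile> Neg ?b \<doteq> num 0)" by (rule derivable_rule1[OF false1])
  then have "derivable ({||} \<turnstile> num 0 \<doteq> Neg ?b)" by (rule derivable_rule1[OF eq_sym])
  moreover from this have "derivable ({||} \<turnstile> repl 0 (num 0) (Var 0 \<doteq> Neg ?b))"
    by (simp add: repl_ident closed_b)
  ultimately have "derivable ({||} \<turnstile> repl 0 (Neg ?b) (Var 0 \<doteq> Neg ?b))"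
    by (rule derivable_rule2[OF eq_subst, rotated]) (simp add: wf_b)
  then have "derivable ({||} \<turnstile> isN (Neg ?b))" by (simp add: repl_ident closed_b)
  then have "derivable ({||} \<turnstile> ?c \<doteq> Neg ?b)" by (rule derivable_rule1[OF conv_eq[OF step]])
  then have "derivable ({||} \<turnstile> repl 0 (Neg ?b) (?c \<doteq> Var 0))"
    by (simp add: rb repl_ident)
  with b0 have "derivable ({||} \<turnstile> repl 0 (num 0) (?c \<doteq> Var 0))"
    by (rule derivable_rule2[OF eq_subst, rotated]) (simp add: wf)
  then have "derivable ({||} \<turnstile> ?c \<doteq> num 0)"
    by (simp add: rb repl_ident)
  then have "derivable ({||} \<turnstile> Neg ?c)" by (rule derivable_rule1[OF false2])
  then show "derivable ({||} \<turnstile> ex_fm b)"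
    unfolding ex_fm_def by (rule derivable_rule2[OF not_all_intro]) (rule derivable_num)
next
  assume "ev (ex_fm b) (Suc 0)"
  then obtain k where "ev (Lam (Neg b) \<cdot> num k) 0" unfolding ex_fm_def ev_Neg1 ev_All0 by blast
  then have "ev (inst 0 (num k) (Neg b)) 0" by (simp only: ev_st_iff[OF st_beta])
  then have "ev (inst 0 (num k) b) (Suc 0)" by simp
  then have "P k" using tv[of k] by (simp add: tv_def)
  then show "\<exists>n. P n" ..
qed

text \<open>One quantifier per inner function. \<open>zs\<close> collects the variables of the
  intermediate results and is shifted along with \<open>xs\<close> whenever another quantifier is
  added; at the end it is the argument list of the outer function.\<close>

fun comp_fm :: "(rterm list \<Rightarrow> rterm \<Rightarrow> rterm) list \<Rightarrow> (rterm list \<Rightarrow> rterm \<Rightarrow> rterm) \<Rightarrow>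
    rterm list \<Rightarrow> rterm list \<Rightarrow> rterm \<Rightarrow> rterm" where
  "comp_fm [] f xs zs y = f zs y"
| "comp_fm (g # gs) f xs zs y =
    ex_fm (g (map up xs) (Var 0) \<^bold>\<and> comp_fm gs f (map up xs) (map up zs @ [Var 0]) (up y))"

text \<open>Primitive recursion uses the recursor at the type of predicates, and minimisation a recursion
  that builds the bounded universal quantifier.\<close>

fun graph_fm :: "recf \<Rightarrow> rterm list \<Rightarrow> rterm \<Rightarrow> rterm" where
  "graph_fm RZero xs y = (y \<doteq> Zer)"
| "graph_fm RSucc xs y = (case xs of [x] \<Rightarrow> y \<doteq> SS x | _ \<Rightarrow> Bot)"
| "graph_fm (RProj i) xs y = (if i < length xs then y \<doteq> xs ! i else Bot)"
| "graph_fm (RComp f gs) xs y = comp_fm (map graph_fm gs) (graph_fm f) xs [] y"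
| "graph_fm (RPrim f g) xs y = (case xs of [] \<Rightarrow> Bot | n # xs \<Rightarrow>
    Rcs \<cdot> Lam (graph_fm f (map up xs) (Var 0))
      \<cdot> Lam (Lam (Lam (ex_fm (Var 2 \<cdot> Var 0 \<^bold>\<and> graph_fm g (Var 3 # Var 0 # map (shift 4 0) xs) (Var 1)))))
      \<cdot> n \<cdot> y)"
| "graph_fm (RMu f) xs y = (graph_fm f (y # xs) Zer \<^bold>\<and>
    Rcs \<cdot> isN Zer
      \<cdot> Lam (Lam (Var 0 \<^bold>\<and> ex_fm (graph_fm f (Var 2 # map (shift 3 0) xs) (SS (Var 0)))))
      \<cdot> y)"

text \<open>The formula depends on its arguments only as a scheme: it adds no free variables, and
  instantiation acts on the arguments alone. Hence instantiating a bound variable with a numeral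
  gives again a graph formula, now at that numeral.\<close>

definition uniform :: "(rterm list \<Rightarrow> rterm \<Rightarrow> rterm) \<Rightarrow> bool" where
  "uniform h \<longleftrightarrow>
    (\<forall>xs y. (\<forall>x \<in> set xs. wf_term x) \<longrightarrow> wf_term y \<longrightarrow> wf_term (h xs y)) \<and>
    (\<forall>xs y n. (\<forall>x \<in> set xs. fv x \<subseteq> {..<n}) \<longrightarrow> fv y \<subseteq> {..<n} \<longrightarrow> fv (h xs y) \<subseteq> {..<n}) \<and>
    (\<forall>xs y i s. fv s = {} \<longrightarrow> inst i s (h xs y) = h (map (inst i s) xs) (inst i s y))"

lemma uniform_wf: "uniform h \<Longrightarrow> \<forall>x \<in> set xs. wf_term x \<Longrightarrow> wf_term y \<Longrightarrow> wf_term (h xs y)"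
  and uniform_fv: "uniform h \<Longrightarrow> \<forall>x \<in> set xs. fv x \<subseteq> {..<n} \<Longrightarrow> fv y \<subseteq> {..<n} \<Longrightarrow>
    fv (h xs y) \<subseteq> {..<n}"
  and uniform_inst: "uniform h \<Longrightarrow> fv s = {} \<Longrightarrow> inst i s (h xs y) = h (map (inst i s) xs) (inst i s y)"
  unfolding uniform_def by blast+

lemma wf_ex_fm [simp]: "wf_term (ex_fm b) \<longleftrightarrow> wf_term b"
  by (simp add: ex_fm_def)

lemma fv_ex_fm: "fv (ex_fm b) \<subseteq> {..<n} \<longleftrightarrow> fv b \<subseteq> {..<Suc n}"
  unfolding ex_fm_def fv_Op_le by (simp add: fv_Op_le One_nat_def del: fv.simps)

lemma inst_ex_fm: "fv s = {} \<Longrightarrow> inst i s (ex_fm b) = ex_fm (inst (Suc i) s b)"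
  by (simp add: ex_fm_def shift_closed One_nat_def)

lemma fv_up_le: "fv t \<subseteq> {..<n} \<Longrightarrow> fv (up t) \<subseteq> {..<Suc n}"
  using fv_shift_le[of t n 1 0] by (simp add: One_nat_def)

lemma inst_up: "fv s = {} \<Longrightarrow> inst (Suc i) s (up t) = up (inst i s t)"
  using inst_shift_high0[of s i 1 t] by (simp add: One_nat_def)

lemma uniform_comp_fm:
  assumes "\<And>g. g \<in> set gs \<Longrightarrow> uniform g" "uniform f"
  shows comp_fm_wf: "(\<forall>x \<in> set xs. wf_term x) \<Longrightarrow> (\<forall>z \<in> set zs. wf_term z) \<Longrightarrow> wf_term y \<Longrightarrow>
      wf_term (comp_fm gs f xs zs y)"
    and comp_fm_fv: "(\<forall>x \<in> set xs. fv x \<subseteq> {..<n}) \<Longrightarrow> (\<forall>z \<in> set zs. fv z \<subseteq> {..<n}) \<Longrightarrow>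
      fv y \<subseteq> {..<n} \<Longrightarrow> fv (comp_fm gs f xs zs y) \<subseteq> {..<n}"
    and comp_fm_inst: "fv s = {} \<Longrightarrow> inst i s (comp_fm gs f xs zs y) =
      comp_fm gs f (map (inst i s) xs) (map (inst i s) zs) (inst i s y)"
proof -
  show "wf_term (comp_fm gs f xs zs y)"
    if "\<forall>x \<in> set xs. wf_term x" "\<forall>z \<in> set zs. wf_term z" "wf_term y"
    using assms(1) that
  proof (induction gs arbitrary: xs zs y)
    case Nil
    then show ?case using uniform_wf[OF assms(2)] by simp
  next
    case (Cons g gs)
    have "wf_term (g (map up xs) (Var 0))"
      by (rule uniform_wf[of g]) (use Cons.prems in auto)
    moreover have "wf_term (comp_fm gs f (map up xs) (map up zs @ [Var 0]) (up y))"
      by (rule Cons.IH) (use Cons.prems in auto)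
    ultimately show ?case by simp
  qed
  show "fv (comp_fm gs f xs zs y) \<subseteq> {..<n}"
    if "\<forall>x \<in> set xs. fv x \<subseteq> {..<n}" "\<forall>z \<in> set zs. fv z \<subseteq> {..<n}" "fv y \<subseteq> {..<n}"
    using assms(1) that
  proof (induction gs arbitrary: xs zs y n)
    case Nil
    then show ?case using uniform_fv[OF assms(2)] by simp
  next
    case (Cons g gs)
    have "fv (g (map up xs) (Var 0)) \<subseteq> {..<Suc n}"
      by (rule uniform_fv[of g]) (use Cons.prems in \<open>simp_all add: fv_up_le del: lessThan_Suc\<close>)
    moreover have "fv (comp_fm gs f (map up xs) (map up zs @ [Var 0]) (up y)) \<subseteq> {..<Suc n}"
      by (rule Cons.IH) (use Cons.prems in \<open>simp_all add: fv_up_le ball_Un del: lessThan_Suc\<close>)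
    ultimately show ?case by (simp add: fv_ex_fm fv_Op_le del: fv.simps)
  qed
  show "inst i s (comp_fm gs f xs zs y) = comp_fm gs f (map (inst i s) xs) (map (inst i s) zs) (inst i s y)"
    if s: "fv s = {}"
    using assms(1)
  proof (induction gs arbitrary: xs zs y i)
    case Nil
    then show ?case using uniform_inst[OF assms(2) s] by simp
  next
    case (Cons g gs)
    have "inst (Suc i) s (g (map up xs) (Var 0)) = g (map up (map (inst i s) xs)) (Var 0)"
      using uniform_inst[OF Cons.prems[of g] s] by (simp add: inst_up[OF s] comp_def)
    moreover have "inst (Suc i) s (comp_fm gs f (map up xs) (map up zs @ [Var 0]) (up y)) =
        comp_fm gs f (map up (map (inst i s) xs)) (map up (map (inst i s) zs) @ [Var 0]) (up (inst i s y))"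
      using Cons by (simp add: inst_up[OF s] comp_def)
    ultimately show ?case by (simp add: inst_ex_fm[OF s] shift_closed[OF s])
  qed
qed


lemma uniform_graph_fm: "uniform (graph_fm f)"
proof (induction f)
  case RZero
  then show ?case by (auto simp: uniform_def fv_Op_le simp del: fv.simps)
next
  case RSucc
  show ?case unfolding uniform_def
  proof (intro conjI allI impI)
    fix xs y assume "\<forall>x \<in> set xs. wf_term x" "wf_term y"
    then show "wf_term (graph_fm RSucc xs y)" by (auto split: list.split)
  next
    fix xs y n assume "\<forall>x \<in> set xs. fv x \<subseteq> {..<n}" "fv y \<subseteq> {..<n}"
    then show "fv (graph_fm RSucc xs y) \<subseteq> {..<n}"
      by (auto simp: fv_Op_le simp del: fv.simps split: list.split)
  next
    fix xs y i s assume "fv s = {}"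
    then show "inst i s (graph_fm RSucc xs y) = graph_fm RSucc (map (inst i s) xs) (inst i s y)"
      by (auto split: list.split simp: shift_closed)
  qed
next
  case (RProj i)
  then show ?case by (auto simp: uniform_def fv_Op_le simp del: fv.simps)
next
  case (RComp f gs)
  have "g \<in> set (map graph_fm gs) \<Longrightarrow> uniform g" for g using RComp by auto
  note u = uniform_comp_fm[where gs = "map graph_fm gs", OF this RComp(1)]
  show ?case
    unfolding uniform_def graph_fm.simps using u(1)[where zs = "[]"] u(2)[where zs = "[]"] u(3)[where zs = "[]"]
    by simp
next
  case (RPrim f g)
  note wf = uniform_wf[OF RPrim.IH(1)] uniform_wf[OF RPrim.IH(2)]
  note fvs = uniform_fv[OF RPrim.IH(1)] uniform_fv[OF RPrim.IH(2)]
  note ins = uniform_inst[OF RPrim.IH(1)] uniform_inst[OF RPrim.IH(2)]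
  show ?case unfolding uniform_def
  proof (intro conjI allI impI)
    fix xs y assume "\<forall>x \<in> set xs. wf_term x" "wf_term y"
    then show "wf_term (graph_fm (RPrim f g) xs y)" by (cases xs) (simp_all add: wf)
  next
    fix xs y n assume a: "\<forall>x \<in> set xs. fv x \<subseteq> {..<n}" "fv y \<subseteq> {..<n}"
    show "fv (graph_fm (RPrim f g) xs y) \<subseteq> {..<n}"
    proof (cases xs)
      case Nil
      then show ?thesis by simp
    next
      case (Cons m ms)
      have "fv (graph_fm f (map up ms) (Var 0)) \<subseteq> {..<Suc n}"
        by (rule fvs) (use a Cons in \<open>simp_all add: fv_up_le del: lessThan_Suc\<close>)
      \<comment> \<open>Four binders lie above this formula: the three abstractions of the recursion
        step and the one inside \<open>ex_fm\<close>.\<close>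
      moreover have "fv (graph_fm g (Var 3 # Var 0 # map (shift 4 0) ms) (Var 1)) \<subseteq> {..<n + 4}"
        by (rule fvs) (use a Cons in \<open>simp_all add: fv_shift_le\<close>)
      ultimately show ?thesis
        using a Cons by (simp add: fv_Op_le fv_ex_fm fv_Var_le One_nat_def numeral_eq_Suc del: fv.simps lessThan_Suc)
    qed
  next
    fix xs y i s assume s: "fv s = {}"
    have "inst (Suc i) s (up x) = up (inst i s x)" "inst (4 + i) s (shift 4 0 x) = shift 4 0 (inst i s x)" for x
      using inst_up[OF s] inst_shift_high0[OF s, of i 4 x] by (simp_all add: add.commute)
    then show "inst i s (graph_fm (RPrim f g) xs y) = graph_fm (RPrim f g) (map (inst i s) xs) (inst i s y)"
      by (cases xs) (simp_all add: ins s inst_ex_fm shift_closed comp_def One_nat_def numeral_eq_Suc)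
  qed
next
  case (RMu f)
  note wf = uniform_wf[OF RMu.IH] note fvs = uniform_fv[OF RMu.IH] note ins = uniform_inst[OF RMu.IH]
  show ?case unfolding uniform_def
  proof (intro conjI allI impI)
    fix xs y assume "\<forall>x \<in> set xs. wf_term x" "wf_term y"
    then show "wf_term (graph_fm (RMu f) xs y)" by (simp add: wf)
  next
    fix xs y n assume a: "\<forall>x \<in> set xs. fv x \<subseteq> {..<n}" "fv y \<subseteq> {..<n}"
    have "fv (graph_fm f (y # xs) Zer) \<subseteq> {..<n}"
      by (rule fvs) (use a in simp_all)
    moreover have "fv (graph_fm f (Var 2 # map (shift 3 0) xs) (SS (Var 0))) \<subseteq> {..<n + 3}"
      by (rule fvs) (use a in \<open>simp_all add: fv_shift_le\<close>)
    ultimately show "fv (graph_fm (RMu f) xs y) \<subseteq> {..<n}"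
      using a by (simp add: fv_Op_le fv_ex_fm fv_Var_le One_nat_def numeral_eq_Suc del: fv.simps lessThan_Suc)
  next
    fix xs y i s assume s: "fv s = {}"
    have "inst (3 + i) s (shift 3 0 x) = shift 3 0 (inst i s x)" for x
      using inst_shift_high0[OF s, of i 3 x] by (simp add: add.commute)
    then show "inst i s (graph_fm (RMu f) xs y) = graph_fm (RMu f) (map (inst i s) xs) (inst i s y)"
      by (simp add: ins s inst_ex_fm shift_closed comp_def One_nat_def numeral_eq_Suc)
  qed
qed


section \<open>Graph formulas agree with computations\<close>

lemma inst_nums [simp]: "map (inst i s \<circ> num) xs = map num xs" "map (inst i s) (map num xs) = map num xs"
  and shift_nums [simp]: "map (shift d c) (map num xs) = map num xs"
  by simp_all

lemma uniform_comp_graph_fm: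
  "wf_term y \<Longrightarrow> \<forall>x \<in> set xs. wf_term x \<Longrightarrow> \<forall>z \<in> set zs. wf_term z \<Longrightarrow>
    wf_term (comp_fm (map graph_fm gs) (graph_fm f) xs zs y)"
  "\<forall>x \<in> set xs. fv x \<subseteq> {..<n} \<Longrightarrow> \<forall>z \<in> set zs. fv z \<subseteq> {..<n} \<Longrightarrow> fv y \<subseteq> {..<n} \<Longrightarrow>
    fv (comp_fm (map graph_fm gs) (graph_fm f) xs zs y) \<subseteq> {..<n}"
  "fv s = {} \<Longrightarrow> inst i s (comp_fm (map graph_fm gs) (graph_fm f) xs zs y) =
      comp_fm (map graph_fm gs) (graph_fm f) (map (inst i s) xs) (map (inst i s) zs) (inst i s y)"
proof -
  have "g \<in> set (map graph_fm gs) \<Longrightarrow> uniform g" for g using uniform_graph_fm by auto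
  note u = uniform_comp_fm[where gs = "map graph_fm gs", OF this uniform_graph_fm]
  show "wf_term y \<Longrightarrow> \<forall>x \<in> set xs. wf_term x \<Longrightarrow> \<forall>z \<in> set zs. wf_term z \<Longrightarrow>
    wf_term (comp_fm (map graph_fm gs) (graph_fm f) xs zs y)" using u(1) by simp
  show "\<forall>x \<in> set xs. fv x \<subseteq> {..<n} \<Longrightarrow> \<forall>z \<in> set zs. fv z \<subseteq> {..<n} \<Longrightarrow> fv y \<subseteq> {..<n} \<Longrightarrow>
    fv (comp_fm (map graph_fm gs) (graph_fm f) xs zs y) \<subseteq> {..<n}" using u(2) by simp
  show "fv s = {} \<Longrightarrow> inst i s (comp_fm (map graph_fm gs) (graph_fm f) xs zs y) =
      comp_fm (map graph_fm gs) (graph_fm f) (map (inst i s) xs) (map (inst i s) zs) (inst i s y)"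
    using u(3) by simp
qed

lemmas graph_fm_wf = uniform_wf[OF uniform_graph_fm]
lemmas graph_fm_fv = uniform_fv[OF uniform_graph_fm]
lemmas graph_fm_inst = uniform_inst[OF uniform_graph_fm]

lemma tv_comp_fm:
  assumes f: "\<And>ys y. tv (graph_fm f (map num ys) (num y)) (computes f ys y)"
    and gs: "\<And>g xs y. g \<in> set gs \<Longrightarrow> tv (graph_fm g (map num xs) (num y)) (computes g xs y)"
  shows "tv (comp_fm (map graph_fm gs) (graph_fm f) (map num xs) (map num zs) (num y))
    (\<exists>ys. list_all2 (\<lambda>g y. computes g xs y) gs ys \<and> computes f (zs @ ys) y)"
  using gs
proof (induction gs arbitrary: zs)
  case Nil
  then show ?case using f by simp
next
  case (Cons g gs)
  let ?b = "graph_fm g (map num xs) (Var 0) \<^bold>\<and>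
     comp_fm (map graph_fm gs) (graph_fm f) (map num xs) (map num zs @ [Var 0]) (num y)"
  let ?P = "\<lambda>z. computes g xs z \<and>
    (\<exists>ys. list_all2 (\<lambda>g y. computes g xs y) gs ys \<and> computes f ((zs @ [z]) @ ys) y)"
  have "tv (ex_fm ?b) (\<exists>z. ?P z)"
  proof (rule tv_ex)
    fix z
    have "tv (graph_fm g (map num xs) (num z) \<^bold>\<and>
        comp_fm (map graph_fm gs) (graph_fm f) (map num xs) (map num (zs @ [z])) (num y)) (?P z)"
      using Cons.IH[of "zs @ [z]"] Cons.prems by (intro tv_and) simp_all
    then show "tv (inst 0 (num z) ?b) (?P z)"
      by (simp add: graph_fm_inst uniform_comp_graph_fm del: map_map)
  next
    show "wf_term ?b" by (simp add: graph_fm_wf uniform_comp_graph_fm)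
    have "fv (graph_fm g (map num xs) (Var 0)) \<subseteq> {..<1}" by (rule graph_fm_fv) auto
    moreover have "fv (comp_fm (map graph_fm gs) (graph_fm f) (map num xs) (map num zs @ [Var 0]) (num y)) \<subseteq> {..<1}"
      by (rule uniform_comp_graph_fm) auto
    ultimately show "fv ?b \<subseteq> {..<1}" by (simp add: fv_Op_le del: fv.simps)
  qed
  moreover have "(\<exists>z. ?P z) \<longleftrightarrow>
      (\<exists>ys. list_all2 (\<lambda>g y. computes g xs y) (g # gs) ys \<and> computes f (zs @ ys) y)"
    by (auto simp: list_all2_Cons1)
  ultimately show ?case by (simp del: map_map)
qed

lemma app_step2: "t \<triangleright> t' \<Longrightarrow> t \<cdot> u \<cdot> v \<triangleright> t' \<cdot> u \<cdot> v"
  by (intro head_step.app)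

text \<open>Everything is pulled back along head steps by \<open>tv_step\<close>. For primitive
  recursion an inner induction shows that the recursor at numeral n is a predicate of the result;
  one unfolding consists of a recursor step and three beta steps, ending in an existential formula
  over the previous result.\<close>

lemma tv_graph_fm: "tv (graph_fm f (map num xs) (num y)) (computes f xs y)"
proof (induction f arbitrary: xs y)
  case RZero
  then show ?case using tv_eq[of y 0] by simp
next
  case RSucc
  show ?case
  proof (cases "\<exists>x. xs = [x]")
    case True
    then show ?thesis using tv_eq[of y "Suc x" for x] by (auto simp: computes_Succ)
  next
    case False
    then have "graph_fm RSucc (map num xs) (num y) = Bot"
      by (auto split: list.split)
    then show ?thesis using False tv_Bot by (simp add: computes_Succ)
  qed
next
  case (RProj i)
  then show ?case using tv_eq[of y "xs ! i"] tv_Bot by (simp add: computes_Proj)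
next
  case (RComp f gs)
  from tv_comp_fm[of f gs xs "[]" y] RComp show ?case by (simp add: computes_Comp)
next
  case (RPrim f g)
  show ?case
  proof (cases xs)
    case Nil
    then show ?thesis using tv_Bot by (simp add: computes_Prim)
  next
    case (Cons n ns)
    let ?G = "Lam (graph_fm f (map num ns) (Var 0))"
    let ?B = "\<lambda>n r y. ex_fm (r \<cdot> Var 0 \<^bold>\<and> graph_fm g (n # Var 0 # map num ns) y)"
    \<comment> \<open>Indices from the outside in: 3 is the recursion argument, 2 the predicate for
      the previous result, 1 the result, and 0, bound in \<open>ex_fm\<close>, the previous
      result.\<close>
    let ?H = "Lam (Lam (Lam (?B (Var 3) (Var 2) (Var 1))))"
    let ?R = "\<lambda>n. Rcs \<cdot> ?G \<cdot> ?H \<cdot> num n"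
    have wfG: "wf_term ?G" and wfH: "wf_term ?H" by (simp_all add: graph_fm_wf)
    have "fv (?R n) \<subseteq> {..<m}" for n m
    proof -
      have "fv (graph_fm f (map num ns) (Var 0)) \<subseteq> {..<Suc m}" by (rule graph_fm_fv) auto
      moreover have "fv (graph_fm g (Var 3 # Var 0 # map num ns) (Var 1)) \<subseteq> {..<m + 4}"
        by (rule graph_fm_fv) auto
      ultimately show ?thesis
        by (simp add: fv_Op_le fv_ex_fm fv_Var_le One_nat_def numeral_eq_Suc del: fv.simps lessThan_Suc)
    qed
    from this[of _ 0] have clR: "fv (?R n) = {}" for n by (simp only: lessThan_0 subset_empty)
    have "tv (?R n \<cdot> num y) (computes (RPrim f g) (n # ns) y)" for y
    proof (induction n arbitrary: y)
      case 0
      have s1: "Rcs \<cdot> ?G \<cdot> ?H \<cdot> Zer \<cdot> num y \<triangleright> ?G \<cdot> num y"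
        using wfH by (intro head_step.app head_step.rec_zero)
      have s2: "?G \<cdot> num y \<triangleright> graph_fm f (map num ns) (num y)"
        using beta[OF wf_num, of "graph_fm f (map num ns) (Var 0)" y] by (simp add: graph_fm_inst)
      show ?case
        unfolding num.simps computes_Prim by (intro tv_step[OF s1] tv_step[OF s2] RPrim.IH(1))
    next
      case (Suc n)
      have s1: "?R (Suc n) \<cdot> num y \<triangleright> ?H \<cdot> num n \<cdot> ?R n \<cdot> num y"
        using wfG by (simp only: num.simps) (intro head_step.app head_step.rec_suc)
      have s2: "?H \<cdot> num n \<cdot> ?R n \<cdot> num y \<triangleright> Lam (Lam (?B (num n) (Var 2) (Var 1))) \<cdot> ?R n \<cdot> num y"
        using beta[OF wf_num, of "Lam (Lam (?B (Var 3) (Var 2) (Var 1)))" n]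
        by (intro app_step2) (simp add: graph_fm_inst inst_ex_fm numeral_eq_Suc One_nat_def)
      \<comment> \<open>Naming the recursor term keeps simplification from opening it; being closed,
        it is unchanged by the beta steps that follow.\<close>
      define r where "r = ?R n"
      have r: "fv r = {}" "wf_term r" using clR[of n] wfG wfH by (simp_all only: r_def wf_simps wf_num)
      have s3: "Lam (Lam (?B (num n) (Var 2) (Var 1))) \<cdot> r \<cdot> num y \<triangleright> Lam (?B (num n) r (Var 1)) \<cdot> num y"
        using beta[OF r(2), of "Lam (?B (num n) (Var 2) (Var 1))"] r(1)
        by (intro head_step.app) (simp add: graph_fm_inst inst_ex_fm shift_closed numeral_eq_Suc One_nat_def)
      have s4: "Lam (?B (num n) r (Var 1)) \<cdot> num y \<triangleright> ?B (num n) r (num y)"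
        using beta[OF wf_num, of "?B (num n) r (Var 1)" y] r(1)
        by (simp add: graph_fm_inst inst_ex_fm inst_closed numeral_eq_Suc One_nat_def)
      let ?P = "\<lambda>z. computes (RPrim f g) (n # ns) z \<and> computes g (n # z # ns) y"
      have "tv (?B (num n) r (num y)) (\<exists>z. ?P z)"
      proof (rule tv_ex)
        fix z
        have "tv (r \<cdot> num z \<^bold>\<and> graph_fm g (map num (n # z # ns)) (num y)) (?P z)"
          using Suc[of z] RPrim.IH(2) unfolding r_def by (intro tv_and)
        then show "tv (inst 0 (num z) (r \<cdot> Var 0 \<^bold>\<and> graph_fm g (num n # Var 0 # map num ns) (num y))) (?P z)"
          using r(1) by (simp add: graph_fm_inst inst_closed del: map_map)
      next
        show "wf_term (r \<cdot> Var 0 \<^bold>\<and> graph_fm g (num n # Var 0 # map num ns) (num y))"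
          using r by (simp add: graph_fm_wf)
        have "fv (graph_fm g (num n # Var 0 # map num ns) (num y)) \<subseteq> {..<1}" by (rule graph_fm_fv) auto
        then show "fv (r \<cdot> Var 0 \<^bold>\<and> graph_fm g (num n # Var 0 # map num ns) (num y)) \<subseteq> {..<1}"
          using r(1) by (simp add: fv_Op_le fv_Var_le del: fv.simps)
      qed
      then show ?case unfolding computes_Prim
        by (intro tv_step[OF s1] tv_step[OF s2] tv_step[OF s3[unfolded r_def]] tv_step[OF s4[unfolded r_def]])
          (simp only: r_def)
    qed
    then show ?thesis using Cons by (simp del: map_map)
  qed
next
  case (RMu f)
  let ?B = "\<lambda>n r. r \<^bold>\<and> ex_fm (graph_fm f (n # map num xs) (SS (Var 0)))"
  let ?H = "Lam (Lam (?B (Var 2) (Var 0)))"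
  \<comment> \<open>Starting from a true equation, each recursion step adds a conjunct saying that
    \<open>f\<close> has some successor as value. Definedness below the minimum is thereby asserted
    existentially, so no negative fact about \<open>f\<close> is needed.\<close>
  let ?R = "\<lambda>n. Rcs \<cdot> isN Zer \<cdot> Lam (Lam (Var 0 \<^bold>\<and> ex_fm (graph_fm f (Var 2 # map num xs) (SS (Var 0))))) \<cdot> num n"
  have wfH: "wf_term (Lam (Lam (Var 0 \<^bold>\<and> ex_fm (graph_fm f (Var 2 # map num xs) (SS (Var 0))))))"
    by (simp add: graph_fm_wf)
  have "fv (?R n) \<subseteq> {..<m}" for n m
  proof -
    have "fv (graph_fm f (Var 2 # map num xs) (SS (Var 0))) \<subseteq> {..<m + 3}" by (rule graph_fm_fv) auto
    then show ?thesis
      by (simp add: fv_Op_le fv_ex_fm fv_Var_le One_nat_def numeral_eq_Suc del: fv.simps lessThan_Suc)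
  qed
  from this[of _ 0] have clR: "fv (?R n) = {}" for n by (simp only: lessThan_0 subset_empty)
  have "tv (?R n) (\<forall>m<n. \<exists>z. computes f (m # xs) (Suc z))" for n
  proof (induction n)
    case 0
    have "?R 0 \<triangleright> isN Zer" using wfH by (simp only: num.simps) (intro head_step.rec_zero)
    from tv_step[OF this] tv_eq[of 0 0] show ?case by simp
  next
    case (Suc n)
    have s1: "?R (Suc n) \<triangleright> Lam (Lam (Var 0 \<^bold>\<and> ex_fm (graph_fm f (Var 2 # map num xs) (SS (Var 0))))) \<cdot> num n \<cdot> ?R n"
      by (simp only: num.simps) (intro head_step.rec_suc, simp)
    define r where "r = ?R n"
    have r: "fv r = {}" "wf_term r" using clR[of n] wfH by (simp_all only: r_def wf_simps wf_num)
    have s2: "Lam (Lam (Var 0 \<^bold>\<and> ex_fm (graph_fm f (Var 2 # map num xs) (SS (Var 0))))) \<cdot> num n \<cdot> r \<triangleright>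
        Lam (Var 0 \<^bold>\<and> ex_fm (graph_fm f (num n # map num xs) (SS (Var 0)))) \<cdot> r"
      using beta[OF wf_num, of "Lam (Var 0 \<^bold>\<and> ex_fm (graph_fm f (Var 2 # map num xs) (SS (Var 0))))" n]
      by (intro head_step.app) (simp add: graph_fm_inst inst_ex_fm numeral_eq_Suc One_nat_def)
    have s3: "Lam (Var 0 \<^bold>\<and> ex_fm (graph_fm f (num n # map num xs) (SS (Var 0)))) \<cdot> r \<triangleright>
        r \<^bold>\<and> ex_fm (graph_fm f (num n # map num xs) (SS (Var 0)))"
      using beta[OF r(2), of "Var 0 \<^bold>\<and> ex_fm (graph_fm f (num n # map num xs) (SS (Var 0)))"] r(1)
      by (simp add: graph_fm_inst inst_ex_fm)
    have "tv (ex_fm (graph_fm f (num n # map num xs) (SS (Var 0)))) (\<exists>z. computes f (n # xs) (Suc z))"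
    proof (rule tv_ex)
      fix z
      show "tv (inst 0 (num z) (graph_fm f (num n # map num xs) (SS (Var 0)))) (computes f (n # xs) (Suc z))"
        using RMu.IH[of "n # xs" "Suc z"] by (simp add: graph_fm_inst)
    next
      show "wf_term (graph_fm f (num n # map num xs) (SS (Var 0)))" by (simp add: graph_fm_wf)
      show "fv (graph_fm f (num n # map num xs) (SS (Var 0))) \<subseteq> {..<1}" by (rule graph_fm_fv) auto
    qed
    from tv_and[OF Suc this]
    have "tv (?R (Suc n)) ((\<forall>m<n. \<exists>z. computes f (m # xs) (Suc z)) \<and> (\<exists>z. computes f (n # xs) (Suc z)))"
      by (intro tv_step[OF s1] tv_step[OF s2[unfolded r_def]] tv_step[OF s3[unfolded r_def]])
    then show ?case by (simp only: less_Suc_eq) (simp only: all_conj_distrib imp_disjL conj_ac all_simps simp_thms)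
  qed
  from tv_and[OF RMu.IH[of "y # xs" 0] this[of y]] show ?case by (simp add: computes_Mu del: map_map)
qed

lemma rec_enum_representable:
  assumes "rec_enum p"
  shows "\<exists>t. closed_term t \<and> wf_term t \<and> (\<forall>n. p n \<longleftrightarrow> derivable ({||} \<turnstile> t \<cdot> num n))"
proof -
  obtain f where f: "\<And>n. p n \<longleftrightarrow> (\<exists>y. computes f [n] y)"
    using assms by (auto simp: rec_enum_def)
  let ?b = "\<lambda>x. graph_fm f [x] (Var 0)"
  let ?t = "Lam (ex_fm (?b (Var 1)))"
  have "fv (?b (Var 1)) \<subseteq> {..<m + 2}" for m by (rule graph_fm_fv) auto
  then have "fv ?t \<subseteq> {..<m}" for m
    by (simp add: fv_Op_le fv_ex_fm One_nat_def numeral_eq_Suc del: fv.simps lessThan_Suc)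
  from this[of 0] have closed: "fv ?t = {}" by (simp only: lessThan_0 subset_empty)
  have wf: "wf_term ?t" by (simp add: graph_fm_wf)
  have "p n \<longleftrightarrow> derivable ({||} \<turnstile> ?t \<cdot> num n)" for n
  proof -
    have step: "?t \<cdot> num n \<triangleright> ex_fm (?b (num n))"
      using beta[OF wf_num, of "ex_fm (?b (Var 1))" n] by (simp add: inst_ex_fm graph_fm_inst One_nat_def)
    have "tv (ex_fm (?b (num n))) (\<exists>y. computes f [n] y)"
    proof (rule tv_ex)
      fix y
      show "tv (inst 0 (num y) (?b (num n))) (computes f [n] y)"
        using tv_graph_fm[of f "[n]" y] by (simp add: graph_fm_inst)
    next
      show "wf_term (?b (num n))" by (simp add: graph_fm_wf)
      show "fv (?b (num n)) \<subseteq> {..<1}" by (rule graph_fm_fv) auto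
    qed
    then have "tv (?t \<cdot> num n) (p n)" using tv_step[OF step] f by simp
    moreover have "fv (?t \<cdot> num n) = {}" using closed by simp
    \<comment> \<open>A derivation gives value 1 by soundness, for which the term must be closed;
      from value 1, \<open>tv\<close> recovers \<open>p n\<close>.\<close>
    ultimately show ?thesis using derivable_closed_ev by (auto simp only: tv_def)
  qed
  then show ?thesis using closed wf by (auto simp only: closed_term_def)
qed

theorem theorem5p3:
  fixes p :: "nat \<Rightarrow> bool"
  shows "rec_enum p \<longleftrightarrow>
    (\<exists>t. closed_term t \<and> wf_term t \<and> (\<forall>n. p n \<longleftrightarrow> derivable ({||} \<turnstile> t \<cdot> num n)))"
proof
  show "rec_enum p \<Longrightarrow>
      \<exists>t. closed_term t \<and> wf_term t \<and> (\<forall>n. p n \<longleftrightarrow> derivable ({||} \<turnstile> t \<cdot> num n))"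
    by (rule rec_enum_representable)
next
  assume "\<exists>t. closed_term t \<and> wf_term t \<and> (\<forall>n. p n \<longleftrightarrow> derivable ({||} \<turnstile> t \<cdot> num n))"
  then obtain t where "p = (\<lambda>n. derivable ({||} \<turnstile> t \<cdot> num n))" by auto
  then show "rec_enum p" by (simp only: derivable_rec_enum)
qed

end
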